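(* Let $\ell\ge r\ge2$ be integers, $Q$ be an $r$-graph, and $F$ be a graph with $\chi(F)=\ell+1$. If $K_{\ell+1}$ is $\partial_{r-2}Q$-edge-stable with respect to $\mathfrak{K}_\ell^2$, then $H_F^r$ is $Q$-edge-stable with respect to $\mathfrak{K}_\ell^r$. Moreover, if $\partial_{r-2}Q$ is $K_{\ell+1}$-Turán-stable, then $Q$ is $H_F^r$-Turán-stable.
   Context: An $r$-graph is a set of $r$-subsets of a finite vertex set. $\mathrm{inj}(Q,\mathcal{H})$ counts injective maps $V(Q)\to V(\mathcal{H})$ sending edges to edges; $\mathrm{inj}(n,Q,\mathcal{F})=\max\{\mathrm{inj}(Q,\mathcal{H}):v(\mathcal{H})=n,\ \mathcal{H}\ \mathcal{F}\text{-free}\}$. $\partial_{r-2}Q$ is the graph of all pairs contained in some edge of $Q$ ($\partial_0Q=Q$ for $r=2$). $\mathfrak{K}_\ell^r$ is the family of $r$-graphs with a homomorphism to $K_\ell^r$. The expansion $H_F^r$ adds $r-2$ new vertices to each edge of $F$, these sets pairwise disjoint ($H_F^2=F$). $T^r(n,\ell)$ is the balanced complete $\ell$-partite $r$-graph on $[n]$ ($T(n,\ell)=T^2(n,\ell)$). For an $r$-graph $Q$ and family $\mathcal{F}$, $\mathcal{F}$ is $Q$-edge-stable w.r.t. $\mathfrak{K}_\ell^r$ if for every $\varepsilon>0$ there exist $\delta>0,N_0$ such that every $\mathcal{F}$-free $r$-graph $\mathcal{H}$ on $n\ge N_0$ vertices with $\mathrm{inj}(Q,\mathcal{H})\ge(1-\delta)\mathrm{inj}(n,Q,\mathcal{F})$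 lies in $\mathfrak{K}_\ell^r$ after removing at most $\varepsilon n^r$ edges. $Q$ is $H_F^r$-Turán-stable (with $\ell=\chi(F)-1$) if for every $\varepsilon>0$ there exist $\delta>0,N_0$ such that every $H_F^r$-free $r$-graph $\mathcal{H}$ on $n\ge N_0$ vertices with $\mathrm{inj}(Q,\mathcal{H})\ge(1-\delta)\mathrm{inj}(n,Q,H_F^r)$ can be made into a copy of $T^r(n,\ell)$ by deleting and adding at most $\varepsilon n^r$ edges; in particular ($r=2$, $F=K_{\ell+1}$) a graph $Q'$ is $K_{\ell+1}$-Turán-stable if the same holds for $K_{\ell+1}$-free graphs and $T(n,\ell)$. *)

theory Defs
  imports Complex_Main "HOL-Library.FuncSet"
begin

text \<open>A hypergraph is a pair of a vertex set and an edge set. Isolated vertices are allowed, and a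
  graph is a 2-graph.\<close>

type_synonym 'a hypergraph = "'a set \<times> 'a set set"

abbreviation verts :: "'a hypergraph \<Rightarrow> 'a set" where "verts \<equiv> fst"
abbreviation edges :: "'a hypergraph \<Rightarrow> 'a set set" where "edges \<equiv> snd"

definition r_graph :: "nat \<Rightarrow> 'a hypergraph \<Rightarrow> bool" where
  "r_graph r H \<longleftrightarrow> finite (verts H) \<and> (\<forall>e\<in>edges H. e \<subseteq> verts H \<and> card e = r)"

definition homomorphism :: "('a \<Rightarrow> 'b) \<Rightarrow> 'a hypergraph \<Rightarrow> 'b hypergraph \<Rightarrow> bool" where
  "homomorphism f G H \<longleftrightarrow> f ` verts G \<subseteq> verts H \<and> (\<forall>e\<in>edges G. f ` e \<in> edges H)"

definition isomorphic :: "'a hypergraph \<Rightarrow> 'b hypergraph \<Rightarrow> bool" where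
  "isomorphic G H \<longleftrightarrow>
     (\<exists>f. bij_betw f (verts G) (verts H) \<and> (\<lambda>e. f ` e) ` edges G = edges H)"

text \<open>Maps are taken in the extensional function space, so that each map on \<open>verts Q\<close> is counted
  exactly once.\<close>

definition inj_count :: "'a hypergraph \<Rightarrow> 'b hypergraph \<Rightarrow> nat" where
  "inj_count Q H =
     card {f \<in> verts Q \<rightarrow>\<^sub>E verts H. inj_on f (verts Q) \<and> homomorphism f Q H}"

text \<open>Freeness refers to not necessarily induced subhypergraphs.\<close>

definition free_of :: "'a hypergraph set \<Rightarrow> 'b hypergraph \<Rightarrow> bool" where
  "free_of \<F> H \<longleftrightarrow> \<not> (\<exists>F\<in>\<F>. \<exists>f. inj_on f (verts F) \<and> homomorphism f F H)"

text \<open>Host hypergraphs, over which a maximum is taken or stability is quantified, have natural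
  numbers as vertices; every finite hypergraph is isomorphic to one of these. The set under
  \<open>Max\<close> is finite, as \<open>inj_count Q H \<le> n ^ card (verts Q)\<close> for finite \<open>verts Q\<close>, and it
  is nonempty whenever every member of \<open>\<F>\<close> has an edge. The uniformity \<open>r\<close> is an explicit
  parameter since an edgeless \<open>Q\<close> does not determine it.\<close>

definition inj_max :: "nat \<Rightarrow> nat \<Rightarrow> 'a hypergraph \<Rightarrow> 'b hypergraph set \<Rightarrow> nat" where
  "inj_max r n Q \<F> =
     Max {inj_count Q H | H :: nat hypergraph.
            r_graph r H \<and> card (verts H) = n \<and> free_of \<F> H}"

definition complete_r_graph :: "nat \<Rightarrow> nat \<Rightarrow> nat hypergraph" where
  "complete_r_graph r l = ({1..l}, {e. e \<subseteq> {1..l} \<and> card e = r})"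

text \<open>Since edges of \<open>complete_r_graph r l\<close> have \<open>r\<close> elements, a homomorphism into it is
  injective on each edge of an \<open>r\<close>-graph.\<close>

definition colorable_family :: "nat \<Rightarrow> nat \<Rightarrow> 'a hypergraph set" where
  "colorable_family r l = {H. r_graph r H \<and> (\<exists>f. homomorphism f H (complete_r_graph r l))}"

text \<open>The parts are the residue classes modulo \<open>l\<close>, whose sizes in \<open>{1..n}\<close> differ by at most
  one.\<close>

definition turan_r_graph :: "nat \<Rightarrow> nat \<Rightarrow> nat \<Rightarrow> nat hypergraph" where
  "turan_r_graph r n l =
     ({1..n}, {e. e \<subseteq> {1..n} \<and> card e = r \<and> inj_on (\<lambda>v. v mod l) e})"

definition pair_shadow :: "'a hypergraph \<Rightarrow> 'a hypergraph" where
  "pair_shadow Q = (verts Q, {p. card p = 2 \<and> (\<exists>e\<in>edges Q. p \<subseteq> e)})"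

definition chromatic_number :: "'a hypergraph \<Rightarrow> nat" where
  "chromatic_number F =
     (LEAST k. \<exists>c :: 'a \<Rightarrow> nat. (\<forall>v\<in>verts F. c v < k) \<and>
        (\<forall>u v. {u, v} \<in> edges F \<longrightarrow> c u \<noteq> c v))"

text \<open>\<open>Inl v\<close> is an original vertex; \<open>Inr (e, i)\<close> with \<open>i < r - 2\<close> are the new vertices added to
  the edge \<open>e\<close>. For \<open>r = 2\<close> this is \<open>F\<close> up to the renaming \<open>Inl\<close>.\<close>

definition expansion :: "nat \<Rightarrow> 'a hypergraph \<Rightarrow> ('a + 'a set \<times> nat) hypergraph" where
  "expansion r F =
     (Inl ` verts F \<union> Inr ` (edges F \<times> {..<r - 2}),
      (\<lambda>e. Inl ` e \<union> Inr ` ({e} \<times> {..<r - 2})) ` edges F)"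

definition edge_stable ::
    "nat \<Rightarrow> 'a hypergraph \<Rightarrow> 'b hypergraph set \<Rightarrow> nat hypergraph set \<Rightarrow> bool" where
  "edge_stable r Q \<F> \<K> \<longleftrightarrow>
     (\<forall>\<epsilon>::real. \<epsilon> > 0 \<longrightarrow> (\<exists>\<delta>::real. \<delta> > 0 \<and> (\<exists>N0::nat.
        \<forall>n\<ge>N0. \<forall>H :: nat hypergraph.
          r_graph r H \<and> card (verts H) = n \<and> free_of \<F> H \<and>
          real (inj_count Q H) \<ge> (1 - \<delta>) * real (inj_max r n Q \<F>) \<longrightarrow>
          (\<exists>D \<subseteq> edges H. real (card D) \<le> \<epsilon> * real n ^ r \<and> (verts H, edges H - D) \<in> \<K>))))"

text \<open>Turned into a copy of the Turan hypergraph on the same vertex set: \<open>D\<close> is deleted, \<open>A\<close> is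
  added, and the bound is on the total number of changes.\<close>

definition turan_stable ::
    "nat \<Rightarrow> nat \<Rightarrow> 'a hypergraph \<Rightarrow> 'b hypergraph \<Rightarrow> bool" where
  "turan_stable r l Q G \<longleftrightarrow>
     (\<forall>\<epsilon>::real. \<epsilon> > 0 \<longrightarrow> (\<exists>\<delta>::real. \<delta> > 0 \<and> (\<exists>N0::nat.
        \<forall>n\<ge>N0. \<forall>H :: nat hypergraph.
          r_graph r H \<and> card (verts H) = n \<and> free_of {G} H \<and>
          real (inj_count Q H) \<ge> (1 - \<delta>) * real (inj_max r n Q {G}) \<longrightarrow>
          (\<exists>D A. D \<subseteq> edges H \<and> A \<subseteq> {e. e \<subseteq> verts H \<and> card e = r} - edges H \<and>
             real (card D + card A) \<le> \<epsilon> * real n ^ r \<and>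
             isomorphic (verts H, (edges H - D) \<union> A) (turan_r_graph r n l)))))"

end

theory Submission
  imports Defs
begin

text \<open>Delete from an expansion-free \<open>r\<close>-graph the few edges containing a pair whose edges can all
  be hit by a bounded set; the shadow of what remains is \<open>F\<close>-free. It remains to see that an
  \<open>F\<close>-free graph \<open>G\<close> with almost \<open>inj_max 2 n (pair_shadow Q) {K}\<close> copies of \<open>pair_shadow Q\<close>,
  where \<open>K\<close> is the complete graph on \<open>l + 1\<close> vertices, is nearly \<open>l\<close>-colorable. The removal
  lemma can be avoided by sampling: for a large constant \<open>m\<close> pull \<open>G\<close> back along a random map
  from \<open>{..<m}\<close> to the vertices of \<open>G\<close>. By Erdos' theorem on complete multipartite hypergraphs the
  pullback contains no \<open>K\<close> with high probability, and by averaging it almost always has almost the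
  extremal number of copies, so the assumed stability on \<open>m\<close> vertices makes it nearly
  \<open>l\<close>-colorable. But if \<open>G\<close> is far from \<open>l\<close>-colorable, then, for a constant \<open>k\<close>, a positive
  fraction of its \<open>k\<close>-tuples is not \<open>l\<close>-colorable.

  For the Turan version, edge stability yields an \<open>l\<close>-partite subhypergraph containing almost
  all edges of \<open>H\<close>. Its shadow is close to the Turan graph, and since every edge of the Turan
  \<open>r\<close>-graph lies in many copies of \<open>Q\<close>, few of these edges can be missing from \<open>H\<close>.\<close>

section \<open>Counting maps\<close>

text \<open>Two mismatches shape the argument. The hypothesis is about graphs without
  \<open>K\<close>, while \<open>G\<close> is only known to contain no \<open>F\<close>. Moreover
  its error is relative to an extremal number that may be 0 at every size, whereas deletions of
  edges cost a small multiple of n ^ v copies, where v is the number of vertices of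
  \<open>Q\<close>. Sampling settles both at once: at a constant size m the extremal number is an
  integer, so either it is 0 and every sample without \<open>K\<close> is trivially extremal, or it
  is at least 1 and absorbs an additive error chosen after m. Blow-ups carry the extremal number
  from m vertices to n. In the Turan version additive errors have to be turned back into relative
  ones. There Turan stability helps itself: the edgeless graph is far from the Turan graph, hence
  not near-extremal, so copies of the shadow exist and blow-ups give at least c n ^ v of them.
  Stability then also makes \<open>Q\<close> properly \<open>l\<close>-colorable, which is why each
  edge of the Turan \<open>r\<close>-graph lies in many copies of \<open>Q\<close>.\<close>

lemma finite_filter_PiE:
  assumes "finite A" "finite B"
  shows "finite {f \<in> A \<rightarrow>\<^sub>E B. P f}"
  by (rule finite_subset[OF _ finite_PiE[of A "\<lambda>_. B"]]) (use assms in auto)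

text \<open>As \<open>f\<close> is injective, a map on \<open>B\<close> amounts to its composite
  with \<open>f\<close> and arbitrary values outside the image of \<open>f\<close>. In probabilistic
  terms, a random map composed with a fixed injection is again uniformly random, which is what every
  sampling count below rests on.\<close>

lemma card_pullback:
  assumes "finite B" "finite V" "inj_on f A" "f ` A \<subseteq> B" "R \<subseteq> A \<rightarrow>\<^sub>E V"
  shows "card {\<phi> \<in> B \<rightarrow>\<^sub>E V. restrict (\<phi> \<circ> f) A \<in> R} = card R * card V ^ (card B - card A)"
proof -
  let ?C = "B - f ` A"
  let ?S = "{\<phi> \<in> B \<rightarrow>\<^sub>E V. restrict (\<phi> \<circ> f) A \<in> R}"
  let ?glue = "\<lambda>(g, \<psi>). \<lambda>b\<in>B. if b \<in> f ` A then g (inv_into A f b) else \<psi> b"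
  have inv: "inv_into A f (f a) = a" if "a \<in> A" for a
    using assms(3) that by simp
  have "bij_betw (\<lambda>\<phi>. (restrict (\<phi> \<circ> f) A, restrict \<phi> ?C)) ?S (R \<times> (?C \<rightarrow>\<^sub>E V))"
  proof (rule bij_betw_byWitness[where f' = ?glue])
    show "\<forall>\<phi>\<in>?S. ?glue (restrict (\<phi> \<circ> f) A, restrict \<phi> ?C) = \<phi>"
    proof
      fix \<phi> assume "\<phi> \<in> ?S"
      then have p: "\<phi> \<in> B \<rightarrow>\<^sub>E V" by simp
      show "?glue (restrict (\<phi> \<circ> f) A, restrict \<phi> ?C) = \<phi>"
      proof
        fix b
        show "?glue (restrict (\<phi> \<circ> f) A, restrict \<phi> ?C) b = \<phi> b"
          using p inv PiE_arb[OF p] by auto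
      qed
    qed
    show "\<forall>p\<in>R \<times> (?C \<rightarrow>\<^sub>E V). (restrict (?glue p \<circ> f) A, restrict (?glue p) ?C) = p"
    proof
      fix p assume "p \<in> R \<times> (?C \<rightarrow>\<^sub>E V)"
      then obtain g \<psi> where p: "p = (g, \<psi>)" and g: "g \<in> A \<rightarrow>\<^sub>E V" and h: "\<psi> \<in> ?C \<rightarrow>\<^sub>E V"
        using assms(5) by auto
      have "restrict (?glue p \<circ> f) A = g"
      proof
        fix a show "restrict (?glue p \<circ> f) A a = g a"
          using p g inv assms(4) PiE_arb[OF g] by auto
      qed
      moreover have "restrict (?glue p) ?C = \<psi>"
      proof
        fix a show "restrict (?glue p) ?C a = \<psi> a"
          using p h PiE_arb[OF h] by (auto simp: restrict_def)
      qed
      ultimately show "(restrict (?glue p \<circ> f) A, restrict (?glue p) ?C) = p"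
        using p by simp
    qed
    show "(\<lambda>\<phi>. (restrict (\<phi> \<circ> f) A, restrict \<phi> ?C)) ` ?S \<subseteq> R \<times> (?C \<rightarrow>\<^sub>E V)"
      by (auto simp: PiE_mem)
    show "?glue ` (R \<times> (?C \<rightarrow>\<^sub>E V)) \<subseteq> ?S"
    proof
      fix x assume "x \<in> ?glue ` (R \<times> (?C \<rightarrow>\<^sub>E V))"
      then obtain g \<psi> where x: "x = ?glue (g, \<psi>)" and gR: "g \<in> R" and h: "\<psi> \<in> ?C \<rightarrow>\<^sub>E V"
        by auto
      have g: "g \<in> A \<rightarrow>\<^sub>E V" using gR assms(5) by auto
      have "restrict (x \<circ> f) A = g"
      proof
        fix a show "restrict (x \<circ> f) A a = g a"
          using x g inv assms(4) PiE_arb[OF g] by auto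
      qed
      moreover have "x \<in> B \<rightarrow>\<^sub>E V"
        unfolding x using PiE_mem[OF g] PiE_mem[OF h] inv by auto
      ultimately show "x \<in> ?S" using gR by simp
    qed
  qed
  then have "card ?S = card (R \<times> (?C \<rightarrow>\<^sub>E V))"
    by (rule bij_betw_same_card)
  also have "\<dots> = card R * card V ^ card ?C"
    using assms by (simp add: card_cartesian_product card_PiE)
  also have "card ?C = card B - card A"
    using assms card_image[OF assms(3)] by (simp add: card_Diff_subset finite_subset[OF assms(4)])
  finally show ?thesis .
qed

text \<open>Greedy choice: when a point receives its value, fewer than \<open>card X\<close> values
  are taken, so at least \<open>s\<close> remain.\<close>

lemma card_inj_PiE_ge:
  assumes "finite X" "\<And>x. x \<in> X \<Longrightarrow> finite (B x)" "\<And>x. x \<in> X \<Longrightarrow> s + card X \<le> card (B x)"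
  shows "s ^ card X \<le> card {f \<in> PiE X B. inj_on f X}"
  using assms
proof (induction X rule: finite_induct)
  case empty
  then show ?case by simp
next
  case (insert x X)
  let ?T = "{f \<in> PiE X B. inj_on f X}"
  let ?S = "{f \<in> PiE (insert x X) B. inj_on f (insert x X)}"
  let ?Z = "SIGMA f : ?T. B x - f ` X"
  have fT: "finite ?T"
    by (rule finite_subset[OF _ finite_PiE[of X B]]) (use insert.prems insert.hyps in auto)
  have fS: "finite ?S"
    by (rule finite_subset[OF _ finite_PiE[of "insert x X" B]]) (use insert.prems insert.hyps in
      auto)
  have fB: "finite (B x)" using insert.prems by simp
  have IH: "s ^ card X \<le> card ?T"
    using insert.prems insert.hyps by (intro insert.IH) fastforce+
  have "s \<le> card (B x - f ` X)" for f
  proof -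
    have "card (B x) - card (f ` X) \<le> card (B x - f ` X)"
      using insert.hyps by (intro diff_card_le_card_Diff) simp
    moreover have "card (f ` X) \<le> card X" using insert.hyps card_image_le by blast
    moreover have "s + Suc (card X) \<le> card (B x)" using insert by simp
    ultimately show ?thesis by linarith
  qed
  then have "(\<Sum>f\<in>?T. s) \<le> (\<Sum>f\<in>?T. card (B x - f ` X))" by (intro sum_mono) auto
  then have "s ^ card X * s \<le> card ?Z"
    using IH fT fB by (simp add: card_SigmaI) (meson le_trans mult_le_mono1)
  moreover have "card ?Z \<le> card ?S"
  proof (rule card_inj_on_le[where f = "\<lambda>(f, y). f(x := y)"])
    show "inj_on (\<lambda>(f, y). f(x := y)) ?Z"
    proof (rule inj_onI, clarify)
      fix f y g z
      assume f: "f \<in> PiE X B" and g: "g \<in> PiE X B" and eq: "f(x := y) = g(x := z)"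
      have "f a = g a" for a
        using fun_cong[OF eq, of a] insert.hyps(2) PiE_arb[OF f] PiE_arb[OF g]
        by (cases "a = x") auto
      then show "f = g \<and> y = z" using fun_cong[OF eq, of x] by auto
    qed
    show "(\<lambda>(f, y). f(x := y)) ` ?Z \<subseteq> ?S"
    proof clarify
      fix f y assume f: "f \<in> PiE X B" "inj_on f X" "y \<in> B x" "y \<notin> f ` X"
      have "f(x := y) \<in> PiE (insert x X) B" using f by (auto simp: PiE_mem PiE_iff extensional_def)
      moreover have "inj_on (f(x := y)) (insert x X)"
        using f insert.hyps(2) by (auto simp: inj_on_def)
      ultimately show "f(x := y) \<in> PiE (insert x X) B \<and> inj_on (f(x := y)) (insert x X)" by simp
    qed
    show "finite ?S" by (fact fS)
  qed
  ultimately show ?case using insert.hyps by (simp add: mult.commute)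
qed

lemma card_supersets_le:
  assumes "finite V" "p \<subseteq> V" "card p \<le> r"
  shows "card {e. e \<subseteq> V \<and> card e = r \<and> p \<subseteq> e} \<le> card V ^ (r - card p)"
proof -
  have fp: "finite p" using assms finite_subset by blast
  have "card {e. e \<subseteq> V \<and> card e = r \<and> p \<subseteq> e} \<le> card {e. e \<subseteq> V \<and> card e = r - card p}"
  proof (rule card_inj_on_le[where f = "\<lambda>e. e - p"])
    show "inj_on (\<lambda>e. e - p) {e. e \<subseteq> V \<and> card e = r \<and> p \<subseteq> e}"
      by (auto simp: inj_on_def)
    show "(\<lambda>e. e - p) ` {e. e \<subseteq> V \<and> card e = r \<and> p \<subseteq> e} \<subseteq> {e. e \<subseteq> V \<and> card e = r - card p}"
      using fp by (auto simp: card_Diff_subset)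
    show "finite {e. e \<subseteq> V \<and> card e = r - card p}" using assms by simp
  qed
  also have "\<dots> = card V choose (r - card p)" using n_subsets[OF assms(1)] by simp
  also have "\<dots> \<le> card V ^ (r - card p)"
    by (cases "r - card p \<le> card V") (auto simp: binomial_le_pow binomial_eq_0)
  finally show ?thesis .
qed

text \<open>Each of the \<open>r\<close> points of \<open>e\<close> must go into \<open>d\<close>,
  and all other points are free.\<close>

lemma card_maps_edge_le:
  assumes "finite A" "finite V" "e \<subseteq> A" "card e = r" "finite d" "card d = r" "d \<subseteq> V"
  shows "card {f \<in> A \<rightarrow>\<^sub>E V. f ` e = d} \<le> r ^ r * card V ^ (card A - r)"
proof -
  let ?B = "\<lambda>x. if x \<in> e then d else V"
  have "{f \<in> A \<rightarrow>\<^sub>E V. f ` e = d} \<subseteq> PiE A ?B" using assms(3) by (auto simp: PiE_iff extensional_def)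
  moreover have "finite (PiE A ?B)" using assms by (intro finite_PiE) auto
  ultimately have "card {f \<in> A \<rightarrow>\<^sub>E V. f ` e = d} \<le> card (PiE A ?B)" by (rule card_mono[rotated])
  also have "\<dots> = (\<Prod>x\<in>A. card (?B x))" using assms(1) by (rule card_PiE)
  also have "\<dots> = (\<Prod>x\<in>e. card (?B x)) * (\<Prod>x\<in>A - e. card (?B x))"
    using prod.subset_diff[OF assms(3,1)] by (metis mult.commute)
  also have "(\<Prod>x\<in>e. card (?B x)) = r ^ r" using assms by simp
  also have "(\<Prod>x\<in>A - e. card (?B x)) = card V ^ (card A - r)"
    using assms by (simp add: card_Diff_subset finite_subset[OF assms(3)])
  finally show ?thesis .
qed

lemma card_maps_hitting_le:
  assumes "finite A" "finite V" "finite D" "finite S"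
    "\<And>e. e \<in> S \<Longrightarrow> e \<subseteq> A \<and> card e = r" "\<And>d. d \<in> D \<Longrightarrow> d \<subseteq> V \<and> card d = r"
  shows "card {f \<in> A \<rightarrow>\<^sub>E V. \<exists>e\<in>S. f ` e \<in> D} \<le> card S * card D * (r ^ r * card V ^ (card A - r))"
proof -
  have "{f \<in> A \<rightarrow>\<^sub>E V. \<exists>e\<in>S. f ` e \<in> D} = (\<Union>(e, d)\<in>S \<times> D. {f \<in> A \<rightarrow>\<^sub>E V. f ` e = d})"
    by auto
  then have "card {f \<in> A \<rightarrow>\<^sub>E V. \<exists>e\<in>S. f ` e \<in> D}
      \<le> (\<Sum>(e, d)\<in>S \<times> D. card {f \<in> A \<rightarrow>\<^sub>E V. f ` e = d})"
    using card_UN_le[of "S \<times> D" "\<lambda>(e, d). {f \<in> A \<rightarrow>\<^sub>E V. f ` e = d}"] assms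
    by (simp add: case_prod_unfold)
  also have "\<dots> \<le> (\<Sum>(e, d)\<in>S \<times> D. r ^ r * card V ^ (card A - r))"
  proof (rule sum_mono, clarify)
    fix e d assume "e \<in> S" "d \<in> D"
    then show "card {f \<in> A \<rightarrow>\<^sub>E V. f ` e = d} \<le> r ^ r * card V ^ (card A - r)"
      using assms by (intro card_maps_edge_le) (auto intro: finite_subset)
  qed
  also have "\<dots> = card S * card D * (r ^ r * card V ^ (card A - r))"
    by (simp add: card_cartesian_product)
  finally show ?thesis .
qed

section \<open>Complete multipartite patterns and uncolorable samples\<close>

text \<open>The complete \<open>k\<close>-partite \<open>k\<close>-uniform hypergraph with parts of
  size \<open>t\<close>, as a set of ordered tuples. Disjointness of the parts is not built in; for
  tuples coming from cliques it is regained from the fact that adjacent vertices are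
  distinct.\<close>

definition contains_box :: "nat \<Rightarrow> nat \<Rightarrow> 'a list set \<Rightarrow> bool" where
  "contains_box k t E \<longleftrightarrow> (\<exists>A. (\<forall>i<k. finite (A i) \<and> card (A i) = t) \<and>
     (\<forall>xs. length xs = k \<longrightarrow> (\<forall>i<k. xs ! i \<in> A i) \<longrightarrow> xs \<in> E))"

text \<open>Induction on \<open>k\<close>, splitting off the first coordinate. Fix \<open>M\<close>
  first coordinates of large degree. By double counting, many \<open>k\<close>-tuples extend by at
  least \<open>t\<close> of them; by pigeonhole a dense family of tuples has the same set of
  extensions, and the induction hypothesis finds a box in this family.\<close>

lemma erdos_box:
  fixes \<beta> :: real
  assumes "0 < \<beta>"
  shows "\<exists>N0::nat. \<forall>(V::'a set) E. finite V \<longrightarrow> N0 \<le> card V \<longrightarrow>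
     E \<subseteq> {xs. set xs \<subseteq> V \<and> length xs = k} \<longrightarrow> \<beta> * real (card V) ^ k \<le> real (card E) \<longrightarrow>
     contains_box k t E"
  using assms
proof (induction k arbitrary: \<beta>)
  case 0
  have "[] \<in> E" if "E \<subseteq> {xs::'a list. set xs \<subseteq> V \<and> length xs = 0}" "\<beta> * real (card V) ^ 0
    \<le> real (card E)" for V E
  proof -
    have "E \<noteq> {}" using that 0 by auto
    then show ?thesis using that by auto
  qed
  then show ?case by (intro exI[of _ 0]) (auto simp: contains_box_def)
next
  case (Suc k)
  \<comment> \<open>This \<open>M\<close> makes the tuples with fewer than \<open>t\<close>
    extensions account for at most half of the incidences counted below.\<close>
  define M where "M = nat \<lceil>4 * real t / \<beta>\<rceil> + 1"
  have M: "4 * real t / \<beta> \<le> real M" "0 < M" unfolding M_def by linarith+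
  have tM: "real t \<le> \<beta> / 4 * real M" using M Suc.prems by (simp add: field_simps)
  \<comment> \<open>A density of \<beta> / 4 of tuples with at least \<open>t\<close> extensions is
    shared among 2 ^ M possible extension sets.\<close>
  define \<gamma> where "\<gamma> = \<beta> / 4 / 2 ^ M"
  have \<gamma>: "0 < \<gamma>" using Suc.prems by (simp add: \<gamma>_def)
  from Suc.IH[OF \<gamma>] obtain N1 where N1: "\<And>(V::'a set) E. finite V \<Longrightarrow> N1 \<le> card V \<Longrightarrow>
     E \<subseteq> {xs. set xs \<subseteq> V \<and> length xs = k} \<Longrightarrow> \<gamma> * real (card V) ^ k \<le> real (card E) \<Longrightarrow>
     contains_box k t E"
    by blast
  define N0 where "N0 = max (Suc N1) (nat \<lceil>2 * real M / \<beta>\<rceil>)"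
  show ?case
  proof (intro exI[of _ N0] allI impI)
    fix V :: "'a set" and E
    assume fV: "finite V" and N0: "N0 \<le> card V"
      and E: "E \<subseteq> {xs. set xs \<subseteq> V \<and> length xs = Suc k}"
      and dens: "\<beta> * real (card V) ^ Suc k \<le> real (card E)"
    define n where "n = card V"
    have n: "N1 \<le> n" "0 < n" "2 * real M / \<beta> \<le> real n" using N0 unfolding N0_def n_def by linarith+
    have nM: "real M \<le> \<beta> / 2 * real n" using n Suc.prems by (simp add: field_simps)
    define Y where "Y = {ys::'a list. set ys \<subseteq> V \<and> length ys = k}"
    have fY: "finite Y" unfolding Y_def using fV by (rule finite_lists_length_eq)
    have cY: "card Y = n ^ k" unfolding Y_def n_def using fV by (rule card_lists_length_eq)
    define deg where "deg v = card {ys \<in> Y. v # ys \<in> E}" for v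
    have deg_le: "deg v \<le> n ^ k" for v
      unfolding deg_def cY[symmetric] using fY by (intro card_mono) auto
    have "E \<subseteq> (\<lambda>(v, ys). v # ys) ` (SIGMA v:V. {ys \<in> Y. v # ys \<in> E})"
    proof
      fix xs assume xs: "xs \<in> E"
      moreover have "set xs \<subseteq> V \<and> length xs = Suc k" using xs E by blast
      ultimately obtain v ys where "xs = v # ys" "v \<in> V" "set ys \<subseteq> V" "length ys = k"
        by (cases xs) auto
      then show "xs \<in> (\<lambda>(v, ys). v # ys) ` (SIGMA v:V. {ys \<in> Y. v # ys \<in> E})"
        using xs by (intro image_eqI[of _ _ "(v, ys)"]) (auto simp: Y_def)
    qed
    then have "card E \<le> card (SIGMA v:V. {ys \<in> Y. v # ys \<in> E})"
      by (rule surj_card_le[rotated]) (use fV fY in auto)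
    then have cE: "card E \<le> (\<Sum>v\<in>V. deg v)"
      using fV fY by (simp add: deg_def)
    \<comment> \<open>Vertices of at least half the average degree. There are at least \<beta> / 2 *
      n of them, hence at least \<open>M\<close> by the choice of \<open>N0\<close>.\<close>
    define Gd where "Gd = {v \<in> V. \<beta> / 2 * real n ^ k \<le> real (deg v)}"
    have fG: "finite Gd" using fV by (simp add: Gd_def)
    have "real (\<Sum>v\<in>V. deg v) = (\<Sum>v\<in>Gd. real (deg v)) + (\<Sum>v\<in>V - Gd. real (deg v))"
      using sum.subset_diff[of Gd V "\<lambda>v. real (deg v)"] fV by (simp add: Gd_def)
    also have "(\<Sum>v\<in>Gd. real (deg v)) \<le> (\<Sum>v\<in>Gd. real n ^ k)"
      using deg_le by (intro sum_mono) (metis of_nat_le_iff of_nat_power)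
    also have "(\<Sum>v\<in>V - Gd. real (deg v)) \<le> (\<Sum>v\<in>V - Gd. \<beta> / 2 * real n ^ k)"
      by (intro sum_mono) (auto simp: Gd_def)
    also have "\<dots> \<le> (\<Sum>v\<in>V. \<beta> / 2 * real n ^ k)"
      using fV Suc.prems by (intro sum_mono2) auto
    finally have "\<beta> * real n ^ Suc k \<le> real (card Gd) * real n ^ k + real n * (\<beta> / 2 * real n ^ k)"
      using dens cE unfolding n_def by (simp add: of_nat_sum[symmetric] del: of_nat_sum)
    then have "(\<beta> / 2 * real n) * real n ^ k \<le> real (card Gd) * real n ^ k"
      by (simp add: algebra_simps)
    then have "\<beta> / 2 * real n \<le> real (card Gd)" using n by (simp add: mult_le_cancel_right)
    then have "M \<le> card Gd" using nM by linarith
    then obtain S where S: "S \<subseteq> Gd" "card S = M" using obtain_subset_with_card_n by metis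
    have fS: "finite S" using S fG finite_subset by blast
    define tr where "tr y = {v \<in> S. v # y \<in> E}" for y
    have tr_le: "card (tr y) \<le> M" for y
      unfolding tr_def S(2)[symmetric] using fS by (intro card_mono) auto
    define Yg where "Yg = {y \<in> Y. t \<le> card (tr y)}"
    have fYg: "finite Yg" using fY by (simp add: Yg_def)
    have "(\<Sum>v\<in>S. deg v) = (\<Sum>v\<in>S. \<Sum>y\<in>Y. if v # y \<in> E then 1 else 0)"
      using fY by (simp add: deg_def flip: sum.inter_filter)
    also have "\<dots> = (\<Sum>y\<in>Y. card (tr y))"
      using fS by (subst sum.swap) (simp add: tr_def flip: sum.inter_filter)
    finally have dc: "(\<Sum>v\<in>S. real (deg v)) = (\<Sum>y\<in>Y. real (card (tr y)))"
      by (metis of_nat_sum)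
    have "real M * (\<beta> / 2 * real n ^ k) \<le> (\<Sum>v\<in>S. real (deg v))"
      using sum_bounded_below[of S "\<beta> / 2 * real n ^ k" "\<lambda>v. real (deg v)"] S by (auto simp: Gd_def)
    also have "\<dots> = (\<Sum>y\<in>Yg. real (card (tr y))) + (\<Sum>y\<in>Y - Yg. real (card (tr y)))"
      unfolding dc using sum.subset_diff[of Yg Y "\<lambda>v. real (card (tr v))"] fY by (simp add: Yg_def)
    also have "(\<Sum>y\<in>Yg. real (card (tr y))) \<le> (\<Sum>y\<in>Yg. real M)"
      using tr_le by (intro sum_mono) simp
    also have "(\<Sum>y\<in>Y - Yg. real (card (tr y))) \<le> (\<Sum>y\<in>Y - Yg. real t)"
      by (intro sum_mono) (auto simp: Yg_def)
    also have "\<dots> \<le> (\<Sum>y\<in>Y. real t)"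
      using fY by (intro sum_mono2) auto
    finally have "real M * (\<beta> / 2 * real n ^ k) \<le> real (card Yg) * real M + real n ^ k * real t"
      by (simp add: cY)
    also have "\<dots> \<le> real (card Yg) * real M + real n ^ k * (\<beta> / 4 * real M)"
      using tM by (intro add_left_mono mult_left_mono) auto
    finally have "(\<beta> / 4 * real n ^ k) * real M \<le> real (card Yg) * real M"
      by (simp add: algebra_simps)
    then have Yg: "\<beta> / 4 * real n ^ k \<le> real (card Yg)" using M by (simp add: mult_le_cancel_right)
    have "\<exists>B\<in>Pow S. \<gamma> * real n ^ k \<le> real (card {y \<in> Yg. tr y = B})"
    proof (rule ccontr)
      assume neg: "\<not> ?thesis"
      have "tr y \<in> Pow S" for y by (auto simp: tr_def)
      then have "Yg = (\<Union>B\<in>Pow S. {y \<in> Yg. tr y = B})" by blast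
      then have "card Yg \<le> (\<Sum>B\<in>Pow S. card {y \<in> Yg. tr y = B})"
        using card_UN_le[of "Pow S" "\<lambda>B. {y \<in> Yg. tr y = B}"] fS by simp
      then have "real (card Yg) \<le> (\<Sum>B\<in>Pow S. real (card {y \<in> Yg. tr y = B}))"
        unfolding of_nat_sum[symmetric] of_nat_le_iff .
      also have "\<dots> < (\<Sum>B\<in>Pow S. \<gamma> * real n ^ k)"
        using neg fS by (intro sum_strict_mono) (auto simp: not_le)
      also have "\<dots> = \<beta> / 4 * real n ^ k" using fS S by (simp add: card_Pow \<gamma>_def)
      finally show False using Yg by simp
    qed
    then obtain B where B: "B \<subseteq> S" "\<gamma> * real n ^ k \<le> real (card {y \<in> Yg. tr y = B})" by blast
    have "0 < \<gamma> * real n ^ k" using \<gamma> n by simp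
    then have "{y \<in> Yg. tr y = B} \<noteq> {}" using B by (metis card.empty not_le of_nat_0)
    then have "t \<le> card B" by (auto simp: Yg_def)
    then obtain B' where B': "B' \<subseteq> B" "card B' = t" "finite B'" using obtain_subset_with_card_n
      by metis
    have "{y \<in> Yg. tr y = B} \<subseteq> {xs. set xs \<subseteq> V \<and> length xs = k}" by (auto simp: Yg_def Y_def)
    from N1[OF fV _ this] B n have "contains_box k t {y \<in> Yg. tr y = B}" unfolding n_def by blast
    then obtain A where A: "\<forall>i<k. finite (A i) \<and> card (A i) = t"
      "\<And>xs. length xs = k \<Longrightarrow> (\<forall>i<k. xs ! i \<in> A i) \<Longrightarrow> xs \<in> {y \<in> Yg. tr y = B}"
      unfolding contains_box_def by blast
    show "contains_box (Suc k) t E"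
      unfolding contains_box_def
    proof (intro exI[of _ "\<lambda>i. case i of 0 \<Rightarrow> B' | Suc j \<Rightarrow> A j"] conjI allI impI)
      fix i assume "i < Suc k"
      then show "finite (case i of 0 \<Rightarrow> B' | Suc j \<Rightarrow> A j)" "card (case i of 0 \<Rightarrow> B' | Suc j \<Rightarrow> A j)
        = t"
        using A B' by (auto split: nat.split)
    next
      fix xs :: "'a list" assume len: "length xs = Suc k"
        and all: "\<forall>i<Suc k. xs ! i \<in> (case i of 0 \<Rightarrow> B' | Suc j \<Rightarrow> A j)"
      obtain v ys where xs: "xs = v # ys" using len by (cases xs) auto
      have "v \<in> B'" using all xs by force
      moreover have "ys \<in> {y \<in> Yg. tr y = B}" using all xs len by (intro A(2)) force+
      ultimately show "xs \<in> E" using B' xs by (auto simp: tr_def)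
    qed
  qed
qed

text \<open>A coloring is a relation \<open>C\<close> rather than a function: when tuples with repeated entries are
  colored by positions, a vertex may receive several colors.\<close>

definition multi_colorable :: "'a set set \<Rightarrow> ('a \<Rightarrow> 'c set) \<Rightarrow> 'a set \<Rightarrow> bool" where
  "multi_colorable E L X \<longleftrightarrow> (\<exists>C. X \<subseteq> fst ` C \<and> (\<forall>(u, a)\<in>C. a \<in> L u) \<and>
     (\<forall>(u, a)\<in>C. \<forall>(v, b)\<in>C. {u, v} \<in> E \<longrightarrow> a \<noteq> b))"

lemma multi_colorable_mono: "multi_colorable E L X \<Longrightarrow> Y \<subseteq> X \<Longrightarrow> multi_colorable E L Y"
  unfolding multi_colorable_def by blast

section \<open>Short vertex lists that witness distance from colorability\<close>

lemma card_append:
  assumes "A \<subseteq> {xs. length xs = a}"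
  shows "card ((\<lambda>(x, y). x @ y) ` (A \<times> B)) = card A * card B"
proof -
  have "inj_on (\<lambda>(x, y). x @ y) (A \<times> B)"
  proof (rule inj_onI, clarify)
    fix x y x' y' assume *: "x \<in> A" "x' \<in> A" "x @ y = x' @ y'"
    then have "length x = a" "length x' = a" using assms by auto
    then show "x = x' \<and> y = y'" using * by simp
  qed
  then show ?thesis by (simp add: card_image card_cartesian_product)
qed

text \<open>Otherwise a coloring with few bad edges exists. Let \<open>W\<close> be the small set of
  vertices counted in the conclusion. Every other vertex \<open>u\<close> has a color in its list
  that occurs in the lists of few neighbors; use it. A bad edge then meets \<open>W\<close>, or it
  joins \<open>u\<close> to one of the fewer than \<alpha> n neighbors whose lists contain the color
  of \<open>u\<close>. This gives at most 2 \<alpha> n ^ 2 bad edges.\<close>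

lemma many_list_reducing_vertices:
  fixes \<alpha> :: real
  assumes V: "finite V" and E: "\<And>e. e \<in> E \<Longrightarrow> e \<subseteq> V \<and> card e = 2" and K: "K \<noteq> {}"
    and \<alpha>: "0 < \<alpha>"
    and far: "\<And>c. (\<forall>v\<in>V. c v \<in> K) \<Longrightarrow> 2 * \<alpha> * real (card V) ^ 2 < real (card {e \<in> E. \<not> inj_on c e})"
    and L: "\<And>v. v \<in> V \<Longrightarrow> L v \<subseteq> K"
  shows "\<alpha> * real (card V) \<le>
    real (card {u \<in> V. \<forall>i\<in>L u. \<alpha> * real (card V) \<le> real (card {w \<in> V. {u, w} \<in> E \<and> i \<in> L w})})"
proof (rule ccontr)
  define n where "n = card V"
  define N where "N u i = {w \<in> V. {u, w} \<in> E \<and> i \<in> L w}" for u i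
  define W where "W = {u \<in> V. \<forall>i\<in>L u. \<alpha> * real n \<le> real (card (N u i))}"
  assume "\<not> ?thesis"
  then have W: "real (card W) < \<alpha> * real n" by (simp add: W_def N_def n_def)
  obtain k where k: "k \<in> K" using K by blast
  \<comment> \<open>Vertices with an empty list lie in \<open>W\<close> vacuously, so the choice
    outside \<open>W\<close> is always possible. On \<open>W\<close> any color of \<open>K\<close>
    will do.\<close>
  define c where "c u = (if u \<in> W then k else SOME i. i \<in> L u
    \<and> real (card (N u i)) < \<alpha> * real n)" for u
  have c: "c u \<in> L u \<and> real (card (N u (c u))) < \<alpha> * real n" if "u \<in> V - W" for u
  proof -
    have "\<exists>i. i \<in> L u \<and> real (card (N u i)) < \<alpha> * real n" using that by (auto simp: W_def not_le)
    from someI_ex[OF this] show ?thesis using that by (simp add: c_def)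
  qed
  have fN: "finite (N u i)" for u i using V by (simp add: N_def)
  have WV: "W \<subseteq> V" by (auto simp: W_def)
  have cK: "\<forall>v\<in>V. c v \<in> K"
  proof
    fix v assume "v \<in> V"
    then show "c v \<in> K" using c[of v] L[of v] k by (cases "v \<in> W") (auto simp: c_def)
  qed
  have "{e \<in> E. \<not> inj_on c e} \<subseteq> (\<lambda>(u, w). {u, w}) ` (W \<times> V) \<union> (\<Union>u\<in>V - W. (\<lambda>w. {u, w}) ` N u (c u))"
  proof clarify
    fix e assume e: "e \<in> E" "\<not> inj_on c e"
      and no: "e \<notin> (\<Union>u\<in>V - W. (\<lambda>w. {u, w}) ` N u (c u))"
    obtain u w where uw: "e = {u, w}" "u \<noteq> w" using E[OF e(1)] by (meson card_2_iff)
    have V2: "u \<in> V" "w \<in> V" using E[OF e(1)] uw by auto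
    have cc: "c u = c w" using e uw by (auto simp: inj_on_def)
    show "e \<in> (\<lambda>(u, w). {u, w}) ` (W \<times> V)"
    proof (cases "u \<in> W \<or> w \<in> W")
      case True
      then show ?thesis using uw V2 by (auto simp: image_iff insert_commute)
    next
      case False
      then have "w \<in> N u (c u)" using c[of w] V2 e uw cc by (auto simp: N_def)
      then have "e \<in> (\<Union>u\<in>V - W. (\<lambda>w. {u, w}) ` N u (c u))" using False V2 uw by auto
      then show ?thesis using no by simp
    qed
  qed
  then have "card {e \<in> E. \<not> inj_on c e}
     \<le> card ((\<lambda>(u, w). {u, w}) ` (W \<times> V) \<union> (\<Union>u\<in>V - W. (\<lambda>w. {u, w}) ` N u (c u)))"
    using V WV fN by (intro card_mono) (auto intro: finite_subset)
  also have "\<dots> \<le> card ((\<lambda>(u, w). {u, w}) ` (W \<times> V)) + card (\<Union>u\<in>V - W. (\<lambda>w. {u, w}) ` N u (c u))"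
    by (rule card_Un_le)
  also have "card ((\<lambda>(u, w). {u, w}) ` (W \<times> V)) \<le> card W * n"
    unfolding n_def card_cartesian_product[symmetric] using V WV
    by (intro card_image_le) (auto intro: finite_subset)
  also have "card (\<Union>u\<in>V - W. (\<lambda>w. {u, w}) ` N u (c u)) \<le> (\<Sum>u\<in>V - W. card ((\<lambda>w. {u, w}) ` N u (c
    u)))"
    using V by (intro card_UN_le) simp
  also have "\<dots> \<le> (\<Sum>u\<in>V - W. card (N u (c u)))"
    by (intro sum_mono card_image_le fN)
  finally have "real (card {e \<in> E. \<not> inj_on c e}) \<le> real (card W) * real n + (\<Sum>u\<in>V - W. real (card
    (N u (c u))))"
    unfolding of_nat_sum[symmetric] of_nat_mult[symmetric] of_nat_add[symmetric] of_nat_le_iff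
      by simp
  also have "(\<Sum>u\<in>V - W. real (card (N u (c u)))) \<le> (\<Sum>u\<in>V - W. \<alpha> * real n)"
    using c by (intro sum_mono) force
  also have "\<dots> \<le> (\<Sum>u\<in>V. \<alpha> * real n)" using V \<alpha> by (intro sum_mono2) auto
  also have "real (card W) * real n \<le> (\<alpha> * real n) * real n"
    using W by (intro mult_right_mono) auto
  finally have "real (card {e \<in> E. \<not> inj_on c e}) \<le> 2 * \<alpha> * real n ^ 2"
    by (simp add: n_def power2_eq_square algebra_simps)
  then show False using far[OF cK] by (simp add: n_def)
qed

fun tester_size :: "nat \<Rightarrow> nat \<Rightarrow> nat" where
  "tester_size l 0 = 0"
| "tester_size l (Suc d) = Suc (l * tester_size l d)"

text \<open>Induction on the total size of the color lists \<open>L v\<close>. Coloring a vertex \<open>u\<close> with \<open>i\<close> deletes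
  \<open>i\<close>
  from the lists of its neighbors; far from colorable graphs have many vertices \<open>u\<close> for which every
  choice of \<open>i\<close> shrinks the total substantially, including those \<open>u\<close> with an empty list. A list for
  \<open>L\<close> consists of such a \<open>u\<close> followed by one list per color.\<close>

lemma many_uncolorable_lists:
  fixes \<alpha> :: real
  assumes V: "finite V" and E: "\<And>e. e \<in> E \<Longrightarrow> e \<subseteq> V \<and> card e = 2" and K: "K \<noteq> {}" "finite K"
    and \<alpha>: "0 < \<alpha>" "\<alpha> \<le> 1"
    and far: "\<And>c. (\<forall>v\<in>V. c v \<in> K) \<Longrightarrow> 2 * \<alpha> * real (card V) ^ 2 < real (card {e \<in> E. \<not> inj_on c e})"
    and L: "\<And>v. v \<in> V \<Longrightarrow> L v \<subseteq> K"
    and small: "(\<Sum>v\<in>V. real (card (L v))) < real d * (\<alpha> * real (card V))"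
  shows "(\<alpha> * real (card V)) ^ tester_size (card K) d \<le>
    real (card {xs. set xs \<subseteq> V \<and> length xs = tester_size (card K) d
      \<and> \<not> multi_colorable E L (set xs)})"
  using L small
proof (induction d arbitrary: L)
  case 0
  have "0 \<le> (\<Sum>v\<in>V. real (card (L v)))" by (intro sum_nonneg) simp
  then show ?case using 0 by simp
next
  case (Suc d)
  define n where "n = card V"
  define k where "k = tester_size (card K) d"
  define W where "W = {u \<in> V. \<forall>i\<in>L u. \<alpha> * real n \<le> real (card {w \<in> V. {u, w} \<in> E \<and> i \<in> L w})}"
  \<comment> \<open>The lists that remain after \<open>u\<close> has been colored with
    \<open>i\<close>.\<close>
  define L' where "L' u i w = (if {u, w} \<in> E then L w - {i} else L w)" for u i w
  have an: "0 \<le> \<alpha> * real n" using \<alpha> by simp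
  have fin: "finite {xs. set xs \<subseteq> V \<and> length xs = m \<and> P xs}" for m P
    by (rule finite_subset[OF _ finite_lists_length_eq[OF V, of m]]) auto
  have W: "\<alpha> * real n \<le> real (card W)"
    unfolding W_def n_def using Suc.prems(1)
    by (intro many_list_reducing_vertices[OF V E K(1) \<alpha>(1) far]) auto
  \<comment> \<open>For a color outside \<open>L u\<close> every list of length \<open>k\<close>
    qualifies. Reserving a block for each color of \<open>K\<close>, whether in \<open>L u\<close>
    or not, keeps the length of a tester independent of \<open>u\<close> and
    \<open>L\<close>.\<close>
  have one: "(\<alpha> * real n) ^ k \<le> real (card {ys. set ys \<subseteq> V \<and> length ys = k \<and>
      (i \<in> L u \<longrightarrow> \<not> multi_colorable E (L' u i) (set ys))})" if u: "u \<in> W" for u i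
  proof (cases "i \<in> L u")
    case True
    have fL: "finite (L w)" if "w \<in> V" for w using Suc.prems(1)[OF that] K(2) finite_subset by blast
    have "real (card (L' u i w)) = real (card (L w)) - (if {u, w} \<in> E \<and> i \<in> L w then 1 else 0)"
      if "w \<in> V" for w
    proof (cases "{u, w} \<in> E \<and> i \<in> L w")
      case True
      then have "0 < card (L w)" using fL[OF that] card_gt_0_iff by blast
      with True show ?thesis by (simp add: L'_def)
    qed (auto simp: L'_def)
    then have "(\<Sum>w\<in>V. real (card (L' u i w))) =
      (\<Sum>w\<in>V. real (card (L w)) - (if {u, w} \<in> E \<and> i \<in> L w then 1 else 0))" by (intro sum.cong) auto
    also have "\<dots> = (\<Sum>w\<in>V. real (card (L w))) - real (card {w \<in> V. {u, w} \<in> E \<and> i \<in> L w})"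
      using V by (simp add: sum_subtractf flip: sum.inter_filter)
    also have "\<dots> < real (Suc d) * (\<alpha> * real n) - \<alpha> * real n"
      using Suc.prems(2) u True unfolding W_def n_def by force
    finally have "(\<Sum>w\<in>V. real (card (L' u i w))) < real d * (\<alpha> * real (card V))"
      by (simp add: algebra_simps n_def)
    moreover have "L' u i v \<subseteq> K" if "v \<in> V" for v
      using Suc.prems(1)[OF that] by (auto simp: L'_def)
    ultimately show ?thesis using Suc.IH[of "L' u i"] True by (simp add: n_def k_def)
  next
    case False
    have "(\<alpha> * real n) ^ k \<le> (1 * real n) ^ k"
      using \<alpha> by (intro power_mono mult_right_mono) auto
    then show ?thesis using False card_lists_length_eq[OF V, of k] by (simp add: n_def)
  qed
  \<comment> \<open>Concatenating blocks multiplies their numbers, and a list containing an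
    uncolorable block is itself uncolorable.\<close>
  have all: "(\<alpha> * real n) ^ (card J * k) \<le> real (card {ys. set ys \<subseteq> V \<and> length ys = card J * k \<and>
      (\<forall>i\<in>J. i \<in> L u \<longrightarrow> \<not> multi_colorable E (L' u i) (set ys))})"
    if "finite J" "u \<in> W" for u J
    using that
  proof (induction J rule: finite_induct)
    case empty
    have "{ys. ys = [] \<and> set ys \<subseteq> V} = {[]}" by auto
    then show ?case by (simp add: conj_commute)
  next
    case (insert i J)
    let ?A = "{ys. set ys \<subseteq> V \<and> length ys = k \<and>
      (i \<in> L u \<longrightarrow> \<not> multi_colorable E (L' u i) (set ys))}"
    let ?B = "{ys. set ys \<subseteq> V \<and> length ys = card J * k \<and>
      (\<forall>i\<in>J. i \<in> L u \<longrightarrow> \<not> multi_colorable E (L' u i) (set ys))}"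
    let ?C = "{ys. set ys \<subseteq> V \<and> length ys = card (insert i J) * k \<and>
      (\<forall>i\<in>insert i J. i \<in> L u \<longrightarrow> \<not> multi_colorable E (L' u i) (set ys))}"
    have sub: "(\<lambda>(x, y). x @ y) ` (?A \<times> ?B) \<subseteq> ?C"
      using insert.hyps multi_colorable_mono by (fastforce simp: card_insert_if)
    have "(\<alpha> * real n) ^ (card (insert i J) * k) = (\<alpha> * real n) ^ k * (\<alpha> * real n) ^ (card J * k)"
      using insert.hyps by (simp add: power_add)
    also have "\<dots> \<le> real (card ?A) * real (card ?B)"
      using one[of u i] insert an by (intro mult_mono) auto
    also have "\<dots> = real (card ((\<lambda>(x, y). x @ y) ` (?A \<times> ?B)))"
      by (subst card_append[where a = k]) auto
    also have "\<dots> \<le> real (card ?C)"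
      unfolding of_nat_le_iff by (rule card_mono[OF fin sub])
    finally show ?case .
  qed
  let ?Y = "\<lambda>u. {ys. set ys \<subseteq> V \<and> length ys = card K * k \<and>
      (\<forall>i\<in>K. i \<in> L u \<longrightarrow> \<not> multi_colorable E (L' u i) (set ys))}"
  let ?Z = "{xs. set xs \<subseteq> V \<and> length xs = tester_size (card K) (Suc d)
    \<and> \<not> multi_colorable E L (set xs)}"
  have sub: "(\<lambda>(u, ys). u # ys) ` (SIGMA u:W. ?Y u) \<subseteq> ?Z"
  proof clarify
    fix u ys
    assume u: "u \<in> W" and ys: "set ys \<subseteq> V" "length ys = card K * k"
      "\<forall>i\<in>K. i \<in> L u \<longrightarrow> \<not> multi_colorable E (L' u i) (set ys)"
    have uV: "u \<in> V" using u by (simp add: W_def)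
    have "\<not> multi_colorable E L (set (u # ys))"
    proof
      assume "multi_colorable E L (set (u # ys))"
      then obtain C where C: "set (u # ys) \<subseteq> fst ` C" "\<forall>(u, a)\<in>C. a \<in> L u"
        "\<forall>(u, a)\<in>C. \<forall>(v, b)\<in>C. {u, v} \<in> E \<longrightarrow> a \<noteq> b"
        unfolding multi_colorable_def by blast
      obtain a where a: "(u, a) \<in> C" using C(1) by auto
      have "a \<in> L u" using a C(2) by auto
      moreover have "a \<in> K" using \<open>a \<in> L u\<close> Suc.prems(1)[OF uV] by blast
      moreover have "multi_colorable E (L' u a) (set ys)"
        unfolding multi_colorable_def
      proof (intro exI[of _ C] conjI)
        \<comment> \<open>Since \<open>(u, a)\<close> belongs to \<open>C\<close>, no neighbor of
          \<open>u\<close> is given the color \<open>a\<close> by \<open>C\<close>; so the same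
          relation respects the reduced lists.\<close>
        show "\<forall>(w, b)\<in>C. b \<in> L' u a w" using C(2,3) a by (fastforce simp: L'_def)
      qed (use C in auto)
      ultimately show False using ys(3) by blast
    qed
    then show "set (u # ys) \<subseteq> V \<and> length (u # ys) = tester_size (card K) (Suc d)
      \<and> \<not> multi_colorable E L (set (u # ys))"
      using uV ys by (simp add: k_def)
  qed
  have fW: "finite W" using V by (simp add: W_def)
  have "(\<alpha> * real n) ^ tester_size (card K) (Suc d) = \<alpha> * real n * (\<alpha> * real n) ^ (card K * k)"
    by (simp add: k_def)
  also have "\<dots> \<le> real (card W) * (\<alpha> * real n) ^ (card K * k)"
    using W an by (intro mult_right_mono) auto
  also have "\<dots> = (\<Sum>u\<in>W. (\<alpha> * real n) ^ (card K * k))" by simp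
  also have "\<dots> \<le> (\<Sum>u\<in>W. real (card (?Y u)))"
    using all[OF K(2)] by (intro sum_mono) auto
  also have "\<dots> = real (card (SIGMA u:W. ?Y u))"
    using fW fin by (subst card_SigmaI) auto
  also have "\<dots> = real (card ((\<lambda>(u, ys). u # ys) ` (SIGMA u:W. ?Y u)))"
    by (subst card_image) (auto simp: inj_on_def)
  also have "\<dots> \<le> real (card ?Z)"
    unfolding of_nat_le_iff by (rule card_mono[OF fin sub])
  finally show ?case by (simp add: n_def)
qed

section \<open>Hypergraph basics and blow-ups\<close>

abbreviation (input) vcard :: "'a hypergraph \<Rightarrow> nat" where
  "vcard H \<equiv> card (verts H)"

abbreviation (input) clique :: "nat \<Rightarrow> nat hypergraph" where
  "clique k \<equiv> complete_r_graph 2 k"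

abbreviation (input) inj_homs :: "'a hypergraph \<Rightarrow> 'b hypergraph \<Rightarrow> ('a \<Rightarrow> 'b) set" where
  "inj_homs Q H \<equiv> {f \<in> verts Q \<rightarrow>\<^sub>E verts H. inj_on f (verts Q) \<and> homomorphism f Q H}"

abbreviation (input) deletion_close ::
    "nat \<Rightarrow> real \<Rightarrow> 'a hypergraph set \<Rightarrow> 'a hypergraph \<Rightarrow> bool" where
  "deletion_close r \<epsilon> \<K> H \<equiv> \<exists>D\<subseteq>edges H.
     real (card D) \<le> \<epsilon> * real (vcard H) ^ r \<and> (verts H, edges H - D) \<in> \<K>"

abbreviation (input) turan_close :: "nat \<Rightarrow> nat \<Rightarrow> real \<Rightarrow> nat hypergraph \<Rightarrow> bool" where
  "turan_close r l \<epsilon> H \<equiv> \<exists>D A. D \<subseteq> edges H \<and> A \<subseteq> {e. e \<subseteq> verts H \<and> card e = r} - edges H \<and>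
     real (card D + card A) \<le> \<epsilon> * real (vcard H) ^ r \<and>
     isomorphic (verts H, (edges H - D) \<union> A) (turan_r_graph r (vcard H) l)"

abbreviation (input) near_max ::
    "nat \<Rightarrow> 'a hypergraph \<Rightarrow> 'b hypergraph set \<Rightarrow> real \<Rightarrow> nat hypergraph \<Rightarrow> bool" where
  "near_max r Q \<F> \<delta> H \<equiv>
     (1 - \<delta>) * real (inj_max r (vcard H) Q \<F>) \<le> real (inj_count Q H)"

abbreviation (input) near_max_imp ::
    "nat \<Rightarrow> 'a hypergraph \<Rightarrow> 'b hypergraph set \<Rightarrow> real \<Rightarrow> nat \<Rightarrow> (nat hypergraph \<Rightarrow> bool) \<Rightarrow> bool" where
  "near_max_imp r Q \<F> \<delta> N C \<equiv> \<forall>H :: nat hypergraph.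
     r_graph r H \<longrightarrow> N \<le> vcard H \<longrightarrow> free_of \<F> H \<longrightarrow> near_max r Q \<F> \<delta> H \<longrightarrow> C H"

text \<open>The error is measured against all maps instead of the maximum: this is the form in which
  losses from deleting edges and from passing to shadows arrive, and it remains meaningful when the
  maximum is 0.\<close>

abbreviation (input) near_max_additive ::
    "nat \<Rightarrow> 'a hypergraph \<Rightarrow> real \<Rightarrow> nat hypergraph \<Rightarrow> bool" where
  "near_max_additive l P \<delta> G \<equiv>
     real (inj_max 2 (vcard G) P {clique (l + 1)})
       - \<delta> * real (vcard G) ^ vcard P \<le> real (inj_count P G)"

lemma finite_verts: "r_graph r H \<Longrightarrow> finite (verts H)"
  by (simp add: r_graph_def)

lemma finite_edges: "r_graph r H \<Longrightarrow> finite (edges H)"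
  unfolding r_graph_def by (rule finite_subset[of _ "Pow (verts H)"]) auto

lemma r_graph_subset: "r_graph r H \<Longrightarrow> E \<subseteq> edges H \<Longrightarrow> r_graph r (verts H, E)"
  unfolding r_graph_def by auto

lemma finite_inj_homs:
  assumes "finite (verts Q)" "finite (verts H)"
  shows "finite (inj_homs Q H)"
  by (rule finite_subset[OF _ finite_PiE[of "verts Q" "\<lambda>_. verts H"]]) (use assms in auto)

lemma inj_count_le:
  assumes "finite (verts Q)" "finite (verts H)"
  shows "inj_count Q H \<le> vcard H ^ vcard Q"
proof -
  have "inj_count Q H \<le> card (verts Q \<rightarrow>\<^sub>E verts H)"
    unfolding inj_count_def using assms by (intro card_mono finite_PiE) auto
  then show ?thesis using assms by (simp add: card_PiE)
qed

lemma inj_counts_finite: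
  assumes "finite (verts Q)"
  shows "finite {inj_count Q H | H :: nat hypergraph. r_graph r H \<and> vcard H = n \<and> free_of \<F> H}"
proof (rule finite_subset)
  show "{inj_count Q H | H :: nat hypergraph. r_graph r H \<and> vcard H = n \<and> free_of \<F> H}
      \<subseteq> {..n ^ vcard Q}"
    using inj_count_le[OF assms] unfolding r_graph_def by blast
qed simp

lemma inj_max_ge:
  fixes H :: "nat hypergraph"
  assumes "finite (verts Q)" "r_graph r H" "vcard H = n" "free_of \<F> H"
  shows "inj_count Q H \<le> inj_max r n Q \<F>"
  unfolding inj_max_def using assms by (intro Max_ge inj_counts_finite) blast+

lemma inj_max_attained:
  assumes "finite (verts Q)" "\<And>F. F \<in> \<F> \<Longrightarrow> edges F \<noteq> {}"
  obtains H :: "nat hypergraph"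
  where "r_graph r H" "vcard H = n" "free_of \<F> H" "inj_count Q H = inj_max r n Q \<F>"
proof -
  let ?S = "{inj_count Q H | H :: nat hypergraph. r_graph r H \<and> vcard H = n \<and> free_of \<F> H}"
  have "r_graph r ({..<n}, {})" "card (verts ({..<n}, {})) = n" by (auto simp: r_graph_def)
  moreover have "free_of \<F> ({..<n}, {})"
    using assms(2) by (fastforce simp: free_of_def homomorphism_def)
  ultimately have "?S \<noteq> {}" by blast
  then have "inj_max r n Q \<F> \<in> ?S"
    unfolding inj_max_def using inj_counts_finite[OF assms(1)] by (intro Max_in) auto
  then show thesis using that by auto
qed

text \<open>A lost copy sends some edge of \<open>Q\<close> onto a deleted edge, so
  \<open>card_maps_hitting_le\<close> bounds the number of lost copies.\<close>

lemma inj_count_delete: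
  assumes Q: "r_graph r Q" and H: "r_graph r H" and D: "D \<subseteq> edges H"
  shows "inj_count Q H \<le> inj_count Q (verts H, edges H - D) +
    card (edges Q) * r ^ r * card D * vcard H ^ (vcard Q - r)"
proof -
  let ?A = "(inj_homs Q H)"
  let ?B = "(inj_homs Q (verts H, edges H - D))"
  let ?C = "{f \<in> verts Q \<rightarrow>\<^sub>E verts H. \<exists>e\<in>edges Q. f ` e \<in> D}"
  have fin: "finite (verts Q)" "finite (verts H)" using Q H by (auto simp: r_graph_def)
  have "?A \<subseteq> ?B \<union> ?C" by (auto simp: homomorphism_def)
  moreover have "finite ?B" using finite_inj_homs[of Q "(verts H, edges H - D)"] fin by simp
  moreover have "finite ?C"
    by (rule finite_filter_PiE) (use fin in auto)
  ultimately have "card ?A \<le> card ?B + card ?C"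
    by (meson card_Un_le card_mono finite_UnI le_trans)
  moreover have "card ?C \<le> card (edges Q) * card D * (r ^ r * vcard H ^ (vcard Q - r))"
    using Q H D finite_edges[OF Q] finite_subset[OF D finite_edges[OF H]] fin
    by (intro card_maps_hitting_le) (auto simp: r_graph_def)
  ultimately show ?thesis unfolding inj_count_def by (simp add: mult_ac)
qed

text \<open>A strong coloring: the vertices of an edge receive distinct colors. Colors start at 1 so
  that for an \<open>r\<close>-graph this is the same as a homomorphism to
  \<open>complete_r_graph r l\<close>.\<close>

definition proper_coloring :: "nat \<Rightarrow> 'a hypergraph \<Rightarrow> ('a \<Rightarrow> nat) \<Rightarrow> bool" where
  "proper_coloring l H c \<longleftrightarrow> (\<forall>v\<in>verts H. c v \<in> {1..l}) \<and> (\<forall>e\<in>edges H. inj_on c e)"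

lemma colorable_family_iff:
  "H \<in> colorable_family r l \<longleftrightarrow> r_graph r H \<and> (\<exists>c. proper_coloring l H c)"
proof -
  have "homomorphism c H (complete_r_graph r l) \<longleftrightarrow> proper_coloring l H c" if H: "r_graph r H" for c
  proof (cases "c ` verts H \<subseteq> {1..l}")
    case True
    have "c ` e \<in> edges (complete_r_graph r l) \<longleftrightarrow> inj_on c e" if "e \<in> edges H" for e
    proof (cases "r = 0")
      case True
      then have "finite e" "card e = 0" using H that by (auto simp: r_graph_def intro:
        finite_subset)
      then have "e = {}" by simp
      then show ?thesis using True by (simp add: complete_r_graph_def)
    next
      case False
      then have "finite e" "card e = r" "e \<subseteq> verts H"
        using H that by (auto simp: r_graph_def dest: finite_subset)
      then show ?thesis using True inj_on_iff_eq_card[of e c] \<open>c ` verts H \<subseteq> {1..l}\<close>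
        by (auto simp: complete_r_graph_def)
    qed
    then show ?thesis using True
      by (auto simp: homomorphism_def proper_coloring_def complete_r_graph_def)
  next
    case False
    then show ?thesis by (auto simp: homomorphism_def proper_coloring_def complete_r_graph_def)
  qed
  then show ?thesis by (auto simp: colorable_family_def)
qed

lemma homomorphism_complete_graph:
  assumes "inj_on f {1..k}" "f ` {1..k} \<subseteq> verts G"
  shows "homomorphism f (clique k) G \<longleftrightarrow>
     (\<forall>i\<in>{1..k}. \<forall>j\<in>{1..k}. i \<noteq> j \<longrightarrow> {f i, f j} \<in> edges G)"
proof -
  have "(\<forall>e. e \<subseteq> {1..k} \<and> card e = 2 \<longrightarrow> f ` e \<in> edges G) \<longleftrightarrow>
     (\<forall>i\<in>{1..k}. \<forall>j\<in>{1..k}. i \<noteq> j \<longrightarrow> {f i, f j} \<in> edges G)" (is "?L \<longleftrightarrow> ?R")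
  proof
    assume L: ?L
    show ?R
    proof (intro ballI impI)
      fix i j assume "i \<in> {1..k}" "j \<in> {1..k}" "i \<noteq> j"
      then show "{f i, f j} \<in> edges G" using L[rule_format, of "{i, j}"] by simp
    qed
  next
    assume R: ?R
    show ?L
    proof (intro allI impI)
      fix e assume e: "e \<subseteq> {1..k} \<and> card e = 2"
      then obtain i j where "e = {i, j}" "i \<noteq> j" by (meson card_2_iff)
      then show "f ` e \<in> edges G" using R e by auto
    qed
  qed
  then show ?thesis using assms(2) by (simp add: homomorphism_def complete_r_graph_def)
qed

lemma complete_free_if_colorable:
  assumes "proper_coloring l G c" "r_graph 2 G"
  shows "free_of {clique (l + 1)} G"
proof -
  have False if f: "inj_on f {1..l + 1}" "homomorphism f (clique (l + 1)) G" for f :: "nat \<Rightarrow> 'a"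
  proof -
    have sub: "f ` {1..l + 1} \<subseteq> verts G" using f(2) by (simp add: homomorphism_def
      complete_r_graph_def)
    have "inj_on (c \<circ> f) {1..l + 1}"
    proof (rule inj_onI, rule ccontr)
      fix i j assume ij: "i \<in> {1..l + 1}" "j \<in> {1..l + 1}" "(c \<circ> f) i = (c \<circ> f) j" "i \<noteq> j"
      then have "{f i, f j} \<in> edges G" using homomorphism_complete_graph[OF f(1) sub] f(2) by blast
      then have "inj_on c {f i, f j}" using assms(1) by (auto simp: proper_coloring_def)
      then have "f i = f j" using ij(3) unfolding comp_def by (rule inj_onD) simp_all
      then have "i = j" using f(1) ij(1,2) by (auto dest: inj_onD)
      then show False using ij(4) by simp
    qed
    moreover have "(c \<circ> f) ` {1..l + 1} \<subseteq> {1..l}"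
      using sub assms(1) by (auto simp: proper_coloring_def)
    ultimately have "card {1..l + 1} \<le> card {1..l}" by (meson card_inj_on_le finite_atLeastAtMost)
    then show False by simp
  qed
  then show ?thesis by (auto simp: free_of_def complete_r_graph_def)
qed

section \<open>Chromatic number and freeness of expansions\<close>

lemma chromatic_number_le:
  assumes "\<And>v. v \<in> verts F \<Longrightarrow> c v < k" "\<And>u v. {u, v} \<in> edges F \<Longrightarrow> c u \<noteq> c v"
  shows "chromatic_number F \<le> k"
  unfolding chromatic_number_def by (rule Least_le) (use assms in blast)

text \<open>An injective numbering of the vertices is a coloring, since edges have two distinct
  ends; so the least number of colors is attained.\<close>

lemma chromatic_number_coloring:
  assumes "r_graph 2 F"
  obtains c :: "'a \<Rightarrow> nat" where "\<And>v. v \<in> verts F \<Longrightarrow> c v < chromatic_number F"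
    "\<And>u v. {u, v} \<in> edges F \<Longrightarrow> c u \<noteq> c v"
proof -
  have "finite (verts F)" using assms by (simp add: r_graph_def)
  then obtain f :: "'a \<Rightarrow> nat" and n where f: "f ` verts F = {i. i < n}" "inj_on f (verts F)"
    using finite_imp_inj_to_nat_seg by metis
  have "f u \<noteq> f v" if "{u, v} \<in> edges F" for u v
  proof -
    have "card {u, v} = 2" "{u, v} \<subseteq> verts F" using assms that unfolding r_graph_def by blast+
    then have "u \<noteq> v" by auto
    then show ?thesis using f \<open>{u, v} \<subseteq> verts F\<close> by (auto simp: inj_on_def)
  qed
  then have "\<exists>k. \<exists>c :: 'a \<Rightarrow> nat. (\<forall>v\<in>verts F. c v < k) \<and> (\<forall>u v. {u, v} \<in> edges F \<longrightarrow> c u \<noteq> c v)"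
    using f by (intro exI[of _ n] exI[of _ f]) auto
  from LeastI_ex[OF this] show thesis
    using that unfolding chromatic_number_def by auto
qed

lemma edges_nonempty_if_chromatic:
  assumes "1 < chromatic_number F"
  shows "edges F \<noteq> {}"
  using assms chromatic_number_le[of F "\<lambda>_. 0" 1] by auto

text \<open>In a copy of the expansion, the ends of each edge of \<open>F\<close> lie in a common
  edge of \<open>H\<close> and get distinct colors. A copy would thus color \<open>F\<close> with
  \<open>l\<close> colors.\<close>

lemma expansion_free_if_colorable:
  assumes c: "proper_coloring l H c" and F: "r_graph 2 F" "l < chromatic_number F"
  shows "free_of {expansion r F} H"
proof -
  have False if f: "inj_on f (verts (expansion r F))" "homomorphism f (expansion r F) H" for f
  proof -
    have v: "f (Inl v) \<in> verts H" if "v \<in> verts F" for v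
      using f(2) that by (auto simp: homomorphism_def expansion_def)
    have "chromatic_number F \<le> l"
    \<comment> \<open>The shift by one is needed because \<open>chromatic_number\<close> uses colors
      below \<open>k\<close>, while \<open>proper_coloring\<close> uses 1 up to
      \<open>l\<close>.\<close>
    proof (rule chromatic_number_le[where c = "\<lambda>v. c (f (Inl v)) - 1"])
      fix x assume "x \<in> verts F"
      then have "c (f (Inl x)) \<in> {1..l}" using v c by (auto simp: proper_coloring_def)
      then show "c (f (Inl x)) - 1 < l" by auto
    next
      fix x y assume e: "{x, y} \<in> edges F"
      have "card {x, y} = 2" "{x, y} \<subseteq> verts F" using F(1) e unfolding r_graph_def by blast+
      then have xy: "x \<noteq> y" "x \<in> verts F" "y \<in> verts F" by auto
      then have ne: "f (Inl x) \<noteq> f (Inl y)"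
        using f(1) by (auto simp: inj_on_def expansion_def)
      have "Inl ` {x, y} \<union> Inr ` ({{x, y}} \<times> {..<r - 2}) \<in> edges (expansion r F)"
        using e unfolding expansion_def snd_conv by (rule imageI)
      then have "inj_on c (f ` (Inl ` {x, y} \<union> Inr ` ({{x, y}} \<times> {..<r - 2})))"
        using f(2) c unfolding homomorphism_def proper_coloring_def by blast
      then have "c (f (Inl x)) \<noteq> c (f (Inl y))" using ne by (auto simp: inj_on_def)
      moreover have "1 \<le> c (f (Inl x))" "1 \<le> c (f (Inl y))"
        using v xy c by (auto simp: proper_coloring_def)
      ultimately show "c (f (Inl x)) - 1 \<noteq> c (f (Inl y)) - 1" by linarith
    qed
    then show False using F by simp
  qed
  then show ?thesis by (auto simp: free_of_def)
qed

lemma edges_expansion_nonempty: "edges F \<noteq> {} \<Longrightarrow> edges (expansion r F) \<noteq> {}"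
  by (simp add: expansion_def)

lemma edges_complete_graph_nonempty: "2 \<le> k \<Longrightarrow> edges (clique k) \<noteq> {}"
  by (auto simp: complete_r_graph_def intro!: exI[of _ "{1, 2}"])

section \<open>Passing between copies of Q and copies of its shadow\<close>

lemma r_graph_pair_shadow: "r_graph r Q \<Longrightarrow> r_graph 2 (pair_shadow Q)"
  by (auto simp: r_graph_def pair_shadow_def)

lemma verts_pair_shadow [simp]: "verts (pair_shadow Q) = verts Q"
  by (simp add: pair_shadow_def)

lemma inj_count_pair_shadow_ge:
  assumes Q: "finite (verts Q)" and H: "finite (verts H)"
    and sh: "\<And>e p. e \<in> edges H \<Longrightarrow> p \<subseteq> e \<Longrightarrow> card p = 2 \<Longrightarrow> p \<in> edges G" and V: "verts G = verts H"
    and QV: "\<And>e. e \<in> edges Q \<Longrightarrow> e \<subseteq> verts Q"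
  shows "inj_count Q H \<le> inj_count (pair_shadow Q) G"
  unfolding inj_count_def
proof (rule card_mono)
  show "finite (inj_homs (pair_shadow Q) G)"
    using Q H V by (intro finite_inj_homs) auto
  show "(inj_homs Q H) \<subseteq>
    (inj_homs (pair_shadow Q) G)"
  proof clarify
    fix f assume f: "f \<in> verts Q \<rightarrow>\<^sub>E verts H" "inj_on f (verts Q)" "homomorphism f Q H"
    have "f ` p \<in> edges G" if "card p = 2" "e \<in> edges Q" "p \<subseteq> e" for p e
    proof (rule sh)
      show "f ` e \<in> edges H" using f(3) that by (simp add: homomorphism_def)
      show "f ` p \<subseteq> f ` e" using that by auto
      show "card (f ` p) = 2" using that f(2) QV[of e] by (metis card_image inj_on_subset)
    qed
    then show "f \<in> verts (pair_shadow Q) \<rightarrow>\<^sub>E verts G \<and>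
      inj_on f (verts (pair_shadow Q)) \<and> homomorphism f (pair_shadow Q) G"
      using f V by (auto simp: homomorphism_def pair_shadow_def)
  qed
qed

text \<open>A converse to \<open>inj_count_pair_shadow_ge\<close>: all pairs inside an edge of
  \<open>Q\<close> are in its shadow, so a copy of the shadow in \<open>G\<close> carries each edge
  of \<open>Q\<close> to an \<open>r\<close>-clique. Collecting the \<open>r\<close>-cliques of
  \<open>G\<close> as edges therefore loses no copies.\<close>

lemma inj_count_cliques_ge:
  assumes Q: "r_graph r Q" and G: "r_graph 2 G" and r: "2 \<le> r"
  shows "inj_count (pair_shadow Q) G \<le> inj_count Q
    (verts G, {e. e \<subseteq> verts G \<and> card e = r \<and> (\<forall>p\<subseteq>e. card p = 2 \<longrightarrow> p \<in> edges G)})"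
  (is "_ \<le> inj_count Q ?T")
  unfolding inj_count_def
proof (rule card_mono)
  show "finite (inj_homs Q ?T)"
    using Q G by (intro finite_inj_homs) (auto simp: r_graph_def)
  show "(inj_homs (pair_shadow Q) G) \<subseteq>
    (inj_homs Q ?T)"
  proof clarify
    fix f assume f: "f \<in> verts (pair_shadow Q) \<rightarrow>\<^sub>E verts G" "inj_on f (verts (pair_shadow Q))"
      "homomorphism f (pair_shadow Q) G"
    have "f ` e \<in> edges ?T" if e: "e \<in> edges Q" for e
    proof -
      have ev: "e \<subseteq> verts Q" "card e = r" using Q e by (auto simp: r_graph_def)
      have inj: "inj_on f e" using f(2) ev by (auto intro: inj_on_subset)
      have "p \<in> edges G" if p: "p \<subseteq> f ` e" "card p = 2" for p
      proof -
        obtain q where q: "q \<subseteq> e" "p = f ` q" using p(1) subset_imageE by metis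
        have "card q = 2" using p(2) q inj by (metis card_image inj_on_subset)
        then have "q \<in> edges (pair_shadow Q)" using q e by (auto simp: pair_shadow_def)
        then show ?thesis using f(3) q by (simp add: homomorphism_def)
      qed
      moreover have "f ` e \<subseteq> verts G" using f(1) ev by auto
      ultimately show ?thesis using ev inj by (simp add: card_image)
    qed
    then show "f \<in> verts Q \<rightarrow>\<^sub>E verts ?T \<and> inj_on f (verts Q) \<and> homomorphism f Q ?T"
      using f by (auto simp: homomorphism_def)
  qed
qed

text \<open>Blow up an extremal graph on \<open>m\<close> vertices, replacing its vertices by the
  residue classes modulo \<open>m\<close> in \<open>{..<n}\<close>. A clique of the blow-up projects
  to a clique of the same size, since classes are independent, while a copy of \<open>P\<close>
  lifts in \<open>n div m\<close> ways at each vertex.\<close>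

lemma inj_max_blowup:
  assumes rP: "r_graph 2 P" and m: "0 < m" and k: "2 \<le> k"
  shows "inj_max 2 m P {clique k} * (n div m) ^ vcard P
    \<le> inj_max 2 n P {clique k}"
proof -
  let ?K = "clique k"
  note P = finite_verts[OF rP]
  obtain G :: "nat hypergraph" where G: "r_graph 2 G" "vcard G = m" "free_of {?K} G"
    "inj_count P G = inj_max 2 m P {?K}"
    using inj_max_attained[OF P, of "{?K}" 2 m] edges_complete_graph_nonempty[OF k] by auto
  note fG = finite_verts[OF G(1)]
  obtain h where h: "bij_betw h {0..<m} (verts G)" using ex_bij_betw_nat_finite[OF fG] G(2) by auto
  define t where "t x = h (x mod m)" for x
  have tV: "t x \<in> verts G" for x unfolding t_def using h m by (auto simp: bij_betw_def)
  define B :: "nat hypergraph" where "B = ({..<n}, {{x, y} | x y. x < n \<and> y < n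
    \<and> {t x, t y} \<in> edges G})"
  have neq: "t x \<noteq> t y" if "{t x, t y} \<in> edges G" for x y
  proof
    assume "t x = t y"
    then have "card {t x, t y} = 1" by simp
    then show False using G(1) that unfolding r_graph_def by fastforce
  qed
  have B_edge: "{x, y} \<in> edges B \<longleftrightarrow> x < n \<and> y < n \<and> {t x, t y} \<in> edges G" for x y
    by (auto simp: B_def doubleton_eq_iff insert_commute)
  have rB: "r_graph 2 B"
    using neq by (auto simp: r_graph_def B_def card_2_iff) metis
  have "free_of {?K} B"
  proof -
    have False if f: "inj_on f {1..k}" "homomorphism f ?K B" for f :: "nat \<Rightarrow> nat"
    proof -
      have sub: "f ` {1..k} \<subseteq> verts B" using f(2) by (simp add: homomorphism_def
        complete_r_graph_def)
      have e: "{t (f i), t (f j)} \<in> edges G" if "i \<in> {1..k}" "j \<in> {1..k}" "i \<noteq> j" for i j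
        using homomorphism_complete_graph[OF f(1) sub] f(2) that B_edge by blast
      then have inj: "inj_on (t \<circ> f) {1..k}" using neq by (auto simp: inj_on_def) metis
      moreover have "homomorphism (t \<circ> f) ?K G"
        using homomorphism_complete_graph[OF inj, of G] e tV by auto
      ultimately show False using G(3) by (auto simp: free_of_def complete_r_graph_def)
    qed
    then show ?thesis by (auto simp: free_of_def complete_r_graph_def)
  qed
  then have "inj_count P B \<le> inj_max 2 n P {?K}"
    using rB by (intro inj_max_ge[OF P]) (auto simp: B_def)
  moreover have "inj_count P G * (n div m) ^ vcard P \<le> inj_count P B"
  proof -
    let ?I = "(inj_homs P G)"
    let ?J = "(inj_homs P B)"
    let ?S = "verts P \<rightarrow>\<^sub>E {..<n div m}"
    \<comment> \<open>The vertex \<open>x\<close> is sent to member number \<open>s x\<close> of the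
      class of \<open>f x\<close>. Only full blocks of length \<open>m\<close> are used, which keeps
      the value below \<open>n\<close>; reduction modulo \<open>m\<close> recovers
      \<open>f\<close>.\<close>
    let ?\<Phi> = "\<lambda>(f, s). \<lambda>x\<in>verts P. inv_into {0..<m} h (f x) + m * s x"
    have hi: "inv_into {0..<m} h v < m" "h (inv_into {0..<m} h v) = v" if "v \<in> verts G" for v
      using h that inv_into_into[of v h "{0..<m}"] by (auto simp: bij_betw_def f_inv_into_f)
    have "card (?I \<times> ?S) \<le> card ?J"
    proof (rule card_inj_on_le[where f = ?\<Phi>])
      show "finite ?J" using P by (intro finite_inj_homs) (auto simp: B_def)
      show "inj_on ?\<Phi> (?I \<times> ?S)"
      proof (rule inj_onI, clarify)
        fix f s g u
        assume f: "f \<in> verts P \<rightarrow>\<^sub>E verts G" and g: "g \<in> verts P \<rightarrow>\<^sub>E verts G"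
          and s: "s \<in> ?S" and u: "u \<in> ?S"
          and eq: "(\<lambda>x\<in>verts P. inv_into {0..<m} h (f x) + m * s x) =
             (\<lambda>x\<in>verts P. inv_into {0..<m} h (g x) + m * u x)"
        have "f x = g x \<and> s x = u x" for x
        proof (cases "x \<in> verts P")
          case True
          have E: "inv_into {0..<m} h (f x) + m * s x = inv_into {0..<m} h (g x) + m * u x"
            using fun_cong[OF eq, of x] True by simp
          have a: "inv_into {0..<m} h (f x) < m" "inv_into {0..<m} h (g x) < m"
            using hi f g True by (auto simp: PiE_mem)
          have "inv_into {0..<m} h (f x) = inv_into {0..<m} h (g x)"
            using arg_cong[OF E, of "\<lambda>z. z mod m"] a by simp
          moreover have "s x = u x" using E calculation m by simp
          ultimately show ?thesis using hi(2) PiE_mem[OF f True] PiE_mem[OF g True] by metis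
        next
          case False
          then show ?thesis using PiE_arb f g s u by metis
        qed
        then show "f = g \<and> s = u" by auto
      qed
      show "?\<Phi> ` (?I \<times> ?S) \<subseteq> ?J"
      proof (rule image_subsetI)
        fix p assume "p \<in> ?I \<times> ?S"
        then obtain f s where p: "p = (f, s)" and s: "s \<in> ?S"
          and f: "f \<in> verts P \<rightarrow>\<^sub>E verts G" "inj_on f (verts P)" "homomorphism f P G" by auto
        let ?g = "\<lambda>x\<in>verts P. inv_into {0..<m} h (f x) + m * s x"
        have tg: "t (?g x) = f x" if "x \<in> verts P" for x
          using that hi[OF PiE_mem[OF f(1) that]] by (simp add: t_def)
        have gn: "?g x < n" if "x \<in> verts P" for x
        proof -
          have "inv_into {0..<m} h (f x) < m" using hi[OF PiE_mem[OF f(1) that]] by simp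
          moreover have "s x + 1 \<le> n div m" using PiE_mem[OF s that] by simp
          then have "m * (s x + 1) \<le> m * (n div m)" by (rule mult_le_mono2)
          moreover have "m * (n div m) \<le> n" by simp
          ultimately have "inv_into {0..<m} h (f x) + m * s x < n"
            unfolding distrib_left by linarith
          then show ?thesis using that by simp
        qed
        have inj: "inj_on ?g (verts P)"
          using tg f(2) unfolding inj_on_def by metis
        have "?g ` e \<in> edges B" if "e \<in> edges P" for e
        proof -
          have e2: "card e = 2" "e \<subseteq> verts P" using rP that by (auto simp: r_graph_def)
          then obtain x y where e: "e = {x, y}" by (meson card_2_iff)
          with e2 have "x \<in> verts P" "y \<in> verts P" by auto
          note e = e this
          have "f ` e \<in> edges G" using f(3) that by (simp add: homomorphism_def)
          then have "{t (?g x), t (?g y)} \<in> edges G" using e tg by simp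
          then have "{?g x, ?g y} \<in> edges B" using B_edge gn e by blast
          then show ?thesis using e by simp
        qed
        then show "?\<Phi> p \<in> ?J"
          unfolding p using gn inj by (auto simp: B_def homomorphism_def)
      qed
    qed
    then show ?thesis using P by (simp add: inj_count_def card_cartesian_product card_PiE)
  qed
  ultimately show ?thesis using G(4) by simp
qed

section \<open>Pulling back along random maps\<close>

lemma graph_edgeE:
  assumes "r_graph 2 G" "e \<in> edges G"
  obtains x y where "e = {x, y}" "x \<noteq> y" "x \<in> verts G" "y \<in> verts G"
proof -
  have "card e = 2" "e \<subseteq> verts G" using assms by (auto simp: r_graph_def)
  then obtain x y where "e = {x, y}" "x \<noteq> y" by (meson card_2_iff)
  then show thesis using that \<open>e \<subseteq> verts G\<close> by blast
qed

text \<open>If the ordered \<open>k\<close>-cliques were dense, \<open>erdos_box\<close> would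
  provide a complete \<open>k\<close>-partite graph in \<open>G\<close> with parts as large as
  \<open>F\<close>, and this contains the \<open>k\<close>-colorable graph \<open>F\<close>.\<close>

lemma few_cliques:
  fixes F :: "'b hypergraph" and \<beta> :: real
  assumes F: "r_graph 2 F" "chromatic_number F \<le> k" and \<beta>: "0 < \<beta>"
  shows "\<exists>N0. \<forall>G :: 'a hypergraph. r_graph 2 G \<longrightarrow> N0 \<le> vcard G \<longrightarrow> free_of {F} G \<longrightarrow>
    real (inj_count (clique k) G) < \<beta> * real (vcard G) ^ k"
proof -
  define t where "t = vcard F"
  from erdos_box[OF \<beta>, where k = k and t = t and 'a = 'a] obtain N0 where
    N0: "\<And>(V::'a set) E. finite V \<Longrightarrow> N0 \<le> card V \<Longrightarrow>
     E \<subseteq> {xs. set xs \<subseteq> V \<and> length xs = k} \<Longrightarrow> \<beta> * real (card V) ^ k \<le> real (card E) \<Longrightarrow>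
     contains_box k t E" by blast
  show ?thesis
  proof (intro exI[of _ N0] allI impI, rule ccontr)
    fix G :: "'a hypergraph"
    assume G: "r_graph 2 G" "N0 \<le> vcard G" "free_of {F} G"
      and "\<not> real (inj_count (clique k) G) < \<beta> * real (vcard G) ^ k"
    then have big: "\<beta> * real (vcard G) ^ k \<le> real (inj_count (clique k) G)" by simp
    let ?H = "{f \<in> {1..k} \<rightarrow>\<^sub>E verts G. inj_on f {1..k} \<and> homomorphism f (clique k) G}"
    \<comment> \<open>Cliques are indexed from 1 but list positions and the colors of
      \<open>F\<close> from 0; hence position \<open>i\<close> of a tuple is the image of
      \<open>Suc i\<close>.\<close>
    let ?E = "(\<lambda>f. map f [1..<Suc k]) ` ?H"
    note fG = finite_verts[OF G(1)]
    have "inj_on (\<lambda>f. map f [1..<Suc k]) ?H"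
    proof (rule inj_onI)
      fix f g assume f: "f \<in> ?H" and g: "g \<in> ?H" and eq: "map f [1..<Suc k] = map g [1..<Suc k]"
      have "f x = g x" if "x \<in> {1..k}" for x using eq that by (auto simp: map_eq_conv simp del:
        upt_Suc)
      then show "f = g" using f g by (intro PiE_ext[of f "{1..k}" "\<lambda>_. verts G" g]) auto
    qed
    then have cE: "card ?E = inj_count (clique k) G"
      by (simp add: card_image inj_count_def complete_r_graph_def)
    have sub: "?E \<subseteq> {xs. set xs \<subseteq> verts G \<and> length xs = k}"
      by (auto simp: PiE_iff simp del: upt_Suc)
    have "contains_box k t ?E" using N0[OF fG G(2) sub] big unfolding cE .
    then obtain A where A: "\<And>i. i < k \<Longrightarrow> finite (A i) \<and> card (A i) = t"
      "\<And>xs. length xs = k \<Longrightarrow> (\<forall>i<k. xs ! i \<in> A i) \<Longrightarrow> xs \<in> ?E"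
      unfolding contains_box_def by blast
    have "\<exists>h. bij_betw h (verts F) (A i)" if "i < k" for i
      using A(1)[OF that] F(1) finite_same_card_bij[of "verts F" "A i"]
      by (simp add: t_def r_graph_def)
    then obtain h where h: "\<And>i. i < k \<Longrightarrow> bij_betw (h i) (verts F) (A i)" by metis
    obtain c :: "'b \<Rightarrow> nat" where c: "\<And>v. v \<in> verts F \<Longrightarrow> c v < k"
      "\<And>u v. {u, v} \<in> edges F \<Longrightarrow> c u \<noteq> c v"
      using chromatic_number_coloring[OF F(1)] F(2) by (metis order_less_le_trans)
    \<comment> \<open>Each part has one slot for every vertex of \<open>F\<close>; the vertex
      \<open>v\<close> uses its own slot in the part given by its color.\<close>
    define \<phi> where "\<phi> v = h (c v) v" for v
    have e: "\<phi> u \<in> verts G \<and> (c u \<noteq> c v \<longrightarrow> {\<phi> u, \<phi> v} \<in> edges G)"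
      if uv: "u \<in> verts F" "v \<in> verts F" for u v
    proof -
      \<comment> \<open>A tuple of the box through both \<phi> u and \<phi> v. The other positions
        are filled with arbitrary members of their parts, and the clique structure of the tuple
        makes the two vertices adjacent.\<close>
      define xs where "xs = map (\<lambda>i. if i = c u then \<phi> u else if i
        = c v then \<phi> v else h i u) [0..<k]"
      have "\<forall>i<k. xs ! i \<in> A i"
        using h uv by (auto simp: xs_def \<phi>_def bij_betw_def)
      then have "xs \<in> ?E" by (intro A(2)) (simp_all add: xs_def)
      then obtain f where f: "f \<in> ?H" "xs = map f [1..<Suc k]" by blast
      have xf: "xs ! i = f (Suc i)" if "i < k" for i using f(2) that by (simp del: upt_Suc)
      have u: "f (Suc (c u)) = \<phi> u" using xf[OF c(1)[OF uv(1)]] c(1)[OF uv(1)] by (simp add: xs_def)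
      have "{\<phi> u, \<phi> v} \<in> edges G" if ne: "c u \<noteq> c v"
      proof -
        have v: "f (Suc (c v)) = \<phi> v"
          using xf[OF c(1)[OF uv(2)]] c(1)[OF uv(2)] ne by (simp add: xs_def)
        have "{f (Suc (c u)), f (Suc (c v))} \<in> edges G"
          using homomorphism_complete_graph[of f k G] f(1) c(1)[OF uv(1)] c(1)[OF uv(2)] ne
          by (auto simp: PiE_iff image_subset_iff)
        then show ?thesis by (simp only: u v)
      qed
      moreover have "f (Suc (c u)) \<in> verts G" using f(1) c(1)[OF uv(1)] by (auto simp: PiE_mem)
      ultimately show ?thesis using u by simp
    qed
    \<comment> \<open>Within a color \<open>h\<close> is injective; vertices of different colors
      have adjacent, hence distinct, images.\<close>
    have "inj_on \<phi> (verts F)"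
    proof (rule inj_onI, rule ccontr)
      fix u v assume uv: "u \<in> verts F" "v \<in> verts F" "\<phi> u = \<phi> v" "u \<noteq> v"
      show False
      proof (cases "c u = c v")
        case True
        then show False using h[OF c(1)[OF uv(1)]] uv by (auto simp: \<phi>_def bij_betw_def inj_on_def)
      next
        case False
        then have "card {\<phi> u, \<phi> v} = 2" using e[OF uv(1,2)] G(1) unfolding r_graph_def by blast
        then show False using uv by simp
      qed
    qed
    moreover have "homomorphism \<phi> F G"
      unfolding homomorphism_def
    proof (intro conjI ballI)
      show "\<phi> ` verts F \<subseteq> verts G" using e by blast
      fix p assume p: "p \<in> edges F"
      then obtain u v where "p = {u, v}" "u \<in> verts F" "v \<in> verts F"
        by (blast elim: graph_edgeE[OF F(1)])
      then show "\<phi> ` p \<in> edges G" using e c(2) p by auto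
    qed
    ultimately show False using G(3) by (auto simp: free_of_def)
  qed
qed

text \<open>The graph that \<open>G\<close> induces on the sample \<phi> 0, ..., \<phi> (m - 1),
  where repetitions are allowed: positions with the same image are never adjacent when
  \<open>G\<close> has no loops. Working with positions gives exactly \<open>m\<close> vertices for
  every \<phi>, so the extremal number at \<open>m\<close> applies without conditioning on
  injectivity.\<close>

definition pullback :: "nat \<Rightarrow> (nat \<Rightarrow> 'a) \<Rightarrow> 'a hypergraph \<Rightarrow> nat hypergraph" where
  "pullback m \<phi> G = ({..<m}, {{i, j} | i j. i < m \<and> j < m \<and> {\<phi> i, \<phi> j} \<in> edges G})"

lemma verts_pullback [simp]: "verts (pullback m \<phi> G) = {..<m}"
  by (simp add: pullback_def)

lemma edges_pullback: "{i, j} \<in> edges (pullback m \<phi> G) \<longleftrightarrow> i < m \<and> j < m \<and> {\<phi> i, \<phi> j} \<in> edges G"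
  by (auto simp: pullback_def doubleton_eq_iff insert_commute)

lemma r_graph_pullback:
  assumes "r_graph 2 G"
  shows "r_graph 2 (pullback m \<phi> G)"
proof -
  have "i \<noteq> j" if "{\<phi> i, \<phi> j} \<in> edges G" for i j
  proof
    assume "i = j"
    then have "card {\<phi> i, \<phi> j} = 1" by simp
    then show False using assms that unfolding r_graph_def by fastforce
  qed
  then show ?thesis by (auto simp: r_graph_def pullback_def card_insert_if)
qed

lemma homomorphism_pullback:
  assumes P: "r_graph 2 P" and f: "f ` verts P \<subseteq> {..<m}" and \<phi>: "\<phi> ` {..<m} \<subseteq> verts G"
  shows "homomorphism f P (pullback m \<phi> G) \<longleftrightarrow> homomorphism (restrict (\<phi> \<circ> f) (verts P)) P G"
proof -
  have "f ` e \<in> edges (pullback m \<phi> G) \<longleftrightarrow> restrict (\<phi> \<circ> f) (verts P) ` e \<in> edges G"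
    if eP: "e \<in> edges P" for e
  proof -
    obtain x y where e: "e = {x, y}" and "x \<in> verts P" "y \<in> verts P"
      using graph_edgeE[OF P eP] by metis
    then show ?thesis using edges_pullback[of "f x" "f y" m \<phi> G] f e by auto
  qed
  then show ?thesis using f \<phi> by (auto simp: homomorphism_def)
qed

text \<open>Count pairs of an injection of \<open>P\<close> into the positions and a map \<phi> in
  both orders. Only an inequality results, because a copy of \<open>P\<close> in the pullback may
  collapse to a non-injective map into \<open>G\<close>.\<close>

lemma sum_inj_count_pullback:
  assumes P: "r_graph 2 P" and G: "finite (verts G)"
  shows "card {\<iota> \<in> verts P \<rightarrow>\<^sub>E {..<m}. inj_on \<iota> (verts P)} * inj_count P G *
      vcard G ^ (m - vcard P)
    \<le> (\<Sum>\<phi>\<in>{..<m} \<rightarrow>\<^sub>E verts G. inj_count P (pullback m \<phi> G))"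
proof -
  let ?I = "{\<iota> \<in> verts P \<rightarrow>\<^sub>E {..<m}. inj_on \<iota> (verts P)}"
  let ?\<Phi> = "{..<m} \<rightarrow>\<^sub>E verts G"
  let ?R = "(inj_homs P G)"
  note fP = finite_verts[OF P]
  have fI: "finite ?I" by (rule finite_filter_PiE) (use fP in auto)
  have f\<Phi>: "finite ?\<Phi>" using G by (intro finite_PiE) auto
  have "card ?R * vcard G ^ (m - vcard P) \<le>
     card {\<phi> \<in> ?\<Phi>. homomorphism \<iota> P (pullback m \<phi> G)}" if \<iota>: "\<iota> \<in> ?I" for \<iota>
  proof -
    have sub: "\<iota> ` verts P \<subseteq> {..<m}" using \<iota> by (auto simp: PiE_mem)
    have "card {\<phi> \<in> ?\<Phi>. restrict (\<phi> \<circ> \<iota>) (verts P) \<in> ?R}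
       = card ?R * vcard G ^ (card {..<m} - vcard P)"
      using \<iota> sub G by (intro card_pullback) auto
    moreover have "card {\<phi> \<in> ?\<Phi>. restrict (\<phi> \<circ> \<iota>) (verts P) \<in> ?R}
       \<le> card {\<phi> \<in> ?\<Phi>. homomorphism \<iota> P (pullback m \<phi> G)}"
    proof (rule card_mono)
      show "{\<phi> \<in> ?\<Phi>. restrict (\<phi> \<circ> \<iota>) (verts P) \<in> ?R} \<subseteq> {\<phi> \<in> ?\<Phi>. homomorphism \<iota> P (pullback m \<phi> G)}"
      proof clarify
        fix \<phi> assume \<phi>: "\<phi> \<in> ?\<Phi>" "homomorphism (restrict (\<phi> \<circ> \<iota>) (verts P)) P G"
        then have "\<phi> ` {..<m} \<subseteq> verts G" by auto
        then show "homomorphism \<iota> P (pullback m \<phi> G)" using homomorphism_pullback[OF P sub] \<phi>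
          by blast
      qed
    qed (use f\<Phi> in auto)
    ultimately show ?thesis by simp
  qed
  then have "(\<Sum>\<iota>\<in>?I. card ?R * vcard G ^ (m - vcard P)) \<le>
     (\<Sum>\<iota>\<in>?I. card {\<phi> \<in> ?\<Phi>. homomorphism \<iota> P (pullback m \<phi> G)})" by (rule sum_mono)
  also have "\<dots> = (\<Sum>\<iota>\<in>?I. \<Sum>\<phi>\<in>?\<Phi>. if homomorphism \<iota> P (pullback m \<phi> G) then 1 else 0)"
    using f\<Phi> by (simp flip: sum.inter_filter)
  also have "\<dots> = (\<Sum>\<phi>\<in>?\<Phi>. \<Sum>\<iota>\<in>?I. if homomorphism \<iota> P (pullback m \<phi> G) then 1 else 0)"
    by (rule sum.swap)
  also have "\<dots> = (\<Sum>\<phi>\<in>?\<Phi>. inj_count P (pullback m \<phi> G))"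
    using fI by (intro sum.cong refl) (simp add: inj_count_def conj_assoc flip: sum.inter_filter)
  finally show ?thesis by (simp add: inj_count_def mult_ac)
qed

text \<open>Union bound over at most m ^ k placements of the clique. In contrast to general copies,
  a clique in the pullback cannot collapse, as its vertices are pairwise adjacent.\<close>

lemma card_pullback_containing_clique:
  assumes G: "r_graph 2 G"
  shows "card {\<phi> \<in> {..<m} \<rightarrow>\<^sub>E verts G. \<not> free_of {clique k} (pullback m \<phi> G)}
    \<le> m ^ k * (inj_count (clique k) G * vcard G ^ (m - k))"
proof -
  let ?K = "clique k"
  let ?\<Phi> = "{..<m} \<rightarrow>\<^sub>E verts G"
  let ?I = "{\<iota> \<in> {1..k} \<rightarrow>\<^sub>E {..<m}. inj_on \<iota> {1..k}}"
  let ?R = "(inj_homs ?K G)"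
  have vK: "verts ?K = {1..k}" by (simp add: complete_r_graph_def)
  have rK: "r_graph 2 ?K" by (auto simp: r_graph_def complete_r_graph_def)
  note fG = finite_verts[OF G(1)]
  have fI: "finite ?I" by (rule finite_filter_PiE) auto
  have f\<Phi>: "finite ?\<Phi>" using fG by (intro finite_PiE) auto
  have "{\<phi> \<in> ?\<Phi>. \<not> free_of {?K} (pullback m \<phi> G)} \<subseteq>
     (\<Union>\<iota>\<in>?I. {\<phi> \<in> ?\<Phi>. restrict (\<phi> \<circ> \<iota>) {1..k} \<in> ?R})"
  proof clarify
    fix \<phi> assume \<phi>: "\<phi> \<in> ?\<Phi>" "\<not> free_of {?K} (pullback m \<phi> G)"
    then obtain f where f: "inj_on f {1..k}" "homomorphism f ?K (pullback m \<phi> G)"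
      by (auto simp: free_of_def vK)
    have sub: "f ` {1..k} \<subseteq> {..<m}" using f(2) by (simp add: homomorphism_def vK)
    have \<phi>V: "\<phi> ` {..<m} \<subseteq> verts G" using \<phi>(1) by auto
    define \<iota> where "\<iota> = restrict f {1..k}"
    have \<iota>: "\<iota> \<in> ?I" using f(1) sub by (simp add: \<iota>_def inj_on_restrict_eq image_subset_iff)
    let ?g = "restrict (\<phi> \<circ> f) {1..k}"
    have g: "?g = restrict (\<phi> \<circ> \<iota>) {1..k}" by (auto simp: \<iota>_def)
    have hom: "homomorphism ?g ?K G"
      using homomorphism_pullback[OF rK, of f m \<phi> G] sub \<phi>V f(2) by (simp add: vK)
    have e: "{\<phi> (f i), \<phi> (f j)} \<in> edges G" if "i \<in> {1..k}" "j \<in> {1..k}" "i \<noteq> j" for i j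
      using homomorphism_complete_graph[OF f(1), of "pullback m \<phi> G"] f(2) sub that
      by (simp add: edges_pullback)
    have "inj_on ?g {1..k}"
    proof (rule inj_onI, rule ccontr)
      fix i j assume ij: "i \<in> {1..k}" "j \<in> {1..k}" "?g i = ?g j" "i \<noteq> j"
      then have "card {\<phi> (f i), \<phi> (f j)} = 2" using e G unfolding r_graph_def by blast
      then show False using ij by simp
    qed
    moreover have "?g \<in> {1..k} \<rightarrow>\<^sub>E verts G" using sub \<phi>V by (auto simp: image_subset_iff)
    ultimately have "?g \<in> ?R" using hom by (simp add: vK)
    then show "\<phi> \<in> (\<Union>\<iota>\<in>?I. {\<phi> \<in> ?\<Phi>. restrict (\<phi> \<circ> \<iota>) {1..k} \<in> ?R})"
      using \<phi>(1) \<iota> unfolding g by blast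
  qed
  then have "card {\<phi> \<in> ?\<Phi>. \<not> free_of {?K} (pullback m \<phi> G)} \<le>
     card (\<Union>\<iota>\<in>?I. {\<phi> \<in> ?\<Phi>. restrict (\<phi> \<circ> \<iota>) {1..k} \<in> ?R})"
    using fI f\<Phi> by (intro card_mono) auto
  also have "\<dots> \<le> (\<Sum>\<iota>\<in>?I. card {\<phi> \<in> ?\<Phi>. restrict (\<phi> \<circ> \<iota>) {1..k} \<in> ?R})"
    by (rule card_UN_le[OF fI])
  also have "\<dots> = (\<Sum>\<iota>\<in>?I. card ?R * vcard G ^ (card {..<m} - card {1..k}))"
    by (intro sum.cong refl card_pullback) (use fG vK in \<open>auto simp: PiE_mem\<close>)
  also have "\<dots> = card ?I * (inj_count ?K G * vcard G ^ (m - k))"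
    by (simp add: inj_count_def)
  also have "card ?I \<le> card ({1..k} \<rightarrow>\<^sub>E {..<m})" by (intro card_mono finite_PiE) auto
  then have "card ?I * (inj_count ?K G * vcard G ^ (m - k))
     \<le> m ^ k * (inj_count ?K G * vcard G ^ (m - k))"
    by (intro mult_right_mono) (auto simp: card_PiE)
  finally show ?thesis .
qed

text \<open>The same double count for lists. Since lists may repeat vertices, nothing collapses and
  equality holds.\<close>

lemma sum_pullback_lists:
  assumes V: "finite V" and X: "X \<subseteq> {xs. set xs \<subseteq> V \<and> length xs = k}"
  shows "card {\<iota> \<in> {..<k} \<rightarrow>\<^sub>E {..<m}. inj_on \<iota> {..<k}} * (card X * card V ^ (m - k)) =
    (\<Sum>\<phi>\<in>{..<m} \<rightarrow>\<^sub>E V. card {\<iota> \<in> {..<k} \<rightarrow>\<^sub>E {..<m}. inj_on \<iota> {..<k} \<and> map (\<phi> \<circ> \<iota>) [0..<k] \<in> X})"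
proof -
  let ?I = "{\<iota> \<in> {..<k} \<rightarrow>\<^sub>E {..<m}. inj_on \<iota> {..<k}}"
  let ?\<Phi> = "{..<m} \<rightarrow>\<^sub>E V"
  let ?R = "{g \<in> {..<k} \<rightarrow>\<^sub>E V. map g [0..<k] \<in> X}"
  have fI: "finite ?I" by (rule finite_filter_PiE) auto
  have f\<Phi>: "finite ?\<Phi>" using V by (intro finite_PiE) auto
  have "bij_betw (\<lambda>g. map g [0..<k]) ?R X"
  proof (rule bij_betw_byWitness[where f' = "\<lambda>xs. \<lambda>i\<in>{..<k}. xs ! i"])
    show "\<forall>g\<in>?R. (\<lambda>i\<in>{..<k}. map g [0..<k] ! i) = g"
    proof clarify
      fix g assume g: "g \<in> {..<k} \<rightarrow>\<^sub>E V"
      show "(\<lambda>i\<in>{..<k}. map g [0..<k] ! i) = g"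
      proof
        fix i show "(\<lambda>i\<in>{..<k}. map g [0..<k] ! i) i = g i" using PiE_arb[OF g, of i] by auto
      qed
    qed
    have *: "map (\<lambda>i\<in>{..<k}. xs ! i) [0..<k] = xs" if "xs \<in> X" for xs
      using X that by (intro nth_equalityI) auto
    then show "\<forall>xs\<in>X. map (\<lambda>i\<in>{..<k}. xs ! i) [0..<k] = xs" by blast
    show "(\<lambda>g. map g [0..<k]) ` ?R \<subseteq> X" by auto
    show "(\<lambda>xs. \<lambda>i\<in>{..<k}. xs ! i) ` X \<subseteq> ?R"
    proof (rule image_subsetI)
      fix xs assume xs: "xs \<in> X"
      then have "set xs \<subseteq> V" "length xs = k" using X by auto
      then have "(\<lambda>i\<in>{..<k}. xs ! i) \<in> {..<k} \<rightarrow>\<^sub>E V" by (auto intro!: nth_mem[THEN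
        subsetD[rotated]])
      then show "(\<lambda>i\<in>{..<k}. xs ! i) \<in> ?R" using *[OF xs] xs by simp
    qed
  qed
  then have cR: "card ?R = card X" by (rule bij_betw_same_card)
  have X_iff: "map (\<phi> \<circ> \<iota>) [0..<k] \<in> X \<longleftrightarrow> restrict (\<phi> \<circ> \<iota>) {..<k} \<in> ?R" if "\<phi> \<in> ?\<Phi>" "\<iota> \<in> ?I" for \<phi> \<iota>
  proof -
    have "map (restrict (\<phi> \<circ> \<iota>) {..<k}) [0..<k] = map (\<phi> \<circ> \<iota>) [0..<k]" by simp
    moreover have "restrict (\<phi> \<circ> \<iota>) {..<k} \<in> {..<k} \<rightarrow>\<^sub>E V" using that by (auto simp: PiE_mem)
    ultimately show ?thesis by (simp del: map_eq_conv)
  qed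
  have "card {\<phi> \<in> ?\<Phi>. map (\<phi> \<circ> \<iota>) [0..<k] \<in> X} = card X * card V ^ (m - k)" if "\<iota> \<in> ?I" for \<iota>
  proof -
    have "{\<phi> \<in> ?\<Phi>. map (\<phi> \<circ> \<iota>) [0..<k] \<in> X} = {\<phi> \<in> ?\<Phi>. restrict (\<phi> \<circ> \<iota>) {..<k} \<in> ?R}"
      using that X_iff by blast
    also have "card \<dots> = card ?R * card V ^ (card {..<m} - card {..<k})"
      using that V by (intro card_pullback) (auto simp: PiE_mem)
    finally show ?thesis by (simp add: cR)
  qed
  then have "card ?I * (card X * card V ^ (m - k)) = (\<Sum>\<iota>\<in>?I. card {\<phi> \<in> ?\<Phi>. map (\<phi> \<circ> \<iota>) [0..<k] \<in>
    X})"
    by simp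
  also have "\<dots> = (\<Sum>\<iota>\<in>?I. \<Sum>\<phi>\<in>?\<Phi>. if map (\<phi> \<circ> \<iota>) [0..<k] \<in> X then 1 else 0)"
    using f\<Phi> by (simp flip: sum.inter_filter)
  also have "\<dots> = (\<Sum>\<phi>\<in>?\<Phi>. \<Sum>\<iota>\<in>?I. if map (\<phi> \<circ> \<iota>) [0..<k] \<in> X then 1 else 0)"
    by (rule sum.swap)
  also have "\<dots> = (\<Sum>\<phi>\<in>?\<Phi>. card {\<iota> \<in> {..<k} \<rightarrow>\<^sub>E {..<m}. inj_on \<iota> {..<k} \<and> map (\<phi> \<circ> \<iota>) [0..<k] \<in> X})"
    using fI by (intro sum.cong refl) (simp add: conj_assoc flip: sum.inter_filter)
  finally show ?thesis .
qed

text \<open>A choice of positions that avoids the deleted pairs inherits the coloring of the rest of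
  the pullback. So an uncolorable choice sends one of at most k ^ 2 pairs onto a member of
  \<open>D\<close>, in at most 4 m ^ (k - 2) ways for each such combination.\<close>

lemma few_uncolorable_if_close:
  assumes D: "D \<subseteq> edges (pullback m \<phi> G)" and G: "r_graph 2 G"
    and col: "({..<m}, edges (pullback m \<phi> G) - D) \<in> colorable_family 2 l"
  shows "card {\<iota> \<in> {..<k} \<rightarrow>\<^sub>E {..<m}. inj_on \<iota> {..<k} \<and>
      \<not> multi_colorable (edges G) (\<lambda>_. {1..l}) (set (map (\<phi> \<circ> \<iota>) [0..<k]))}
    \<le> 4 * k\<^sup>2 * card D * m ^ (k - 2)"
proof -
  let ?mc = "\<lambda>\<iota>. multi_colorable (edges G) (\<lambda>_. {1..l}) (set (map (\<phi> \<circ> \<iota>) [0..<k]))"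
  let ?B = "{\<iota> \<in> {..<k} \<rightarrow>\<^sub>E {..<m}. inj_on \<iota> {..<k} \<and> \<not> ?mc \<iota>}"
  obtain c where c: "proper_coloring l ({..<m}, edges (pullback m \<phi> G) - D) c"
    using col by (auto simp: colorable_family_iff)
  let ?S = "{e. e \<subseteq> {..<k} \<and> card e = 2}"
  have rp: "r_graph 2 (pullback m \<phi> G)" using G by (rule r_graph_pullback)
  have "?B
    \<subseteq> {\<iota> \<in> {..<k} \<rightarrow>\<^sub>E {..<m}. \<exists>e\<in>?S. \<iota> ` e \<in> D}"
  proof clarify
    fix \<iota> assume \<iota>: "\<iota> \<in> {..<k} \<rightarrow>\<^sub>E {..<m}" "inj_on \<iota> {..<k}"
      and bad: "\<not> ?mc \<iota>"
    show "\<exists>e\<in>?S. \<iota> ` e \<in> D"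
    proof (rule ccontr)
      assume no: "\<not> (\<exists>e\<in>?S. \<iota> ` e \<in> D)"
      \<comment> \<open>Distinct positions may have the same image under \<phi> but different
        colors; here the coloring has to be a relation.\<close>
      let ?C = "(\<lambda>i. (\<phi> (\<iota> i), c (\<iota> i))) ` {..<k}"
      have im: "\<iota> i < m" if "i < k" for i using \<iota>(1) that by (auto simp: PiE_mem)
      have "c (\<iota> i) \<noteq> c (\<iota> j)" if ij: "i < k" "j < k" "{\<phi> (\<iota> i), \<phi> (\<iota> j)} \<in> edges G" for i j
      proof -
        have e: "{\<iota> i, \<iota> j} \<in> edges (pullback m \<phi> G)" using ij im by (simp add: edges_pullback)
        then have "card {\<iota> i, \<iota> j} = 2" using rp unfolding r_graph_def by blast
        then have ne: "\<iota> i \<noteq> \<iota> j" by auto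
        then have "{i, j} \<in> ?S" using ij by (auto simp: card_2_iff)
        then have "{\<iota> i, \<iota> j} \<notin> D" using no by force
        then have "inj_on c {\<iota> i, \<iota> j}" using c e unfolding proper_coloring_def snd_conv by blast
        then show ?thesis using ne by (auto dest: inj_onD)
      qed
      moreover have "c (\<iota> i) \<in> {1..l}" if "i < k" for i
        using c im[OF that] by (auto simp: proper_coloring_def)
      ultimately have "?mc \<iota>"
        unfolding multi_colorable_def by (intro exI[of _ ?C]) (auto simp: image_image
          atLeast0LessThan)
      then show False using bad by simp
    qed
  qed
  then have "card ?B
    \<le> card {\<iota> \<in> {..<k} \<rightarrow>\<^sub>E {..<m}. \<exists>e\<in>?S. \<iota> ` e \<in> D}"
    by (rule card_mono[OF finite_filter_PiE, rotated 2]) auto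
  also have "\<dots> \<le> card ?S * card D * (2 ^ 2 * card {..<m} ^ (card {..<k} - 2))"
    using D rp finite_subset[OF D finite_edges[OF rp]]
    by (intro card_maps_hitting_le) (auto simp: r_graph_def)
  also have "card ?S = k choose 2" using n_subsets[of "{..<k}" 2] by simp
  also have "k choose 2 \<le> k\<^sup>2" by (cases "2 \<le> k") (auto simp: binomial_le_pow binomial_eq_0)
  then have "(k choose 2) * card D * (2 ^ 2 * card {..<m} ^ (card {..<k} - 2)) \<le>
    k\<^sup>2 * card D * (2 ^ 2 * card {..<m} ^ (card {..<k} - 2))"
    by (intro mult_right_mono) auto
  finally show ?thesis by (simp add: mult_ac)
qed

section \<open>Stability for graphs without F\<close>

lemma edge_stable_iff:
  "edge_stable r Q \<F> \<K> \<longleftrightarrow>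
    (\<forall>\<epsilon>>0. \<exists>\<delta>>0. \<exists>N. near_max_imp r Q \<F> \<delta> N (deletion_close r \<epsilon> \<K>))"
  unfolding edge_stable_def by (intro all_cong1 imp_cong ex_cong1 conj_cong refl) auto

section \<open>Averaging copies and uncolorable lists over samples\<close>

lemma card_inj_maps:
  assumes "finite A" "card A \<le> m"
  shows "(m - card A) ^ card A \<le> card {f \<in> A \<rightarrow>\<^sub>E {..<m}. inj_on f A}"
    "card {f \<in> A \<rightarrow>\<^sub>E {..<m}. inj_on f A} \<le> m ^ card A"
proof -
  show "(m - card A) ^ card A \<le> card {f \<in> A \<rightarrow>\<^sub>E {..<m}. inj_on f A}"
    using assms by (intro card_inj_PiE_ge) auto
  have "card {f \<in> A \<rightarrow>\<^sub>E {..<m}. inj_on f A} \<le> card (A \<rightarrow>\<^sub>E {..<m})"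
    using assms by (intro card_mono finite_PiE) auto
  then show "card {f \<in> A \<rightarrow>\<^sub>E {..<m}. inj_on f A} \<le> m ^ card A"
    using assms by (simp add: card_PiE)
qed

text \<open>Non-injective placements cost a factor (1 - v / m) ^ v, and rounding in the blow-up
  costs (1 - m / n) ^ v. The common bound (1 - x) ^ v with x = v / m + m / n is estimated by
  Bernoulli's inequality.\<close>

lemma blowup_loss:
  fixes m n v :: nat and \<eta> :: real
  assumes "0 < m" "2 * v \<le> m" "2 * m \<le> n"
    and "2 * real v ^ 2 \<le> \<eta> * real m" "2 * real v * real m \<le> \<eta> * real n"
  shows "(1 - \<eta>) * real n ^ v \<le> real (m - v) ^ v * real (n div m) ^ v"
proof -
  have n: "0 < n" using assms by simp
  define x where "x = real v / real m + real m / real n"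
  have x1: "x \<le> 1"
  proof -
    have "real v / real m \<le> 1 / 2" "real m / real n \<le> 1 / 2"
      using assms n by (auto simp: field_simps)
    then show ?thesis unfolding x_def by linarith
  qed
  have "real v * x = real v ^ 2 / real m + real v * real m / real n"
    by (simp add: x_def power2_eq_square distrib_left)
  also have "real v ^ 2 / real m \<le> \<eta> / 2" using assms by (simp add: field_simps)
  also have "real v * real m / real n \<le> \<eta> / 2" using assms n by (simp add: field_simps)
  finally have vx: "real v * x \<le> \<eta>" by simp
  have "n div m * m + n mod m = n" "n mod m < m" using assms by simp_all
  then have "n \<le> n div m * m + m" by linarith
  then have "real n \<le> real (n div m * m + m)" by (rule of_nat_mono)
  then have "real n \<le> real (n div m) * real m + real m" by simp
  then have div: "real n / real m - 1 \<le> real (n div m)" using assms by (simp add: field_simps)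
  have "real n * (1 - x) \<le> (real m - real v) * (real n / real m - 1)"
    using assms n by (simp add: x_def field_simps)
  also have "\<dots> \<le> (real m - real v) * real (n div m)" using assms div by (intro mult_left_mono) auto
  also have "\<dots> = real (m - v) * real (n div m)" using assms by (simp add: of_nat_diff)
  finally have "(real n * (1 - x)) ^ v \<le> (real (m - v) * real (n div m)) ^ v"
    using x1 by (intro power_mono) auto
  moreover have "1 - \<eta> \<le> (1 - x) ^ v"
    using Bernoulli_inequality[of "- x" v] x1 vx by simp
  then have "(1 - \<eta>) * real n ^ v \<le> (1 - x) ^ v * real n ^ v" by (intro mult_right_mono) auto
  ultimately show ?thesis by (simp add: power_mult_distrib mult.commute)
qed

text \<open>By blow-ups, the mean number of copies of \<open>P\<close> in a sample is nearly the
  extremal number \<open>I\<close> at size \<open>m\<close>. Samples without the clique have at most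
  \<open>I\<close> copies, and at most (1 - \<delta>0) I if they are far; samples with the clique
  are too rare to compensate. So far samples are rare as well. If \<open>I\<close> is 0, no
  clique-free sample is far, because each is trivially extremal.\<close>

lemma few_far_samples:
  fixes P :: "'a hypergraph" and F :: "'b hypergraph" and \<epsilon> \<kappa> :: real
  assumes P: "r_graph 2 P" and l: "1 \<le> l" and F: "r_graph 2 F" "chromatic_number F \<le> l + 1"
    and stable: "edge_stable 2 P {clique (l + 1)} (colorable_family 2 l)"
    and \<epsilon>: "0 < \<epsilon>" and \<kappa>: "0 < \<kappa>"
  shows "\<exists>m\<ge>M. \<exists>\<delta>>0. \<exists>N0. \<forall>G :: nat hypergraph. r_graph 2 G \<longrightarrow> N0 \<le> vcard G \<longrightarrow> free_of {F} G \<longrightarrow>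
      near_max_additive l P \<delta> G \<longrightarrow>
      real (card {\<phi> \<in> {..<m} \<rightarrow>\<^sub>E verts G. \<not> (deletion_close 2 \<epsilon> (colorable_family 2 l) (pullback m
        \<phi> G))}) \<le> \<kappa> * real (vcard G) ^ m"
proof -
  let ?K = "clique (l + 1)"
  define v where "v = vcard P"
  note fP = finite_verts[OF P]
  obtain \<delta>0 N1 where \<delta>0: "0 < \<delta>0" and N1: "near_max_imp 2 P {?K} \<delta>0 N1 (deletion_close 2 \<epsilon>
    (colorable_family 2 l))"
    using stable[unfolded edge_stable_iff, rule_format, OF \<epsilon>] by (elim exE conjE)
  note N1 = N1[rule_format]
  \<comment> \<open>The errors below add up to 3 \<eta>, and 3 / 8 \<delta>0 \<kappa> is less than
    half of \<delta>0 \<kappa>. The other bound leaves the second half of \<kappa> for the samples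
    that contain the clique.\<close>
  define \<eta> where "\<eta> = min (\<kappa> / 2) (\<delta>0 * \<kappa> / 8)"
  have \<eta>: "0 < \<eta>" "\<eta> \<le> \<kappa> / 2" "\<eta> \<le> \<delta>0 * \<kappa> / 8" using \<delta>0 \<kappa> by (auto simp: \<eta>_def)
  define m where "m = N1 + M + 2 * v + (l + 1) + nat \<lceil>2 * real v ^ 2 / \<eta>\<rceil>"
  have m: "N1 \<le> m" "M \<le> m" "2 * v \<le> m" "l + 1 \<le> m" "nat \<lceil>2 * real v ^ 2 / \<eta>\<rceil> \<le> m"
    unfolding m_def by linarith+
  have m0: "0 < m" using m(4) by simp
  have m\<eta>: "2 * real v ^ 2 \<le> \<eta> * real m"
  proof -
    have "2 * real v ^ 2 / \<eta> \<le> real m" using m(5) by linarith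
    then show ?thesis using \<eta> by (simp add: field_simps)
  qed
  \<comment> \<open>The power m ^ (l + 1) pays for the union bound over placements of the clique,
    and m ^ v for the most copies that a sample containing it can have.\<close>
  define \<beta> where "\<beta> = \<eta> / real m ^ (l + 1 + v)"
  have \<beta>: "0 < \<beta>" using \<eta> m0 by (simp add: \<beta>_def)
  obtain N2 where N2: "\<And>G :: nat hypergraph. r_graph 2 G \<Longrightarrow> N2 \<le> vcard G \<Longrightarrow> free_of {F} G \<Longrightarrow>
    real (inj_count ?K G) < \<beta> * real (vcard G) ^ (l + 1)"
    using few_cliques[OF F \<beta>, where 'a = nat] by blast
  define N0 where "N0 = N2 + 2 * m + nat \<lceil>2 * real v * real m / \<eta>\<rceil>"
  have N0: "N2 \<le> N0" "2 * m \<le> N0" "nat \<lceil>2 * real v * real m / \<eta>\<rceil> \<le> N0"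
    unfolding N0_def by linarith+
  \<comment> \<open>There are at most m ^ v placements of \<open>P\<close>, each inheriting the
    additive error of \<open>G\<close>; this \<delta> keeps their total at \<eta> T.\<close>
  define \<delta> where "\<delta> = \<eta> / real m ^ v"
  have \<delta>: "0 < \<delta>" using \<eta> m0 by (simp add: \<delta>_def)
  show ?thesis
  proof (rule exI[of _ m], rule conjI[OF m(2)], rule exI[of _ \<delta>], rule conjI[OF \<delta>],
      rule exI[of _ N0], intro allI impI)
    fix G :: "nat hypergraph"
    assume G: "r_graph 2 G" "N0 \<le> vcard G" "free_of {F} G"
      and near: "near_max_additive l P \<delta> G"
    define n where "n = vcard G"
    define I where "I = inj_max 2 m P {?K}"
    define \<Phi> where "\<Phi> = {..<m} \<rightarrow>\<^sub>E verts G"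
    define X where "X \<phi> = inj_count P (pullback m \<phi> G)" for \<phi>
    define far where "far \<phi> \<longleftrightarrow> \<not> (deletion_close 2 \<epsilon> (colorable_family 2 l) (pullback m \<phi> G))" for \<phi>
    define B where "B = {\<phi> \<in> \<Phi>. free_of {?K} (pullback m \<phi> G) \<and> far \<phi>}"
    define C where "C = {\<phi> \<in> \<Phi>. \<not> free_of {?K} (pullback m \<phi> G)}"
    define J where "J = card {\<iota> \<in> verts P \<rightarrow>\<^sub>E {..<m}. inj_on \<iota> (verts P)}"
    define T where "T = real n ^ m"
    note fG = finite_verts[OF G(1)]
    have f\<Phi>: "finite \<Phi>" unfolding \<Phi>_def using fG by (intro finite_PiE) auto
    have c\<Phi>: "real (card \<Phi>) = T" using fG by (simp add: \<Phi>_def T_def n_def card_PiE)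
    have T0: "0 \<le> T" by (simp add: T_def)
    have n: "2 * m \<le> n" "N2 \<le> n" using G(2) N0 by (simp_all add: n_def)
    have n\<eta>: "2 * real v * real m \<le> \<eta> * real n"
    proof -
      have "2 * real v * real m / \<eta> \<le> real n" using N0(3) G(2) unfolding n_def by linarith
      then show ?thesis using \<eta> by (simp add: field_simps)
    qed
    have vm: "v \<le> m" using m by simp
    have T_split: "real n ^ v * real n ^ (m - v) = T"
      unfolding T_def power_add[symmetric] using vm by simp
    have Xm: "X \<phi> \<le> m ^ v" for \<phi>
      using inj_count_le[of P "pullback m \<phi> G"] fP by (simp add: X_def v_def)
    have XI: "X \<phi> \<le> I" if "free_of {?K} (pullback m \<phi> G)" for \<phi>
      unfolding X_def I_def using that r_graph_pullback[OF G(1)] by (intro inj_max_ge[OF fP]) auto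
    have Xbad: "real (X \<phi>) \<le> (1 - \<delta>0) * real I" "0 < I" if "\<phi> \<in> B" for \<phi>
    proof -
      have "real (X \<phi>) < (1 - \<delta>0) * real I"
      proof (rule ccontr)
        assume "\<not> ?thesis"
        then have "\<not> far \<phi>"
          using N1[OF r_graph_pullback[OF G(1)], of m \<phi>] m(1) that
          by (auto simp: far_def B_def I_def X_def not_less)
        then show False using that by (simp add: B_def)
      qed
      then show "real (X \<phi>) \<le> (1 - \<delta>0) * real I" "0 < I" by (auto intro: Nat.gr0I)
    qed
    have cC: "real (card C) \<le> \<eta> * T / real m ^ v"
    proof -
      have "real (card C) \<le> real (m ^ (l + 1) * (inj_count ?K G * n ^ (m - (l + 1))))"
        unfolding of_nat_le_iff C_def \<Phi>_def n_def by (rule card_pullback_containing_clique[OF G(1)])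
      also have "\<dots> = real m ^ (l + 1) * (real (inj_count ?K G) * real n ^ (m - (l + 1)))" by simp
      also have "\<dots> \<le> real m ^ (l + 1) * ((\<beta> * real n ^ (l + 1)) * real n ^ (m - (l + 1)))"
        using N2[OF G(1) _ G(3)] n by (intro mult_left_mono mult_right_mono) (auto simp: n_def)
      also have "\<dots> = real m ^ (l + 1) * (\<beta> * (real n ^ (l + 1) * real n ^ (m - (l + 1))))" by simp
      also have "real n ^ (l + 1) * real n ^ (m - (l + 1)) = T"
        unfolding T_def power_add[symmetric] using m(4) by simp
      also have "real m ^ (l + 1) * (\<beta> * T) = \<eta> * T / real m ^ v"
        using m0 by (simp add: \<beta>_def power_add field_simps)
      finally show ?thesis .
    qed
    have "\<eta> * T / real m ^ v \<le> \<eta> * T"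
    proof -
      have "1 \<le> real m ^ v" using m0 by (intro one_le_power) simp
      then have "\<eta> * T * 1 \<le> \<eta> * T * real m ^ v" using \<eta> T0 by (intro mult_left_mono) auto
      then show ?thesis using m0 by (simp add: divide_le_eq)
    qed
    with cC have cC': "real (card C) \<le> \<eta> * T" by linarith
    have cCm: "real m ^ v * real (card C) \<le> \<eta> * T"
      using cC m0 by (simp add: field_simps)
    have far_card: "card {\<phi> \<in> \<Phi>. far \<phi>} \<le> card B + card C"
    proof -
      have "{\<phi> \<in> \<Phi>. far \<phi>} \<subseteq> B \<union> C" by (auto simp: B_def C_def)
      then have "card {\<phi> \<in> \<Phi>. far \<phi>} \<le> card (B \<union> C)"
        using f\<Phi> by (intro card_mono) (auto simp: B_def C_def)
      then show ?thesis using card_Un_le[of B C] by linarith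
    qed
    have cB: "real (card B) \<le> \<kappa> / 2 * T"
    proof (cases "B = {}")
      case True
      then show ?thesis using \<kappa> T0 by simp
    next
      case False
      \<comment> \<open>A positive integer is at least 1. This lets the additive terms \<eta> T be
        replaced by \<eta> T * I, after which \<open>I\<close> cancels.\<close>
      then have I1: "1 \<le> real I" using Xbad(2) by force
      have J: "real (m - v) ^ v \<le> real J" "real J \<le> real m ^ v"
        using card_inj_maps[OF fP, of m] vm
        unfolding J_def v_def of_nat_power[symmetric] of_nat_le_iff by simp_all
      have "(1 - \<eta>) * T * real I - \<eta> * T \<le> real J * real (inj_count P G) * real n ^ (m - v)"
      proof -
        have "(1 - \<eta>) * real n ^ v \<le> real J * real (n div m) ^ v"
          using blowup_loss[OF m0 m(3) n(1) m\<eta> n\<eta>] J(1)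
          by (meson mult_right_mono order_trans zero_le_power of_nat_0_le_iff)
        then have "((1 - \<eta>) * real n ^ v) * (real n ^ (m - v) * real I)
            \<le> (real J * real (n div m) ^ v) * (real n ^ (m - v) * real I)"
          by (intro mult_right_mono) auto
        moreover have "((1 - \<eta>) * real n ^ v) * (real n ^ (m - v) * real I) = (1 - \<eta>) * T * real I"
          by (simp add: T_split[symmetric])
        moreover have "real J * (\<delta> * real n ^ v) * real n ^ (m - v) \<le> \<eta> * T"
        proof -
          have "real J * (\<delta> * real n ^ v) * real n ^ (m - v) = real J * (\<delta> * T)"
            by (simp add: T_split[symmetric])
          also have "\<dots> \<le> real m ^ v * (\<delta> * T)" using J \<delta> T0 by (intro mult_right_mono) auto
          also have "\<dots> = \<eta> * T" using m0 by (simp add: \<delta>_def)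
          finally show ?thesis .
        qed
        moreover have "real J * (real I * real (n div m) ^ v - \<delta> * real n ^ v) * real n ^ (m - v)
           \<le> real J * real (inj_count P G) * real n ^ (m - v)"
        proof (intro mult_right_mono mult_left_mono)
          have "I * (n div m) ^ v \<le> inj_max 2 n P {?K}"
            unfolding I_def v_def by (rule inj_max_blowup[OF P m0]) (use l in simp)
          then have "real I * real (n div m) ^ v \<le> real (inj_max 2 n P {?K})"
            by (metis of_nat_le_iff of_nat_mult of_nat_power)
          then show "real I * real (n div m) ^ v - \<delta> * real n ^ v \<le> real (inj_count P G)"
            using near by (simp add: n_def v_def)
        qed auto
        ultimately show ?thesis by (simp add: algebra_simps)
      qed
      also have "\<dots> \<le> (\<Sum>\<phi>\<in>\<Phi>. real (X \<phi>))"
        using sum_inj_count_pullback[OF P fG, of m]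
        unfolding J_def \<Phi>_def X_def n_def v_def of_nat_sum[symmetric] of_nat_mult[symmetric]
          of_nat_power[symmetric] of_nat_le_iff .
      \<comment> \<open>\<open>B\<close> consists of the far samples without the clique, which lose
        \<delta>0 I; those in \<open>C\<close> contain it and are bounded only by m ^ v.\<close>
      also have "\<dots> \<le> (\<Sum>\<phi>\<in>\<Phi>. real I - (if \<phi> \<in> B then \<delta>0 * real I else 0) + (if \<phi> \<in> C then real m ^
        v else 0))"
      proof (rule sum_mono)
        fix \<phi> assume \<phi>: "\<phi> \<in> \<Phi>"
        consider "\<phi> \<in> C" | "\<phi> \<in> B" "\<phi> \<notin> C" | "\<phi> \<notin> B" "\<phi> \<notin> C" by blast
        then show "real (X \<phi>) \<le> real I - (if \<phi> \<in> B then \<delta>0 * real I else 0) + (if \<phi> \<in> C then real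
          m ^ v else 0)"
        proof cases
          case 1
          then have nB: "\<phi> \<notin> B" by (auto simp: B_def C_def)
          have "real (X \<phi>) \<le> real m ^ v" using Xm by (metis of_nat_le_iff of_nat_power)
          then have "real (X \<phi>) \<le> real I + real m ^ v" by linarith
          then show ?thesis using 1 nB by simp
        next
          case 2
          then show ?thesis using Xbad(1)[of \<phi>] by (simp add: algebra_simps)
        next
          case 3
          then show ?thesis using XI[of \<phi>] \<phi> by (simp add: C_def)
        qed
      qed
      also have "\<dots> = T * real I - real (card B) * (\<delta>0 * real I) + real (card C) * real m ^ v"
      proof -
        have "(\<Sum>\<phi>\<in>\<Phi>. if \<phi> \<in> B then \<delta>0 * real I else 0) = real (card B) * (\<delta>0 * real I)"
          using f\<Phi> by (simp add: B_def flip: sum.inter_filter)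
        moreover have "(\<Sum>\<phi>\<in>\<Phi>. if \<phi> \<in> C then real m ^ v else 0) = real (card C) * real m ^ v"
          using f\<Phi> by (simp add: C_def flip: sum.inter_filter)
        ultimately show ?thesis by (simp add: sum.distrib sum_subtractf c\<Phi>)
      qed
      finally have "real (card B) * \<delta>0 * real I \<le> \<eta> * T * real I + 2 * (\<eta> * T)"
        using cCm by (simp add: algebra_simps)
      also have "\<dots> \<le> \<eta> * T * real I + 2 * (\<eta> * T) * real I"
        using I1 \<eta> T0 by (simp add: mult_le_cancel_left1)
      finally have "(real (card B) * \<delta>0) * real I \<le> (3 * \<eta> * T) * real I"
        by (simp add: algebra_simps)
      then have "real (card B) * \<delta>0 \<le> 3 * \<eta> * T" using I1 by (simp add: mult_le_cancel_right)
      also have "\<dots> \<le> 3 * (\<delta>0 * \<kappa> / 8) * T" using \<eta> T0 by (intro mult_right_mono mult_left_mono) auto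
      also have "\<dots> = (3 / 8 * \<kappa> * T) * \<delta>0" by simp
      finally have "real (card B) \<le> 3 / 8 * \<kappa> * T" using \<delta>0 by (simp add: mult_le_cancel_right)
      also have "\<dots> \<le> \<kappa> / 2 * T" using \<kappa> T0 by (intro mult_right_mono) auto
      finally show ?thesis .
    qed
    have "\<eta> * T \<le> \<kappa> / 2 * T" using \<eta> T0 by (intro mult_right_mono) auto
    then have "real (card B) + real (card C) \<le> \<kappa> * T" using cB cC' by (simp add: algebra_simps)
    then have "real (card {\<phi> \<in> \<Phi>. far \<phi>}) \<le> \<kappa> * T"
      using far_card by (metis of_nat_add of_nat_le_iff order_trans)
    then show "real (card {\<phi> \<in> {..<m} \<rightarrow>\<^sub>E verts G. \<not> (deletion_close 2 \<epsilon> (colorable_family 2 l)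
      (pullback m \<phi> G))}) \<le> \<kappa> * real (vcard G) ^ m"
      unfolding \<Phi>_def far_def T_def n_def .
  qed
qed

text \<open>If \<open>G\<close> were far, a fraction \<open>c\<close> of its \<open>k\<close>-tuples
  would be uncolorable, and a random \<open>k\<close>-tuple can be drawn by first taking a sample of
  size \<open>m\<close> and then \<open>k\<close> distinct positions in it. Far samples contribute
  at most c / 2 by \<open>few_far_samples\<close>, close ones at most c / 8 by
  \<open>few_uncolorable_if_close\<close>, which is too little.\<close>

lemma close_to_colorable:
  fixes P :: "'a hypergraph" and F :: "'b hypergraph" and \<epsilon> :: real
  assumes P: "r_graph 2 P" and l: "1 \<le> l" and F: "r_graph 2 F" "chromatic_number F \<le> l + 1"
    and stable: "edge_stable 2 P {clique (l + 1)} (colorable_family 2 l)"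
    and \<epsilon>: "0 < \<epsilon>"
  shows "\<exists>\<delta>>0. \<exists>N0. \<forall>G :: nat hypergraph. r_graph 2 G \<longrightarrow> N0 \<le> vcard G \<longrightarrow> free_of {F} G \<longrightarrow>
      near_max_additive l P \<delta> G \<longrightarrow>
      (deletion_close 2 \<epsilon> (colorable_family 2 l) G)"
proof -
  \<comment> \<open>Twice \<alpha> must not exceed \<epsilon>, since
    \<open>many_uncolorable_lists\<close> assumes more than 2 \<alpha> n ^ 2 bad edges for every
    coloring.\<close>
  define \<alpha> where "\<alpha> = min (\<epsilon> / 2) 1"
  have \<alpha>: "0 < \<alpha>" "\<alpha> \<le> 1" "2 * \<alpha> \<le> \<epsilon>" using \<epsilon> by (auto simp: \<alpha>_def)
  \<comment> \<open>Initially every list has size \<open>l\<close>, so \<open>d\<close> only has to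
    exceed l / \<alpha>; adding 2 also ensures that a tester has at least two entries.\<close>
  define d where "d = nat \<lceil>real l / \<alpha>\<rceil> + 2"
  define k where "k = tester_size l d"
  have k2: "2 \<le> k"
  proof -
    obtain d' where "d = Suc (Suc d')" unfolding d_def by simp
    then show ?thesis using l by (simp add: k_def)
  qed
  define c where "c = \<alpha> ^ k"
  have c: "0 < c" using \<alpha> by (simp add: c_def)
  \<comment> \<open>Then 4 k ^ 2 \<epsilon>1 is c / 16, and a further factor 2 is lost because only
    half of the maps into the positions are known to be injective.\<close>
  define \<epsilon>1 where "\<epsilon>1 = c / (64 * real k ^ 2)"
  have \<epsilon>1: "0 < \<epsilon>1" using c k2 by (simp add: \<epsilon>1_def)
  \<comment> \<open>With m at least 2 k ^ 2, at least half of the maps from \<open>k\<close> points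
    to the sample positions are injective.\<close>
  obtain m \<delta> N1 where m: "2 * k ^ 2 \<le> m" and \<delta>: "0 < \<delta>" and
    N1: "\<And>G :: nat hypergraph. r_graph 2 G \<Longrightarrow> N1 \<le> vcard G \<Longrightarrow> free_of {F} G \<Longrightarrow>
      near_max_additive l P \<delta> G \<Longrightarrow>
      real (card {\<phi> \<in> {..<m} \<rightarrow>\<^sub>E verts G. \<not> (deletion_close 2 \<epsilon>1 (colorable_family 2 l) (pullback
        m \<phi> G))}) \<le> c / 2 * real (vcard G) ^ m"
    using few_far_samples[OF P l F stable \<epsilon>1 half_gt_zero[OF c], where M = "2 * k ^ 2"] by blast
  have km: "k \<le> m" using m k2 by (metis le_trans le_square mult_2 le_add1 power2_eq_square)
  have m0: "0 < m" using km k2 by simp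
  show ?thesis
  proof (intro exI[of _ \<delta>] conjI exI[of _ "max 1 N1"] allI impI \<delta>)
    fix G :: "nat hypergraph"
    assume G: "r_graph 2 G" "max 1 N1 \<le> vcard G" "free_of {F} G"
      and near: "near_max_additive l P \<delta> G"
    define n where "n = vcard G"
    have n: "0 < n" using G(2) by (simp add: n_def)
    note fG = finite_verts[OF G(1)]
    show "deletion_close 2 \<epsilon> (colorable_family 2 l) G"
    proof (rule ccontr)
      assume neg: "\<not> ?thesis"
      have far: "2 * \<alpha> * real (vcard G) ^ 2 < real (card {e \<in> edges G. \<not> inj_on c e})"
        if c: "\<forall>v\<in>verts G. c v \<in> {1..l}" for c
      proof (rule ccontr)
        assume "\<not> ?thesis"
        then have "real (card {e \<in> edges G. \<not> inj_on c e}) \<le> 2 * \<alpha> * real (vcard G) ^ 2" by simp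
        also have "\<dots> \<le> \<epsilon> * real (vcard G) ^ 2" using \<alpha> by (intro mult_right_mono) auto
        finally have "real (card {e \<in> edges G. \<not> inj_on c e}) \<le> \<epsilon> * real (vcard G) ^ 2" .
        moreover have "proper_coloring l (verts G, edges G - {e \<in> edges G. \<not> inj_on c e}) c"
          using c by (auto simp: proper_coloring_def)
        moreover have "r_graph 2 (verts G, edges G - {e \<in> edges G. \<not> inj_on c e})"
          using G(1) by (rule r_graph_subset) auto
        ultimately show False using neg by (metis (no_types, lifting) colorable_family_iff
          mem_Collect_eq subsetI)
      qed
      define X where "X = {xs. set xs \<subseteq> verts G \<and> length xs = k
        \<and> \<not> multi_colorable (edges G) (\<lambda>_. {1..l}) (set xs)}"
      have Xsub: "X \<subseteq> {xs. set xs \<subseteq> verts G \<and> length xs = k}" by (auto simp: X_def)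
      have "(\<alpha> * real (vcard G)) ^ tester_size (card {1..l}) d \<le> real (card {xs. set xs \<subseteq> verts G \<and>
          length xs = tester_size (card {1..l}) d \<and> \<not> multi_colorable (edges G) (\<lambda>_. {1..l}) (set
            xs)})"
      proof (rule many_uncolorable_lists[OF fG _ _ _ \<alpha>(1,2) far])
        show "\<And>e. e \<in> edges G \<Longrightarrow> e \<subseteq> verts G \<and> card e = 2" using G(1) by (auto simp: r_graph_def)
        have "real l / \<alpha> < real d" unfolding d_def by linarith
        then have "real l < real d * \<alpha>" using \<alpha> by (simp add: field_simps)
        then have "real n * real l < real n * (real d * \<alpha>)" using n by simp
        then show "(\<Sum>v\<in>verts G. real (card {1..l})) < real d * (\<alpha> * real (vcard G))"
          by (simp add: n_def mult_ac)
      qed (use l in auto)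
      then have cX: "c * real n ^ k \<le> real (card X)"
        by (simp add: X_def k_def c_def n_def power_mult_distrib)
      define \<Phi> where "\<Phi> = {..<m} \<rightarrow>\<^sub>E verts G"
      define T where "T = real n ^ m"
      have T: "0 < T" using n by (simp add: T_def)
      have f\<Phi>: "finite \<Phi>" unfolding \<Phi>_def using fG by (intro finite_PiE) auto
      have c\<Phi>: "real (card \<Phi>) = T" using fG by (simp add: \<Phi>_def T_def n_def card_PiE)
      define J where "J = card {\<iota> \<in> {..<k} \<rightarrow>\<^sub>E {..<m}. inj_on \<iota> {..<k}}"
      define Y where "Y \<phi> = card {\<iota> \<in> {..<k} \<rightarrow>\<^sub>E {..<m}. inj_on \<iota> {..<k}
        \<and> map (\<phi> \<circ> \<iota>) [0..<k] \<in> X}" for \<phi>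
      define far where "far \<phi> \<longleftrightarrow> \<not> (deletion_close 2 \<epsilon>1 (colorable_family 2 l) (pullback m \<phi> G))"
        for \<phi>
      have cfar: "real (card {\<phi> \<in> \<Phi>. far \<phi>}) \<le> c / 2 * T"
        using N1[OF G(1) _ G(3) near] G(2) by (simp add: \<Phi>_def T_def far_def n_def)
      have J: "real m ^ k / 2 \<le> real J"
      proof -
        have "(1 - real k / real m) ^ k \<ge> 1 - real k * (real k / real m)"
          using Bernoulli_inequality[of "- (real k / real m)" k] km m0 by simp
        moreover have "real k * (real k / real m) \<le> 1 / 2"
        proof -
          have "2 * (real k * real k) \<le> real m" using m by (metis of_nat_le_iff of_nat_mult
            of_nat_numeral power2_eq_square)
          then show ?thesis using m0 by (simp add: field_simps)
        qed
        ultimately have "1 / 2 \<le> (1 - real k / real m) ^ k" by linarith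
        then have "real m ^ k * (1 / 2) \<le> real m ^ k * (1 - real k / real m) ^ k"
          by (intro mult_left_mono) auto
        also have "\<dots> = (real m * (1 - real k / real m)) ^ k" by (simp add: power_mult_distrib)
        also have "real m * (1 - real k / real m) = real (m - k)" using m0 km
          by (simp add: field_simps)
        also have "real (m - k) ^ k \<le> real J"
          using card_inj_maps(1)[of "{..<k}" m] km unfolding J_def of_nat_power[symmetric]
            of_nat_le_iff by simp
        finally show ?thesis by simp
      qed
      have J0: "0 < real J" using J m0 by (meson half_gt_zero less_le_trans of_nat_0_less_iff
        zero_less_power)
      have YJ: "Y \<phi> \<le> J" for \<phi>
        unfolding Y_def J_def
        by (rule card_mono[OF finite_filter_PiE]) auto
      have Ynear: "real (Y \<phi>) \<le> c / 8 * real J" if \<phi>: "\<phi> \<in> \<Phi>" "\<not> far \<phi>" for \<phi>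
      proof -
        obtain D where D: "D \<subseteq> edges (pullback m \<phi> G)" "real (card D) \<le> \<epsilon>1 * real m ^ 2"
          "({..<m}, edges (pullback m \<phi> G) - D) \<in> colorable_family 2 l" using \<phi>(2)
            by (auto simp: far_def)
        have "Y \<phi> \<le> card {\<iota> \<in> {..<k} \<rightarrow>\<^sub>E {..<m}. inj_on \<iota> {..<k} \<and>
          \<not> multi_colorable (edges G) (\<lambda>_. {1..l}) (set (map (\<phi> \<circ> \<iota>) [0..<k]))}"
          unfolding Y_def X_def
          by (rule card_mono[OF finite_filter_PiE]) auto
        also have "\<dots> \<le> 4 * k\<^sup>2 * card D * m ^ (k - 2)"
          by (rule few_uncolorable_if_close[OF D(1) G(1) D(3)])
        finally have "real (Y \<phi>) \<le> real (4 * k\<^sup>2 * card D * m ^ (k - 2))" by (rule of_nat_mono)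
        also have "\<dots> = 4 * real k ^ 2 * real (card D) * real m ^ (k - 2)" by simp
        also have "\<dots> \<le> 4 * real k ^ 2 * (\<epsilon>1 * real m ^ 2) * real m ^ (k - 2)"
          using D by (intro mult_right_mono mult_left_mono) auto
        also have "\<dots> = 4 * real k ^ 2 * \<epsilon>1 * (real m ^ 2 * real m ^ (k - 2))" by simp
        also have "real m ^ 2 * real m ^ (k - 2) = real m ^ k"
          using k2 by (metis le_add_diff_inverse power_add)
        also have "4 * real k ^ 2 * \<epsilon>1 = c / 16" using k2 by (simp add: \<epsilon>1_def)
        also have "c / 16 * real m ^ k = c / 8 * (real m ^ k / 2)" by simp
        also have "\<dots> \<le> c / 8 * real J" using J c by (intro mult_left_mono) auto
        finally show ?thesis .
      qed
      have "real J * (c * T) \<le> real J * (real (card X) * real n ^ (m - k))"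
      proof (intro mult_left_mono)
        have "c * T = c * real n ^ k * real n ^ (m - k)"
          unfolding T_def using km by (simp flip: power_add)
        also have "\<dots> \<le> real (card X) * real n ^ (m - k)" using cX by (intro mult_right_mono) auto
        finally show "c * T \<le> real (card X) * real n ^ (m - k)" .
      qed auto
      also have "\<dots> = (\<Sum>\<phi>\<in>\<Phi>. real (Y \<phi>))"
        using sum_pullback_lists[OF fG Xsub, of m]
        unfolding J_def Y_def \<Phi>_def n_def of_nat_sum[symmetric] of_nat_mult[symmetric]
          of_nat_power[symmetric] of_nat_eq_iff .
      also have "\<dots> \<le> (\<Sum>\<phi>\<in>\<Phi>. (if far \<phi> then real J else 0) + c / 8 * real J)"
      proof (rule sum_mono)
        fix \<phi> assume "\<phi> \<in> \<Phi>"
        then show "real (Y \<phi>) \<le> (if far \<phi> then real J else 0) + c / 8 * real J"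
          using YJ[of \<phi>] Ynear[of \<phi>] c by (simp add: add_increasing2)
      qed
      also have "\<dots> = real (card {\<phi> \<in> \<Phi>. far \<phi>}) * real J + T * (c / 8 * real J)"
        using f\<Phi> by (simp add: sum.distrib c\<Phi> flip: sum.inter_filter)
      also have "\<dots> \<le> c / 2 * T * real J + T * (c / 8 * real J)"
        using cfar by (intro add_right_mono mult_right_mono) auto
      also have "\<dots> = 5 / 8 * (real J * (c * T))" by (simp add: algebra_simps)
      finally show False using J0 c T by (simp add: mult_le_cancel_right2 zero_less_mult_iff)
    qed
  qed
qed

section \<open>From expansions to graphs\<close>

text \<open>In greedy embeddings \<open>S\<close> is the set of vertices already occupied: a robust
  pair can be completed to an edge whatever the earlier choices were.\<close>

definition robust_pair :: "'a hypergraph \<Rightarrow> nat \<Rightarrow> 'a set \<Rightarrow> bool" where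
  "robust_pair H M p \<longleftrightarrow> (\<forall>S. finite S \<longrightarrow> card S \<le> M \<longrightarrow> S \<inter> p = {} \<longrightarrow>
     (\<exists>e\<in>edges H. p \<subseteq> e \<and> e \<inter> S = {}))"

text \<open>Such an edge contains a pair \<open>p\<close> together with a vertex of the small set
  \<open>S p\<close> that meets all edges over \<open>p\<close>. There are at most n ^ 2 pairs,
  \<open>M\<close> choices of the vertex, and n ^ (r - 3) edges over the resulting triple.\<close>

lemma card_fragile_edges:
  assumes H: "r_graph r H"
  shows "card {e \<in> edges H. \<exists>p\<subseteq>e. card p = 2 \<and> \<not> robust_pair H M p} \<le> M * vcard H ^ (r - 1)"
proof -
  let ?V = "verts H" and ?n = "vcard H"
  let ?L = "{e \<in> edges H. \<exists>p\<subseteq>e. card p = 2 \<and> \<not> robust_pair H M p}"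
  let ?P = "{p. p \<subseteq> ?V \<and> card p = 2}"
  let ?A = "\<lambda>q. {e. e \<subseteq> ?V \<and> card e = r \<and> q \<subseteq> e}"
  have fV: "finite ?V" using H by (simp add: r_graph_def)
  have fP: "finite ?P" using fV by simp
  have fA: "finite (?A q)" for q using fV by simp
  define S where "S p = (SOME S. finite S \<and> card S \<le> M \<and> S \<inter> p = {} \<and>
      (\<forall>e\<in>edges H. p \<subseteq> e \<longrightarrow> e \<inter> S \<noteq> {}))" for p
  have S: "finite (S p) \<and> card (S p) \<le> M \<and> S p \<inter> p = {} \<and> (\<forall>e\<in>edges H. p \<subseteq> e \<longrightarrow> e \<inter> S p \<noteq> {})"
    if "\<not> robust_pair H M p" for p
  proof -
    have "\<exists>S. finite S \<and> card S \<le> M \<and> S \<inter> p = {} \<and> (\<forall>e\<in>edges H. p \<subseteq> e \<longrightarrow> e \<inter> S \<noteq> {})"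
    proof -
      from that obtain S where "\<not> (finite S \<longrightarrow> card S \<le> M \<longrightarrow> S \<inter> p = {} \<longrightarrow>
          (\<exists>e\<in>edges H. p \<subseteq> e \<and> e \<inter> S = {}))"
        unfolding robust_pair_def not_all by (elim exE)
      then show ?thesis by (intro exI[of _ S]) simp
    qed
    from someI_ex[OF this] show ?thesis unfolding S_def .
  qed
  let ?S = "\<lambda>p. if robust_pair H M p then {} else S p \<inter> ?V"
  have S3: "card (insert x p) = 3" if "p \<in> ?P" "x \<in> ?S p" for p x
  proof -
    have "\<not> robust_pair H M p \<and> x \<in> S p" using that(2) by (cases "robust_pair H M p") simp_all
    then have "x \<notin> p" using S[of p] by blast
    moreover have "finite p" using that fV finite_subset by blast
    ultimately show ?thesis using that by simp
  qed
  have wit: "\<exists>p\<in>?P. \<exists>x\<in>?S p. e \<in> ?A (insert x p)" if eL: "e \<in> ?L" for e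
  proof -
    obtain p where e: "e \<in> edges H" and p: "p \<subseteq> e" "card p = 2" "\<not> robust_pair H M p" using eL
      by blast
    then obtain x where x: "x \<in> e" "x \<in> S p" using S[OF p(3)] by blast
    have eV: "e \<subseteq> ?V" "card e = r" using H e by (auto simp: r_graph_def)
    show ?thesis
    proof (rule bexI[of _ p], rule bexI[of _ x])
      show "e \<in> ?A (insert x p)" using eV p(1) x(1) by simp
      show "x \<in> ?S p" using eV p(3) x by auto
      show "p \<in> ?P" using eV p by auto
    qed
  qed
  show ?thesis
  proof (cases "?L = {}")
    case True
    then show ?thesis by (metis card.empty le0)
  next
    case False
    then obtain e where "e \<in> ?L" by blast
    from wit[OF this] obtain p x where *: "p \<in> ?P" "x \<in> ?S p" "e \<in> ?A (insert x p)" by blast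
    then have "finite e" using fV finite_subset by blast
    then have "card (insert x p) \<le> card e" using * by (intro card_mono) auto
    \<comment> \<open>For r = 2 the set is empty: an edge equals its only pair, and a set disjoint
      from the pair cannot meet it. So the exponent r - 3 below is not truncated.\<close>
    then have r3: "3 \<le> r" using * S3[OF *(1,2)] by simp
    have "?L \<subseteq> (\<Union>p\<in>?P. \<Union>x\<in>?S p. ?A (insert x p))"
    proof
      fix e assume "e \<in> ?L"
      from wit[OF this] show "e \<in> (\<Union>p\<in>?P. \<Union>x\<in>?S p. ?A (insert x p))" by blast
    qed
    then have "card ?L \<le> card (\<Union>p\<in>?P. \<Union>x\<in>?S p. ?A (insert x p))"
      using fP fV fA by (intro card_mono) auto
    also have "\<dots> \<le> (\<Sum>p\<in>?P. card (\<Union>x\<in>?S p. ?A (insert x p)))" by (rule card_UN_le[OF fP])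
    also have "\<dots> \<le> (\<Sum>p\<in>?P. M * ?n ^ (r - 3))"
    proof (rule sum_mono)
      fix p assume p: "p \<in> ?P"
      have fS: "finite (?S p)" using fV by simp
      have cS: "card (?S p) \<le> M"
      proof (cases "robust_pair H M p")
        case False
        then have "finite (S p)" "card (S p) \<le> M" using S by blast+
        then show ?thesis using False card_mono[of "S p" "S p \<inter> ?V"] by simp
      qed simp
      have "card (\<Union>x\<in>?S p. ?A (insert x p)) \<le> (\<Sum>x\<in>?S p. card (?A (insert x p)))"
        by (rule card_UN_le[OF fS])
      also have "\<dots> \<le> (\<Sum>x\<in>?S p. ?n ^ (r - 3))"
      proof (rule sum_mono)
        fix x assume x: "x \<in> ?S p"
        then have "x \<in> ?V" by (cases "robust_pair H M p") simp_all
        then have "insert x p \<subseteq> ?V" using p by simp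
        then show "card (?A (insert x p)) \<le> ?n ^ (r - 3)"
          using card_supersets_le[OF fV, of "insert x p" r] S3[OF p x] r3 by simp
      qed
      also have "\<dots> \<le> M * ?n ^ (r - 3)" using cS by simp
      finally show "card (\<Union>x\<in>?S p. ?A (insert x p)) \<le> M * ?n ^ (r - 3)" .
    qed
    also have "\<dots> = (?n choose 2) * (M * ?n ^ (r - 3))" using n_subsets[OF fV, of 2] by simp
    also have "\<dots> \<le> ?n ^ 2 * (M * ?n ^ (r - 3))"
      by (intro mult_right_mono) (cases "2 \<le> ?n"; auto simp: binomial_le_pow binomial_eq_0)+
    also have "\<dots> = M * (?n ^ 2 * ?n ^ (r - 3))" by simp
    also have "?n ^ 2 * ?n ^ (r - 3) = ?n ^ (r - 1)"
    proof -
      have "2 + (r - 3) = r - 1" using r3 by simp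
      then show ?thesis by (metis power_add)
    qed
    finally show ?thesis .
  qed
qed

text \<open>Extend the pairs one after another. Robustness always yields an edge that avoids the
  images of the other vertices and all previously added vertices, as together these number at most
  \<open>M\<close>.\<close>

lemma disjoint_extensions:
  assumes H: "r_graph r H" and f: "\<And>e. e \<in> E \<Longrightarrow> e \<subseteq> V" and V: "finite V"
    and rob: "\<And>e. e \<in> E \<Longrightarrow> robust_pair H M (f ` e)" and E: "finite E"
    and M: "card V + card E * r \<le> M"
  shows "\<exists>h. \<forall>e\<in>E. h e \<in> edges H \<and> f ` e \<subseteq> h e \<and> (h e - f ` e) \<inter> f ` V = {} \<and>
    (\<forall>e'\<in>E. e \<noteq> e' \<longrightarrow> (h e - f ` e) \<inter> (h e' - f ` e') = {})"
  using E f rob M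
proof (induction E rule: finite_induct)
  case empty
  then show ?case by simp
next
  case (insert a E)
  have "\<exists>h. \<forall>e\<in>E. h e \<in> edges H \<and> f ` e \<subseteq> h e \<and> (h e - f ` e) \<inter> f ` V = {} \<and>
    (\<forall>e'\<in>E. e \<noteq> e' \<longrightarrow> (h e - f ` e) \<inter> (h e' - f ` e') = {})"
    by (rule insert.IH) (use insert.prems insert.hyps in auto)
  then obtain h where "\<forall>e\<in>E. h e \<in> edges H \<and> f ` e \<subseteq> h e \<and> (h e - f ` e) \<inter> f ` V = {} \<and>
    (\<forall>e'\<in>E. e \<noteq> e' \<longrightarrow> (h e - f ` e) \<inter> (h e' - f ` e') = {})" by (elim exE)
  note h = bspec[OF this]
  \<comment> \<open>The ends of \<open>a\<close> are left out of the first set, since the new edge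
    has to contain them; the second set is disjoint from them by the invariant on earlier
    extensions.\<close>
  let ?S = "(f ` V - f ` a) \<union> (\<Union>e\<in>E. h e - f ` e)"
  have fh: "finite (h e)" "card (h e) = r" if "e \<in> E" for e
    using h[OF that] H by (auto simp: r_graph_def intro: finite_subset)
  have finS: "finite ?S" using V insert.hyps fh by auto
  have "card ?S \<le> card (f ` V - f ` a) + card (\<Union>e\<in>E. h e - f ` e)" by (rule card_Un_le)
  also have "card (f ` V - f ` a) \<le> card V"
    using V card_image_le[OF V, of f] card_mono[of "f ` V" "f ` V - f ` a"] by simp
  also have "card (\<Union>e\<in>E. h e - f ` e) \<le> (\<Sum>e\<in>E. card (h e - f ` e))"
    using insert.hyps by (intro card_UN_le) auto
  also have "\<dots> \<le> (\<Sum>e\<in>E. r)"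
  proof (rule sum_mono)
    fix e assume "e \<in> E"
    then show "card (h e - f ` e) \<le> r" using card_mono[of "h e" "h e - f ` e"] fh[of e] by simp
  qed
  finally have "card ?S \<le> card V + card E * r" by simp
  also have "\<dots> \<le> M" using insert by simp
  finally have cS: "card ?S \<le> M" .
  have aV: "f ` a \<subseteq> f ` V" using insert.prems(1)[of a] by auto
  have "x \<notin> f ` a" if x: "x \<in> ?S" for x
  proof
    assume xa: "x \<in> f ` a"
    then obtain e where e: "e \<in> E" "x \<in> h e - f ` e" using x by blast
    have "(h e - f ` e) \<inter> f ` V = {}" using h[OF e(1)] by blast
    then show False using e(2) xa aV by blast
  qed
  then have Sa: "?S \<inter> f ` a = {}" by blast
  have "robust_pair H M (f ` a)" using insert.prems(2) by simp
  from this[unfolded robust_pair_def, rule_format, OF finS cS Sa]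
  obtain d where d: "d \<in> edges H" "f ` a \<subseteq> d" "d \<inter> ?S = {}" by blast
  define h' where "h' = h(a := d)"
  have h'a: "h' a = d" by (simp add: h'_def)
  have h'e: "h' e = h e" if "e \<in> E" for e using that insert.hyps by (auto simp: h'_def)
  have dV: "(d - f ` a) \<inter> f ` V = {}" using d by blast
  have dE: "(d - f ` a) \<inter> (h e - f ` e) = {}" if "e \<in> E" for e using d that by blast
  show ?case
  proof (rule exI[of _ h'], intro ballI conjI impI)
    fix e assume e: "e \<in> insert a E"
    show "h' e \<in> edges H" using e d h h'a h'e by (cases "e = a") auto
    show "f ` e \<subseteq> h' e" using e d h h'a h'e by (cases "e = a") auto
    show "(h' e - f ` e) \<inter> f ` V = {}" using e dV h h'a h'e by (cases "e = a") auto
    fix e' assume e': "e' \<in> insert a E" and ne: "e \<noteq> e'"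
    show "(h' e - f ` e) \<inter> (h' e' - f ` e') = {}"
    proof (cases "e = a")
      case True
      then show ?thesis using e' ne dE[of e'] h'a h'e by auto
    next
      case False
      then have eE: "e \<in> E" using e by simp
      show ?thesis
      proof (cases "e' = a")
        case True
        then show ?thesis using dE[OF eE] h'a h'e[OF eE] by (simp add: Int_commute)
      next
        case False
        then show ?thesis using h[OF eE] e' ne h'e eE by auto
      qed
    qed
  qed
qed

text \<open>The disjoint extensions supply exactly r - 2 private vertices for each edge of
  \<open>F\<close>; numbering them gives the images of the added vertices of the expansion.\<close>

lemma expansion_embeds:
  assumes F: "r_graph 2 F" and H: "r_graph r H"
    and f: "inj_on f (verts F)" "f ` verts F \<subseteq> verts H"
    and rob: "\<And>e. e \<in> edges F \<Longrightarrow> robust_pair H (vcard F + card (edges F) * r) (f ` e)"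
  shows "\<exists>g. inj_on g (verts (expansion r F)) \<and> homomorphism g (expansion r F) H"
proof -
  note fF = finite_verts[OF F]
  have eF: "e \<subseteq> verts F" "card e = 2" if "e \<in> edges F" for e using F that
    by (auto simp: r_graph_def)
  have "\<exists>h. \<forall>e\<in>edges F. h e \<in> edges H \<and> f ` e \<subseteq> h e \<and> (h e - f ` e) \<inter> f ` verts F = {} \<and>
    (\<forall>e'\<in>edges F. e \<noteq> e' \<longrightarrow> (h e - f ` e) \<inter> (h e' - f ` e') = {})"
    by (rule disjoint_extensions[OF H eF(1) fF rob finite_edges[OF F] order_refl])
  then obtain h where "\<forall>e\<in>edges F. h e \<in> edges H \<and> f ` e \<subseteq> h e \<and> (h e - f ` e) \<inter> f ` verts F = {} \<and>
    (\<forall>e'\<in>edges F. e \<noteq> e' \<longrightarrow> (h e - f ` e) \<inter> (h e' - f ` e') = {})" by (elim exE)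
  note h = bspec[OF this]
  have hH: "finite (h e)" "card (h e) = r" "h e \<subseteq> verts H" if "e \<in> edges F" for e
    using h[OF that] H by (auto simp: r_graph_def intro: finite_subset)
  have "\<exists>b. bij_betw b {..<r - 2} (h e - f ` e)" if e: "e \<in> edges F" for e
  proof (rule finite_same_card_bij)
    have "finite (f ` e)" using eF[OF e] fF finite_subset by blast
    then show "card {..<r - 2} = card (h e - f ` e)"
      using hH[OF e] h[OF e] eF[OF e] f(1) by (simp add: card_Diff_subset card_image inj_on_subset)
  qed (use hH[OF e] in auto)
  then obtain b where b: "\<And>e. e \<in> edges F \<Longrightarrow> bij_betw (b e) {..<r - 2} (h e - f ` e)" by metis
  have bim: "b e i \<in> h e - f ` e" if "e \<in> edges F" "i < r - 2" for e i
    using bij_betwE[OF b[OF that(1)]] that(2) by simp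
  define g where "g x = (case x of Inl v \<Rightarrow> f v | Inr (e, i) \<Rightarrow> b e i)" for x
  have gl: "g (Inl v) = f v" and gr: "g (Inr (e, i)) = b e i" for v e i by (simp_all add: g_def)
  have sep: "f v \<noteq> b e i" if "v \<in> verts F" "e \<in> edges F" "i < r - 2" for v e i
  proof -
    have "b e i \<notin> f ` verts F"
      using bim[OF that(2,3)] h[OF that(2), THEN conjunct2, THEN conjunct2, THEN conjunct1] by blast
    then show ?thesis using that(1) by (metis imageI)
  qed
  have binj: "e = e' \<and> i = j" if eq: "b e i = b e' j" and e: "e \<in> edges F" "i < r - 2" "e' \<in> edges
    F" "j < r - 2" for e e' i j
  proof -
    have "e = e'"
    proof (rule ccontr)
      assume ne: "e \<noteq> e'"
      from h[OF e(1), THEN conjunct2, THEN conjunct2, THEN conjunct2, rule_format, OF e(3) ne]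
      show False using bim[OF e(1,2)] bim[OF e(3,4)] eq by auto
    qed
    moreover have "i = j" using b[OF e(1)] eq e calculation by (auto simp: bij_betw_def inj_on_def)
    ultimately show ?thesis by simp
  qed
  have "inj_on g (verts (expansion r F))"
    unfolding expansion_def fst_conv
  proof (rule inj_onI)
    fix x y assume x: "x \<in> Inl ` verts F \<union> Inr ` (edges F \<times> {..<r - 2})"
      and y: "y \<in> Inl ` verts F \<union> Inr ` (edges F \<times> {..<r - 2})" and eq: "g x = g y"
    show "x = y"
    proof (cases x)
      case (Inl v)
      then have v: "v \<in> verts F" using x by auto
      show ?thesis
      proof (cases y)
        case (Inl w)
        then show ?thesis using \<open>x = Inl v\<close> v y eq f(1) by (auto simp: gl inj_on_def)
      next
        case (Inr w)
        then show ?thesis using \<open>x = Inl v\<close> v y eq sep by (auto simp: gl gr)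
      qed
    next
      case (Inr u)
      then obtain e i where u: "x = Inr (e, i)" "e \<in> edges F" "i < r - 2" using x by auto
      show ?thesis
      proof (cases y)
        case (Inl w)
        then show ?thesis using u y eq sep[of w e i] by (auto simp: gl gr)
      next
        case (Inr w)
        then obtain e' j where w: "y = Inr (e', j)" "e' \<in> edges F" "j < r - 2" using y by auto
        then show ?thesis using binj[of e i e' j] u eq by (simp add: gr)
      qed
    qed
  qed
  moreover have "homomorphism g (expansion r F) H"
    unfolding homomorphism_def
  proof (intro conjI ballI)
    show "g ` verts (expansion r F) \<subseteq> verts H"
    proof (rule image_subsetI)
      fix x assume x: "x \<in> verts (expansion r F)"
      show "g x \<in> verts H"
      proof (cases x)
        case (Inl v)
        then have "v \<in> verts F" using x by (auto simp: expansion_def)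
        then show ?thesis using f(2) Inl by (auto simp: gl)
      next
        case (Inr u)
        then obtain e i where u: "x = Inr (e, i)" "e \<in> edges F" "i < r - 2"
          using x by (auto simp: expansion_def)
        then show ?thesis using bim[OF u(2,3)] hH(3)[OF u(2)] by (auto simp: gr)
      qed
    qed
    fix d assume "d \<in> edges (expansion r F)"
    then obtain e where e: "e \<in> edges F" "d = Inl ` e \<union> Inr ` ({e} \<times> {..<r - 2})"
      by (auto simp: expansion_def)
    have "g ` d = f ` e \<union> b e ` {..<r - 2}"
    proof -
      have "{e} \<times> {..<r - 2} = Pair e ` {..<r - 2}" by auto
      then show ?thesis unfolding e(2) by (simp add: image_Un image_image gl gr)
    qed
    also have "b e ` {..<r - 2} = h e - f ` e" using b[OF e(1)] by (simp add: bij_betw_def)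
    also have "f ` e \<union> (h e - f ` e) = h e" using h[OF e(1)] by blast
    finally show "g ` d \<in> edges H" using h[OF e(1)] by simp
  qed
  ultimately show ?thesis by blast
qed

text \<open>Robustness is tested in all of \<open>H\<close>, not in the smaller family
  \<open>E\<close>. Hence one round of deletion suffices: missing edges of \<open>H\<close> remain
  available when pairs are extended.\<close>

lemma shadow_free:
  assumes F: "r_graph 2 F" and H: "r_graph r H" and free: "free_of {expansion r F} H"
    and E: "E \<subseteq> {e \<in> edges H. \<forall>p\<subseteq>e. card p = 2 \<longrightarrow> robust_pair H (vcard F + card (edges F) * r) p}"
  shows "free_of {F} (pair_shadow (verts H, E))"
proof -
  have False if f: "inj_on f (verts F)" "homomorphism f F (pair_shadow (verts H, E))" for f
  proof -
    have "robust_pair H (vcard F + card (edges F) * r) (f ` e)" if "e \<in> edges F" for e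
    proof -
      have "f ` e \<in> edges (pair_shadow (verts H, E))" using f(2) that
        by (simp add: homomorphism_def)
      then show ?thesis using E by (auto simp: pair_shadow_def)
    qed
    moreover have "f ` verts F \<subseteq> verts H" using f(2) by (simp add: homomorphism_def)
    ultimately show False using expansion_embeds[OF F H f(1)] free by (auto simp: free_of_def)
  qed
  then show ?thesis by (auto simp: free_of_def)
qed

text \<open>Removing a proportion \<epsilon> of all possible edges destroys at most a constant times
  \<epsilon> n ^ v copies.\<close>

lemma inj_count_delete_real:
  fixes \<epsilon> :: real
  assumes Q: "r_graph r Q" and H: "r_graph r H" and D: "D \<subseteq> edges H"
    and cD: "real (card D) \<le> \<epsilon> * real (vcard H) ^ r"
  shows "real (inj_count Q H) \<le> real (inj_count Q (verts H, edges H - D)) +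
    real (card (edges Q) * r ^ r) * \<epsilon> * real (vcard H) ^ vcard Q"
proof -
  let ?n = "real (vcard H)"
  have "real (inj_count Q H) \<le> real (inj_count Q (verts H, edges H - D) +
    card (edges Q) * r ^ r * card D * vcard H ^ (vcard Q - r))"
    by (rule of_nat_mono[OF inj_count_delete[OF Q H D]])
  also have "\<dots> = real (inj_count Q (verts H, edges H - D)) +
    real (card (edges Q) * r ^ r) * (real (card D) * ?n ^ (vcard Q - r))" by simp
  also have "real (card (edges Q) * r ^ r) * (real (card D) * ?n ^ (vcard Q - r)) \<le>
    real (card (edges Q) * r ^ r) * (\<epsilon> * ?n ^ vcard Q)"
  \<comment> \<open>An edge is what guarantees that \<open>r\<close> is at most the number of
    vertices of \<open>Q\<close>; without one the constant in front is 0.\<close>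
  proof (cases "edges Q = {}")
    case False
    then have "r \<le> vcard Q" using Q by (auto simp: r_graph_def intro!: card_mono)
    then have "?n ^ r * ?n ^ (vcard Q - r) = ?n ^ vcard Q" by (simp flip: power_add)
    moreover have "real (card D) * ?n ^ (vcard Q - r) \<le> (\<epsilon> * ?n ^ r) * ?n ^ (vcard Q - r)"
      using cD by (intro mult_right_mono) auto
    ultimately show ?thesis by (intro mult_left_mono) (simp_all add: mult.assoc)
  qed simp
  finally show ?thesis by simp
qed

lemma card_edges_over_pairs:
  assumes H: "r_graph r H" and D: "finite D" "\<And>p. p \<in> D \<Longrightarrow> p \<subseteq> verts H \<and> card p = 2" and r: "2 \<le> r"
  shows "card {e \<in> edges H. \<exists>p\<in>D. p \<subseteq> e} \<le> card D * vcard H ^ (r - 2)"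
proof -
  let ?A = "\<lambda>p. {e. e \<subseteq> verts H \<and> card e = r \<and> p \<subseteq> e}"
  note fV = finite_verts[OF H(1)]
  have "{e \<in> edges H. \<exists>p\<in>D. p \<subseteq> e} \<subseteq> (\<Union>p\<in>D. ?A p)" using H by (auto simp: r_graph_def)
  then have "card {e \<in> edges H. \<exists>p\<in>D. p \<subseteq> e} \<le> card (\<Union>p\<in>D. ?A p)"
    using D fV by (intro card_mono) auto
  also have "\<dots> \<le> (\<Sum>p\<in>D. card (?A p))" by (rule card_UN_le[OF D(1)])
  also have "\<dots> \<le> (\<Sum>p\<in>D. vcard H ^ (r - 2))"
  proof (rule sum_mono)
    fix p assume "p \<in> D"
    then show "card (?A p) \<le> vcard H ^ (r - 2)"
      using card_supersets_le[OF fV, of p r] D(2)[of p] r by simp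
  qed
  finally show ?thesis by simp
qed

text \<open>This transfers deletions in the shadow to deletions of \<open>r\<close>-edges at the
  same density.\<close>

lemma card_edges_over_pairs_real:
  fixes \<epsilon> :: real
  assumes "r_graph r H" "finite D" "\<And>p. p \<in> D \<Longrightarrow> p \<subseteq> verts H \<and> card p = 2" "2 \<le> r"
    and "real (card D) \<le> \<epsilon> * real (vcard H) ^ 2"
  shows "real (card {e \<in> edges H. \<exists>p\<in>D. p \<subseteq> e}) \<le> \<epsilon> * real (vcard H) ^ r"
proof -
  let ?n = "real (vcard H)"
  have "real (card {e \<in> edges H. \<exists>p\<in>D. p \<subseteq> e}) \<le> real (card D * vcard H ^ (r - 2))"
    by (rule of_nat_mono[OF card_edges_over_pairs[OF assms(1-4)]])
  also have "\<dots> = real (card D) * ?n ^ (r - 2)" by simp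
  also have "\<dots> \<le> (\<epsilon> * ?n ^ 2) * ?n ^ (r - 2)" using assms by (intro mult_right_mono) auto
  also have "\<dots> = \<epsilon> * ?n ^ r" using assms(4) by (metis le_add_diff_inverse mult.assoc power_add)
  finally show ?thesis .
qed

section \<open>Comparing the two extremal numbers\<close>

lemma inj_max_le:
  assumes "finite (verts Q)" "\<And>F. F \<in> \<F> \<Longrightarrow> edges F \<noteq> {}"
  shows "inj_max r n Q \<F> \<le> n ^ vcard Q"
proof -
  obtain H :: "nat hypergraph" where H: "r_graph r H" "vcard H = n" "inj_count Q H
    = inj_max r n Q \<F>"
    using inj_max_attained[OF assms, of \<F> r n] by metis
  then have "finite (verts H)" by (simp add: r_graph_def)
  then show ?thesis using inj_count_le[OF assms(1), of H] H by simp
qed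

text \<open>A relative error is also an additive one, because the maximum is at most n ^ v.\<close>

lemma inj_max_additive_slack:
  assumes Q: "finite (verts Q)" "\<And>F. F \<in> \<F> \<Longrightarrow> edges F \<noteq> {}"
    and \<delta>: "0 < \<delta>" and x: "(1 - \<delta>) * real (inj_max r n Q \<F>) \<le> x"
  shows "real (inj_max r n Q \<F>) - \<delta> * real n ^ vcard Q \<le> x"
proof -
  have "real (inj_max r n Q \<F>) \<le> real n ^ vcard Q"
    using inj_max_le[OF Q, of \<F> r n] by (metis of_nat_le_iff of_nat_power)
  then have "\<delta> * real (inj_max r n Q \<F>) \<le> \<delta> * real n ^ vcard Q"
    using \<delta> by (intro mult_left_mono) auto
  then show ?thesis using x by (simp add: algebra_simps)
qed

lemma inj_on_if_pairs:
  assumes "\<And>p. p \<subseteq> e \<Longrightarrow> card p = 2 \<Longrightarrow> inj_on c p"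
  shows "inj_on c e"
proof (rule inj_onI, rule ccontr)
  fix x y assume xy: "x \<in> e" "y \<in> e" "c x = c y" "x \<noteq> y"
  then have "inj_on c {x, y}" by (intro assms) auto
  then show False using xy by (auto dest: inj_onD)
qed

lemma small_real_exists:
  fixes a b C :: real
  assumes "0 < a" "0 < b" "0 \<le> C"
  obtains e where "0 < e" "e \<le> a" "C * e < b"
proof
  have C: "0 < C + 1" using assms by simp
  have "min a (b / (C + 1)) \<le> b / (C + 1)" by (rule min.cobounded2)
  then have "min a (b / (C + 1)) * (C + 1) \<le> b" by (simp only: pos_le_divide_eq[OF C])
  moreover have "0 < min a (b / (C + 1))" using assms C by simp
  ultimately show "C * min a (b / (C + 1)) < b" unfolding distrib_left mult_1_right
    by (simp only: mult.commute)
qed (use assms in auto)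

text \<open>The \<open>r\<close>-cliques of an extremal graph need not form an expansion-free
  hypergraph, as a graph without the clique may well contain \<open>F\<close>. Stability, applied to
  the extremal graph itself, makes it \<open>l\<close>-colorable at a small cost, and then its
  \<open>r\<close>-cliques form an \<open>l\<close>-colorable hypergraph, which is
  expansion-free.\<close>

lemma inj_max_expansion_ge:
  fixes \<epsilon> :: real and F :: "'b hypergraph"
  assumes r: "2 \<le> r" and l: "1 \<le> l" and Q: "r_graph r Q"
    and F: "r_graph 2 F" "chromatic_number F = l + 1"
    and stable: "edge_stable 2 (pair_shadow Q) {clique (l + 1)} (colorable_family 2 l)"
    and \<epsilon>: "0 < \<epsilon>"
  shows "\<exists>N0. \<forall>n\<ge>N0. real (inj_max 2 n (pair_shadow Q) {clique (l + 1)}) - \<epsilon> * real n ^ vcard Q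
    \<le> real (inj_max r n Q {expansion r F})"
proof -
  let ?P = "pair_shadow Q" and ?K = "clique (l + 1)"
  let ?C = "real (card (edges ?P) * 2 ^ 2)"
  have P: "r_graph 2 ?P" using Q by (rule r_graph_pair_shadow)
  note fQ = finite_verts[OF Q]
  obtain \<epsilon>1 where \<epsilon>1: "0 < \<epsilon>1" "?C * \<epsilon>1 < \<epsilon>"
    using small_real_exists[of 1 \<epsilon> ?C] \<epsilon> by auto
  obtain \<delta> N where \<delta>: "0 < \<delta>" and N: "near_max_imp 2 ?P {?K} \<delta> N (deletion_close 2 \<epsilon>1
    (colorable_family 2 l))"
    using stable[unfolded edge_stable_iff, rule_format, OF \<epsilon>1(1)] by (elim exE conjE)
  note N = N[rule_format]
  show ?thesis
  proof (intro exI[of _ N] allI impI)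
    fix n assume n: "N \<le> n"
    obtain G :: "nat hypergraph" where G: "r_graph 2 G" "vcard G = n" "free_of {?K} G"
      "inj_count ?P G = inj_max 2 n ?P {?K}"
      using inj_max_attained[of ?P "{?K}" 2 n] fQ edges_complete_graph_nonempty[of "l + 1"] l
        by auto
    have "(1 - \<delta>) * real (inj_count ?P G) \<le> real (inj_count ?P G)"
      using \<delta> by (simp add: mult_le_cancel_right2)
    then obtain D where D: "D \<subseteq> edges G" "real (card D) \<le> \<epsilon>1 * real (vcard G) ^ 2"
      "(verts G, edges G - D) \<in> colorable_family 2 l"
      using N[OF G(1) _ G(3)] G n by auto
    let ?G = "(verts G, edges G - D)"
    let ?T = "(verts ?G, {e. e \<subseteq> verts ?G \<and> card e = r \<and> (\<forall>p\<subseteq>e. card p = 2 \<longrightarrow> p \<in> edges ?G)})"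
    obtain c where c: "proper_coloring l ?G c" and rG: "r_graph 2 ?G" using D(3)
      by (auto simp: colorable_family_iff)
    have "real (inj_count ?P G) \<le> real (inj_count ?P ?G) + ?C * \<epsilon>1 * real (vcard G) ^ vcard ?P"
      by (rule inj_count_delete_real[OF P G(1) D(1,2)])
    also have "?C * \<epsilon>1 * real (vcard G) ^ vcard ?P \<le> \<epsilon> * real n ^ vcard Q"
      unfolding G(2) verts_pair_shadow using \<epsilon>1 by (intro mult_right_mono) auto
    also have "inj_count ?P ?G \<le> inj_count Q ?T" by (rule inj_count_cliques_ge[OF Q rG r])
    also have "inj_count Q ?T \<le> inj_max r n Q {expansion r F}"
    proof (rule inj_max_ge[OF fQ])
      show "r_graph r ?T" using rG by (auto simp: r_graph_def)
      have "inj_on c e" if "\<forall>p\<subseteq>e. card p = 2 \<longrightarrow> p \<in> edges ?G" for e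
        by (rule inj_on_if_pairs) (use c that in \<open>unfold proper_coloring_def snd_conv, blast\<close>)
      then have "proper_coloring l ?T c" using c by (auto simp: proper_coloring_def)
      then show "free_of {expansion r F} ?T" using F by (intro expansion_free_if_colorable) auto
    qed (simp add: G)
    finally show "real (inj_max 2 n ?P {?K}) - \<epsilon> * real n ^ vcard Q
      \<le> real (inj_max r n Q {expansion r F})"
      by (simp add: G(4))
  qed
qed

lemma expansion_edge_stable:
  fixes F :: "'b hypergraph"
  assumes r: "2 \<le> r" and l: "1 \<le> l" and Q: "r_graph r Q"
    and F: "r_graph 2 F" "chromatic_number F = l + 1"
    and stable: "edge_stable 2 (pair_shadow Q) {clique (l + 1)} (colorable_family 2 l)"
  shows "edge_stable r Q {expansion r F} (colorable_family r l)"
  unfolding edge_stable_iff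
proof (intro allI impI)
  fix \<epsilon> :: real assume \<epsilon>: "0 < \<epsilon>"
  let ?P = "pair_shadow Q" and ?K = "clique (l + 1)"
  let ?C = "real (card (edges Q) * r ^ r)"
  have P: "r_graph 2 ?P" using Q by (rule r_graph_pair_shadow)
  note fQ = finite_verts[OF Q]
  define v where "v = vcard Q"
  define M where "M = vcard F + card (edges F) * r"
  obtain \<delta>1 N1 where \<delta>1: "0 < \<delta>1" and N1: "\<And>G :: nat hypergraph. r_graph 2 G \<Longrightarrow> N1 \<le> vcard G \<Longrightarrow>
      free_of {F} G \<Longrightarrow>
      near_max_additive l ?P \<delta>1 G \<Longrightarrow>
      deletion_close 2 (\<epsilon> / 2) (colorable_family 2 l) G"
    using close_to_colorable[OF P l F(1) eq_imp_le[OF F(2)] stable half_gt_zero[OF \<epsilon>]] by blast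
  \<comment> \<open>Three losses of \<delta> n ^ v each: the comparison of the extremal numbers, the
    slack of \<open>H\<close>, and the deletion of the edges with a fragile pair.\<close>
  define \<delta> where "\<delta> = \<delta>1 / 3"
  have \<delta>: "0 < \<delta>" using \<delta>1 by (simp add: \<delta>_def)
  \<comment> \<open>The fragile edges must take up at most half of the deletion budget and also
    destroy few copies of \<open>Q\<close>.\<close>
  obtain \<epsilon>2 where \<epsilon>2: "0 < \<epsilon>2" "\<epsilon>2 \<le> \<epsilon> / 2" "?C * \<epsilon>2 < \<delta>"
    using small_real_exists[of "\<epsilon> / 2" \<delta> ?C] \<epsilon> \<delta> by auto
  obtain N2 where N2: "\<And>n. N2 \<le> n \<Longrightarrow> real (inj_max 2 n ?P {?K}) - \<delta> * real n ^ v
    \<le> real (inj_max r n Q {expansion r F})"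
    using inj_max_expansion_ge[OF r l Q F stable \<delta>] unfolding v_def by blast
  define N0 where "N0 = N1 + N2 + nat \<lceil>real M / \<epsilon>2\<rceil> + 1"
  have N0: "N1 \<le> N0" "N2 \<le> N0" "nat \<lceil>real M / \<epsilon>2\<rceil> \<le> N0" "1 \<le> N0" unfolding N0_def by linarith+
  have main: "\<exists>D\<subseteq>edges H. real (card D) \<le> \<epsilon> * real n ^ r \<and> (verts H, edges H - D) \<in>
    colorable_family r l"
    if n: "N0 \<le> n" and H: "r_graph r H" "vcard H = n" "free_of {expansion r F} H"
      and near: "(1 - \<delta>) * real (inj_max r n Q {expansion r F}) \<le> real (inj_count Q H)" for n
        and H :: "nat hypergraph"
  proof -
    define L where "L = {e \<in> edges H. \<exists>p\<subseteq>e. card p = 2 \<and> \<not> robust_pair H M p}"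
    let ?H' = "(verts H, edges H - L)"
    let ?G = "pair_shadow ?H'"
    have rH': "r_graph r ?H'" by (rule r_graph_subset[OF H(1)]) auto
    have rG: "r_graph 2 ?G" using rH' by (rule r_graph_pair_shadow)
    note fV = finite_verts[OF H(1)]
    have free: "free_of {F} ?G"
      by (rule shadow_free[OF F(1) H(1,3)]) (auto simp: L_def M_def)
    have cL: "real (card L) \<le> \<epsilon>2 * real (vcard H) ^ r"
    proof -
      have "real (card L) \<le> real (M * n ^ (r - 1))"
        using card_fragile_edges[OF H(1), of M] unfolding L_def H(2) by (rule of_nat_mono)
      also have "\<dots> = real M * real n ^ (r - 1)" by simp
      also have "real M \<le> \<epsilon>2 * real n"
      proof -
        have "real M / \<epsilon>2 \<le> real n" using N0(3) n by linarith
        then show ?thesis using \<epsilon>2 by (simp add: field_simps)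
      qed
      then have "real M * real n ^ (r - 1) \<le> \<epsilon>2 * real n * real n ^ (r - 1)"
        by (intro mult_right_mono) auto
      also have "\<dots> = \<epsilon>2 * real n ^ r" using r by (simp add: mult.assoc flip: power_Suc)
      finally show ?thesis by (simp add: H(2))
    qed
    have "real (inj_max 2 n ?P {?K}) - \<delta>1 * real n ^ v \<le> real (inj_count ?P ?G)"
    proof -
      have "real (inj_max 2 n ?P {?K}) - \<delta> * real n ^ v \<le> real (inj_max r n Q {expansion r F})"
        using N2 n N0 by simp
      moreover have "real (inj_max r n Q {expansion r F}) - \<delta> * real n ^ v \<le> real (inj_count Q H)"
        unfolding v_def using edges_nonempty_if_chromatic[of F] F(2) l
        by (intro inj_max_additive_slack[OF fQ _ \<delta> near]) (auto intro!: edges_expansion_nonempty)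
      moreover have "real (inj_count Q H) \<le> real (inj_count Q ?H') + ?C * \<epsilon>2 * real (vcard H) ^
        vcard Q"
        by (rule inj_count_delete_real[OF Q H(1) _ cL]) (auto simp: L_def)
      moreover have "?C * \<epsilon>2 * real (vcard H) ^ vcard Q \<le> \<delta> * real n ^ v"
        unfolding H(2) v_def using \<epsilon>2 by (intro mult_right_mono) auto
      moreover have "inj_count Q ?H' \<le> inj_count ?P ?G"
        by (rule inj_count_pair_shadow_ge[OF fQ]) (use fV Q in \<open>auto simp: pair_shadow_def
          r_graph_def\<close>)
      then have "real (inj_count Q ?H') \<le> real (inj_count ?P ?G)" by simp
      moreover have "\<delta>1 * real n ^ v = \<delta> * real n ^ v + \<delta> * real n ^ v + \<delta> * real n ^ v"
        by (simp add: \<delta>_def)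
      ultimately show ?thesis by linarith
    qed
    then obtain D2 where D2: "D2 \<subseteq> edges ?G" "real (card D2) \<le> \<epsilon> / 2 * real (vcard ?G) ^ 2"
      "(verts ?G, edges ?G - D2) \<in> colorable_family 2 l"
      using N1[OF rG _ free] H(2) n N0 by (auto simp: v_def)
    obtain c where c: "proper_coloring l (verts ?G, edges ?G - D2) c" using D2(3)
      by (auto simp: colorable_family_iff)
    \<comment> \<open>Deleting all edges over pairs of \<open>D2\<close> makes the coloring of the
      remaining shadow injective on every remaining edge.\<close>
    define L2 where "L2 = {e \<in> edges H. \<exists>p\<in>D2. p \<subseteq> e}"
    have "real (card L2) \<le> \<epsilon> / 2 * real (vcard H) ^ r"
      unfolding L2_def
    proof (rule card_edges_over_pairs_real[OF H(1) _ _ r])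
      show "finite D2" using D2(1) finite_edges[OF rG] finite_subset by blast
      show "\<And>p. p \<in> D2 \<Longrightarrow> p \<subseteq> verts H \<and> card p = 2" using D2(1) rG by (auto simp: r_graph_def)
    qed (use D2(2) in simp)
    moreover have "real (card (L \<union> L2)) \<le> real (card L) + real (card L2)"
      using card_Un_le[of L L2] by linarith
    moreover have "\<epsilon>2 * real n ^ r \<le> \<epsilon> / 2 * real n ^ r" using \<epsilon>2 by (intro mult_right_mono) auto
    ultimately have "real (card (L \<union> L2)) \<le> \<epsilon> * real n ^ r" using cL unfolding H(2)
      by (simp add: field_simps)
    moreover have "L \<union> L2 \<subseteq> edges H" by (auto simp: L_def L2_def)
    moreover have "(verts H, edges H - (L \<union> L2)) \<in> colorable_family r l"
    proof -
      have "inj_on c e" if e: "e \<in> edges H - (L \<union> L2)" for e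
      proof (rule inj_on_if_pairs)
        fix p assume p: "p \<subseteq> e" "card p = 2"
        then have "p \<in> edges ?G" using e by (auto simp: pair_shadow_def)
        moreover have "p \<notin> D2" using e p by (auto simp: L2_def)
        ultimately show "inj_on c p" using c unfolding proper_coloring_def snd_conv by blast
      qed
      then have "proper_coloring l (verts H, edges H - (L \<union> L2)) c"
        using c by (auto simp: proper_coloring_def)
      moreover have "r_graph r (verts H, edges H - (L \<union> L2))" by (rule r_graph_subset[OF H(1)]) auto
      ultimately show ?thesis by (auto simp: colorable_family_iff)
    qed
    ultimately show ?thesis by blast
  qed
  show "\<exists>\<delta>>0. \<exists>N. near_max_imp r Q {expansion r F} \<delta> N (deletion_close r \<epsilon> (colorable_family r l))"
    by (rule exI[of _ \<delta>], rule conjI[OF \<delta>], rule exI[of _ N0], intro allI impI, rule main) simp_all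
qed

section \<open>Turan graphs\<close>

lemma turan_stable_iff:
  "turan_stable r l Q G \<longleftrightarrow>
    (\<forall>\<epsilon>>0. \<exists>\<delta>>0. \<exists>N. near_max_imp r Q {G} \<delta> N (turan_close r l \<epsilon>))"
  unfolding turan_stable_def by (intro all_cong1 imp_cong ex_cong1 conj_cong refl) auto

lemma turan_isomorphismE:
  assumes iso: "isomorphic (V, E) (turan_r_graph r n l)"
  obtains g where "bij_betw g V {1..n}" "(\<lambda>e. g ` e) ` E = edges (turan_r_graph r n l)"
    "\<And>e. e \<in> E \<Longrightarrow> e \<subseteq> V \<Longrightarrow> inj_on (\<lambda>x. g x mod l) e"
proof -
  obtain g where g: "bij_betw g V {1..n}" "(\<lambda>e. g ` e) ` E = edges (turan_r_graph r n l)"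
    using iso by (auto simp: isomorphic_def turan_r_graph_def)
  have "inj_on (\<lambda>x. g x mod l) e" if "e \<in> E" "e \<subseteq> V" for e
  proof -
    have "g ` e \<in> edges (turan_r_graph r n l)" using g(2) that(1) by blast
    then have "inj_on (\<lambda>y. y mod l) (g ` e)" by (simp add: turan_r_graph_def)
    moreover have "inj_on g e" using g(1) that(2) by (auto simp: bij_betw_def intro: inj_on_subset)
    ultimately show ?thesis using comp_inj_on[of g e "\<lambda>y. y mod l"] by (simp add: comp_def)
  qed
  then show thesis using that g by blast
qed

text \<open>After the deletions the hypergraph is contained in a copy of the Turan hypergraph, whose
  residues color it.\<close>

lemma turan_stable_imp_edge_stable:
  assumes "turan_stable r l Q G" "1 \<le> l"
  shows "edge_stable r Q {G} (colorable_family r l)"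
  unfolding edge_stable_iff
proof (intro allI impI)
  fix \<epsilon> :: real assume \<epsilon>: "0 < \<epsilon>"
  obtain \<delta> N0 where \<delta>: "0 < \<delta>" and N0: "near_max_imp r Q {G} \<delta> N0 (turan_close r l \<epsilon>)"
    using assms(1)[unfolded turan_stable_iff, rule_format, OF \<epsilon>] by (elim exE conjE)
  note N0 = N0[rule_format]
  have main: "\<exists>D\<subseteq>edges H. real (card D) \<le> \<epsilon> * real n ^ r \<and> (verts H, edges H - D) \<in>
    colorable_family r l"
    if n: "N0 \<le> n" and H: "r_graph r H" "vcard H = n" "free_of {G} H"
      and near: "(1 - \<delta>) * real (inj_max r n Q {G}) \<le> real (inj_count Q H)" for n
        and H :: "nat hypergraph"
  proof -
    obtain D A where D: "D \<subseteq> edges H" "real (card D + card A) \<le> \<epsilon> * real n ^ r"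
      "isomorphic (verts H, (edges H - D) \<union> A) (turan_r_graph r n l)"
      using N0[OF H(1) _ H(3)] H(2) n near by auto
    obtain g where "bij_betw g (verts H) {1..n}" "(\<lambda>e. g ` e) ` ((edges H - D) \<union> A)
      = edges (turan_r_graph r n l)"
      and g: "\<And>e. e \<in> (edges H - D) \<union> A \<Longrightarrow> e \<subseteq> verts H \<Longrightarrow> inj_on (\<lambda>x. g x mod l) e"
      by (rule turan_isomorphismE[OF D(3)]) (rule that, assumption, assumption, blast)
    \<comment> \<open>Adding 1 moves the residues into the color set \<open>{1..l}\<close>.\<close>
    have "inj_on (\<lambda>x. g x mod l + 1) e" if "e \<in> edges H - D" for e
      using g[of e] that H(1) by (auto simp: r_graph_def inj_on_def)
    then have "proper_coloring l (verts H, edges H - D) (\<lambda>x. g x mod l + 1)"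
      using assms(2) by (auto simp: proper_coloring_def Suc_le_eq)
    moreover have "r_graph r (verts H, edges H - D)" by (rule r_graph_subset[OF H(1)]) auto
    ultimately have "(verts H, edges H - D) \<in> colorable_family r l"
      by (auto simp: colorable_family_iff)
    moreover have "real (card D) \<le> \<epsilon> * real n ^ r" using D(2) by simp
    ultimately show ?thesis using D(1) by blast
  qed
  show "\<exists>\<delta>>0. \<exists>N. near_max_imp r Q {G} \<delta> N (deletion_close r \<epsilon> (colorable_family r l))"
    by (rule exI[of _ \<delta>], rule conjI[OF \<delta>], rule exI[of _ N0], intro allI impI, rule main) simp_all
qed

section \<open>Sizes of residue classes and of Turan graphs\<close>

lemma card_residue_class_ge:
  assumes "j < l"
  shows "n div l \<le> card {y \<in> {1..n}. y mod l = j}"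
proof -
  \<comment> \<open>Vertices start at 1, so the smallest member of the class of 0 is
    \<open>l\<close>.\<close>
  define j' where "j' = (if j = 0 then l else j)"
  have j': "1 \<le> j'" "j' \<le> l" "j' mod l = j" using assms by (auto simp: j'_def)
  have "l * i + j' \<le> n" if "i < n div l" for i
  proof -
    have "l * (i + 1) \<le> l * (n div l)" using that by (intro mult_le_mono2) simp
    moreover have "l * (n div l) \<le> n" by simp
    ultimately show ?thesis using j' unfolding distrib_left by linarith
  qed
  moreover have "(l * i + j') mod l = j" for i using j' by simp
  ultimately have "(\<lambda>i. l * i + j') ` {..<n div l} \<subseteq> {y \<in> {1..n}. y mod l = j}"
    using j' by (auto simp: Suc_le_eq)
  moreover have "inj_on (\<lambda>i. l * i + j') {..<n div l}" using assms by (auto simp: inj_on_def)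
  ultimately have "card {..<n div l} \<le> card {y \<in> {1..n}. y mod l = j}"
    by (intro card_inj_on_le[where f = "\<lambda>i. l * i + j'"]) auto
  then show ?thesis by simp
qed

text \<open>Counting the pairs between the classes of 0 and 1 already gives the right order of
  magnitude.\<close>

lemma card_turan_graph_edges_ge:
  assumes "2 \<le> l"
  shows "(n div l)\<^sup>2 \<le> card (edges (turan_r_graph 2 n l))"
proof -
  let ?X = "{y \<in> {1..n}. y mod l = 0}" and ?Y = "{y \<in> {1..n}. y mod l = 1}"
  let ?T = "edges (turan_r_graph 2 n l)"
  have fT: "finite ?T" by (rule finite_subset[of _ "Pow {1..n}"]) (auto simp: turan_r_graph_def)
  have "(n div l)\<^sup>2 \<le> card ?X * card ?Y"
    unfolding power2_eq_square using assms by (intro mult_le_mono card_residue_class_ge) auto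
  also have "\<dots> = card (?X \<times> ?Y)" by (simp add: card_cartesian_product)
  also have "\<dots> \<le> card ?T"
  proof (rule card_inj_on_le[where f = "\<lambda>(x, y). {x, y}"])
    show "inj_on (\<lambda>(x, y). {x, y}) (?X \<times> ?Y)"
      by (auto simp: inj_on_def doubleton_eq_iff)
    show "(\<lambda>(x, y). {x, y}) ` (?X \<times> ?Y) \<subseteq> ?T"
      by (auto simp: turan_r_graph_def card_insert_if)
  qed (fact fT)
  finally show ?thesis .
qed

lemma half_quotient_le:
  fixes m n :: nat
  assumes "0 < m" "m \<le> n"
  shows "real n / (2 * real m) \<le> real (n div m)"
proof -
  have "1 \<le> n div m" using assms by (simp add: Suc_le_eq div_greater_zero_iff)
  then have "m * 1 \<le> m * (n div m)" by (intro mult_le_mono2)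
  moreover have "n = m * (n div m) + n mod m" "n mod m < m" using assms by simp_all
  ultimately have "n \<le> 2 * (m * (n div m))" by linarith
  then have "real n \<le> real (2 * (m * (n div m)))" by (rule of_nat_mono)
  then show ?thesis using assms by (simp add: field_simps)
qed

text \<open>The edgeless graph is far from the Turan graph, so by stability it is not near-extremal.
  But it would be if \<open>P\<close> had no edge, or if no admissible graph of that size contained
  a copy of \<open>P\<close>.\<close>

lemma turan_stable_nontrivial:
  assumes stable: "turan_stable 2 l P (clique (l + 1))" and l: "2 \<le> l" and P: "r_graph 2 P"
  shows "edges P \<noteq> {} \<and> (\<exists>m>0. 0 < inj_max 2 m P {clique (l + 1)})"
proof -
  let ?K = "clique (l + 1)"
  note fP = finite_verts[OF P]
  \<comment> \<open>Half of the lower bound n ^ 2 / (4 l ^ 2) for the number of edges of the Turan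
    graph.\<close>
  define \<epsilon> where "\<epsilon> = 1 / (8 * real l ^ 2)"
  have \<epsilon>: "0 < \<epsilon>" using l by (simp add: \<epsilon>_def)
  obtain \<delta> N where \<delta>: "0 < \<delta>" and N: "near_max_imp 2 P {?K} \<delta> N (turan_close 2 l \<epsilon>)"
    using stable[unfolded turan_stable_iff, rule_format, OF \<epsilon>] by (elim exE conjE)
  note N = N[rule_format]
  define n where "n = N + l"
  obtain G :: "nat hypergraph" where G: "r_graph 2 G" "vcard G = n" "free_of {?K} G"
    "inj_count P G = inj_max 2 n P {?K}"
    using inj_max_attained[OF fP, of "{?K}" 2 n] edges_complete_graph_nonempty[of "l + 1"] l by auto
  let ?G0 = "(verts G, {} :: nat set set)"
  have "\<not> (1 - \<delta>) * real (inj_max 2 n P {?K}) \<le> real (inj_count P ?G0)"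
  proof
    assume near: "(1 - \<delta>) * real (inj_max 2 n P {?K}) \<le> real (inj_count P ?G0)"
    have "r_graph 2 ?G0" using G(1) by (simp add: r_graph_def)
    moreover have "free_of {?K} ?G0"
      using edges_complete_graph_nonempty[of "l + 1"] l by (auto simp: free_of_def homomorphism_def)
    ultimately obtain D A where D: "D \<subseteq> {}" "A \<subseteq> {e. e \<subseteq> verts G \<and> card e = 2}"
      "real (card D + card A) \<le> \<epsilon> * real n ^ 2"
      "isomorphic (verts G, ({} - D) \<union> A) (turan_r_graph 2 n l)"
      using N[of ?G0] near by (auto simp: G(2) n_def)
    have fA: "finite A"
      by (rule finite_subset[OF D(2)]) (use G(1) in \<open>simp add: r_graph_def\<close>)
    obtain g where g: "(\<lambda>e. g ` e) ` (({} - D) \<union> A) = edges (turan_r_graph 2 n l)"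
      by (rule turan_isomorphismE[OF D(4)]) (rule that)
    have "card (edges (turan_r_graph 2 n l)) \<le> card A"
      unfolding g[symmetric] using card_image_le[OF fA] by simp
    then have "(n div l)\<^sup>2 \<le> card A" using card_turan_graph_edges_ge[OF l, of n] by linarith
    then have "real (n div l) ^ 2 \<le> real (card A)" by (metis of_nat_le_iff of_nat_power)
    also have "\<dots> \<le> \<epsilon> * real n ^ 2" using D(3) by simp
    finally have up: "real (n div l) ^ 2 \<le> \<epsilon> * real n ^ 2" .
    have "(real n / (2 * real l)) ^ 2 \<le> real (n div l) ^ 2"
      using half_quotient_le[of l n] l by (intro power_mono) (auto simp: n_def)
    with up have "real n ^ 2 / (4 * real l ^ 2) \<le> real n ^ 2 / (8 * real l ^ 2)"
      by (simp add: \<epsilon>_def power_divide power_mult_distrib)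
    moreover have "0 < real n ^ 2" using l by (simp add: n_def)
    ultimately show False using l by (simp add: field_simps)
  qed
  then have lt: "real (inj_count P ?G0) < (1 - \<delta>) * real (inj_max 2 n P {?K})" by simp
  have "edges P \<noteq> {}"
  proof
    assume "edges P = {}"
    then have "inj_count P ?G0 = inj_count P G" by (simp add: inj_count_def homomorphism_def)
    then have "real (inj_max 2 n P {?K}) < (1 - \<delta>) * real (inj_max 2 n P {?K})" using lt G(4)
      by simp
    moreover have "0 \<le> \<delta> * real (inj_max 2 n P {?K})" using \<delta> by simp
    ultimately show False by (simp add: algebra_simps)
  qed
  moreover have "0 < inj_max 2 n P {?K}" using lt by (intro Nat.gr0I) auto
  moreover have "0 < n" using l by (simp add: n_def)
  ultimately show ?thesis by blast
qed

text \<open>One copy at a single size \<open>m\<close> propagates to all larger sizes by blow-ups.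
  This is what turns additive errors into relative ones in the Turan argument.\<close>

lemma inj_max_order_of_magnitude:
  assumes P: "r_graph 2 P" and k: "2 \<le> k" and m: "0 < m" "0 < inj_max 2 m P {clique k}"
  shows "\<exists>c::real>0. \<forall>n\<ge>m. c * real n ^ vcard P \<le> real (inj_max 2 n P {clique k})"
proof (rule exI[of _ "(1 / (2 * real m)) ^ vcard P"], intro conjI allI impI)
  show "0 < (1 / (2 * real m)) ^ vcard P" using m by simp
  fix n assume n: "m \<le> n"
  have "(1 / (2 * real m)) ^ vcard P * real n ^ vcard P = (real n / (2 * real m)) ^ vcard P"
    by (simp add: power_divide power_mult_distrib)
  also have "\<dots> \<le> real (n div m) ^ vcard P"
    using half_quotient_le[OF m(1) n] by (intro power_mono) auto
  also have "\<dots> \<le> real (inj_max 2 m P {clique k} * (n div m) ^ vcard P)"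
    using m(2) by (simp add: mult_le_cancel_right1)
  also have "\<dots> \<le> real (inj_max 2 n P {clique k})"
    by (rule of_nat_mono[OF inj_max_blowup[OF P m(1) k]])
  finally show "(1 / (2 * real m)) ^ vcard P * real n ^ vcard P \<le> real (inj_max 2 n P {clique k})" .
qed

text \<open>An extremal graph has at least c n ^ v copies of \<open>P\<close>, and making it
  \<open>l\<close>-colorable destroys fewer than that. A surviving copy pulls the coloring back to
  \<open>P\<close>.\<close>

lemma stable_imp_colorable:
  assumes P: "r_graph 2 P" and l: "1 \<le> l"
    and stable: "edge_stable 2 P {clique (l + 1)} (colorable_family 2 l)"
    and c: "0 < (c::real)" "\<And>n. m \<le> n \<Longrightarrow> c * real n ^ vcard P \<le> real (inj_max 2 n P {clique (l +
      1)})"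
  shows "\<exists>\<kappa>. proper_coloring l P \<kappa>"
proof -
  let ?K = "clique (l + 1)" and ?C = "real (card (edges P) * 2 ^ 2)"
  note fP = finite_verts[OF P]
  obtain \<epsilon> where \<epsilon>: "0 < \<epsilon>" and C\<epsilon>: "?C * \<epsilon> < c"
    using small_real_exists[of 1 c ?C] c by auto
  obtain \<delta> N where \<delta>: "0 < \<delta>" and N: "near_max_imp 2 P {?K} \<delta> N (deletion_close 2 \<epsilon>
    (colorable_family 2 l))"
    using stable[unfolded edge_stable_iff, rule_format, OF \<epsilon>] by (elim exE conjE)
  note N = N[rule_format]
  define n where "n = N + m + 1"
  obtain G :: "nat hypergraph" where G: "r_graph 2 G" "vcard G = n" "free_of {?K} G"
    "inj_count P G = inj_max 2 n P {?K}"
    using inj_max_attained[OF fP, of "{?K}" 2 n] edges_complete_graph_nonempty[of "l + 1"] l by auto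
  have "(1 - \<delta>) * real (inj_count P G) \<le> real (inj_count P G)" using \<delta>
    by (simp add: mult_le_cancel_right2)
  then obtain D where D: "D \<subseteq> edges G" "real (card D) \<le> \<epsilon> * real (vcard G) ^ 2"
    "(verts G, edges G - D) \<in> colorable_family 2 l"
    using N[OF G(1) _ G(3)] G by (auto simp: n_def)
  obtain d where d: "proper_coloring l (verts G, edges G - D) d" using D(3)
    by (auto simp: colorable_family_iff)
  have n0: "0 < real n ^ vcard P" by (simp add: n_def)
  have "c * real n ^ vcard P \<le> real (inj_count P G)" using c(2)[of n] by (simp add: n_def G(4))
  also have "\<dots> \<le> real (inj_count P (verts G, edges G - D)) + ?C * \<epsilon> * real (vcard G) ^ vcard P"
    by (rule inj_count_delete_real[OF P G(1) D(1,2)])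
  finally have "c * real n ^ vcard P - ?C * \<epsilon> * real n ^ vcard P
    \<le> real (inj_count P (verts G, edges G - D))"
    by (simp add: G(2))
  moreover have "?C * \<epsilon> * real n ^ vcard P < c * real n ^ vcard P"
    using C\<epsilon> n0 by (intro mult_strict_right_mono)
  ultimately have "0 < inj_count P (verts G, edges G - D)" by linarith
  then obtain f where f: "f \<in> verts P \<rightarrow>\<^sub>E verts G" "inj_on f (verts P)" "homomorphism f P (verts
    G, edges G - D)"
    unfolding inj_count_def by (auto dest: card_gt_0_iff[THEN iffD1])
  have "inj_on (\<lambda>x. d (f x)) e" if e: "e \<in> edges P" for e
  proof -
    have "f ` e \<in> edges G - D" using f(3) e by (simp add: homomorphism_def)
    then have "inj_on d (f ` e)" using d unfolding proper_coloring_def snd_conv by blast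
    moreover have "inj_on f e" using f(2) P e by (auto simp: r_graph_def intro: inj_on_subset)
    ultimately show ?thesis using comp_inj_on[of f e d] by (simp add: comp_def)
  qed
  moreover have "d (f x) \<in> {1..l}" if "x \<in> verts P" for x
    using d PiE_mem[OF f(1) that] unfolding proper_coloring_def fst_conv by blast
  ultimately show ?thesis by (intro exI[of _ "\<lambda>x. d (f x)"]) (simp add: proper_coloring_def)
qed

section \<open>Copies of Q through a given edge of a complete partite hypergraph\<close>

lemma extend_inj_to_same_card:
  assumes "finite A" "finite B" "card A = card B" "S \<subseteq> A" "inj_on \<tau> S" "\<tau> ` S \<subseteq> B"
  shows "\<exists>\<sigma>. bij_betw \<sigma> A B \<and> (\<forall>x\<in>S. \<sigma> x = \<tau> x)"
proof -
  have "card (A - S) = card (B - \<tau> ` S)"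
    using assms by (simp add: card_Diff_subset finite_subset card_image)
  then obtain \<beta> where \<beta>: "bij_betw \<beta> (A - S) (B - \<tau> ` S)"
    using finite_same_card_bij[of "A - S" "B - \<tau> ` S"] assms by auto
  have "bij_betw (\<lambda>x. if x \<in> S then \<tau> x else \<beta> x) (S \<union> (A - S)) (\<tau> ` S \<union> (B - \<tau> ` S))"
  proof (rule bij_betw_combine)
    show "bij_betw (\<lambda>x. if x \<in> S then \<tau> x else \<beta> x) S (\<tau> ` S)"
      using assms(5) by (auto simp: bij_betw_def inj_on_def)
    show "bij_betw (\<lambda>x. if x \<in> S then \<tau> x else \<beta> x) (A - S) (B - \<tau> ` S)"
      using \<beta> by (subst bij_betw_cong[of _ _ \<beta>]) auto
  qed auto
  moreover have "S \<union> (A - S) = A" "\<tau> ` S \<union> (B - \<tau> ` S) = B" using assms by auto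
  ultimately show ?thesis by (intro exI[of _ "\<lambda>x. if x \<in> S then \<tau> x else \<beta> x"]) simp
qed

text \<open>Map \<open>e0\<close> onto \<open>a\<close> first. The colors on \<open>e0\<close> under
  \<kappa> are thereby matched with the parts that \<open>a\<close> meets; extend this matching to a
  bijection \<sigma> from colors to parts. All other vertices can then be placed greedily, each in
  the part of its color.\<close>

lemma card_copies_through_edge:
  assumes V: "finite V" and h: "\<And>x. x \<in> V \<Longrightarrow> h x < l" "\<And>j. j < l \<Longrightarrow> q \<le> card {x \<in> V. h x = j}"
    and Q: "r_graph r Q" and \<kappa>: "proper_coloring l Q \<kappa>" and e0: "e0 \<in> edges Q"
    and a: "a \<subseteq> V" "card a = r" "inj_on h a" and vq: "vcard Q \<le> q"
  shows "(q - vcard Q) ^ (vcard Q - r) \<le>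
    card {f \<in> verts Q \<rightarrow>\<^sub>E V. inj_on f (verts Q) \<and> f ` e0 = a \<and> (\<forall>e\<in>edges Q. inj_on (h \<circ> f) e)}"
proof -
  let ?X = "verts Q - e0"
  note fQ = finite_verts[OF Q]
  have e0Q: "e0 \<subseteq> verts Q" "card e0 = r" using Q e0 by (auto simp: r_graph_def)
  have fe0: "finite e0" using e0Q fQ finite_subset by blast
  have fa: "finite a" using a V finite_subset by blast
  obtain b where b: "bij_betw b e0 a" using finite_same_card_bij[OF fe0 fa] e0Q a by auto
  have \<kappa>e0: "inj_on \<kappa> e0" using \<kappa> e0 by (simp add: proper_coloring_def)
  \<comment> \<open>The part forced on the color \<open>i\<close> by the placement \<open>b\<close>
    of \<open>e0\<close>.\<close>
  define \<tau> where "\<tau> i = h (b (inv_into e0 \<kappa> i))" for i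
  have \<tau>: "\<tau> (\<kappa> x) = h (b x)" if "x \<in> e0" for x using \<kappa>e0 that by (simp add: \<tau>_def)
  have hb: "inj_on (\<lambda>x. h (b x)) e0"
    using b a(3) comp_inj_on[of b e0 h] by (simp add: bij_betw_def comp_def)
  have "inj_on \<tau> (\<kappa> ` e0)"
    using hb \<tau> by (auto simp: inj_on_def)
  moreover have "\<tau> ` \<kappa> ` e0 \<subseteq> {..<l}"
    using \<tau> b a(1) h(1) by (fastforce simp: bij_betw_def)
  moreover have "\<kappa> ` e0 \<subseteq> {1..l}" using \<kappa> e0Q by (auto simp: proper_coloring_def)
  ultimately have "\<exists>\<sigma>. bij_betw \<sigma> {1..l} {..<l} \<and> (\<forall>i\<in>\<kappa> ` e0. \<sigma> i = \<tau> i)"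
    by (intro extend_inj_to_same_card) auto
  then obtain \<sigma> where \<sigma>: "bij_betw \<sigma> {1..l} {..<l}" and \<sigma>\<tau>: "\<And>i. i \<in> \<kappa> ` e0 \<Longrightarrow> \<sigma> i = \<tau> i"
    by blast
  have \<kappa>l: "\<kappa> x \<in> {1..l}" if "x \<in> verts Q" for x using \<kappa> that by (simp add: proper_coloring_def)
  define B where "B x = {y \<in> V. h y = \<sigma> (\<kappa> x)} - a" for x
  \<comment> \<open>Of the \<open>q\<close> vertices of a part, at most \<open>r\<close> lie in
    \<open>a\<close>; setting aside one for each of the other vcard Q - r vertices still leaves
    \<open>s\<close>.\<close>
  define s where "s = q - vcard Q"
  have cX: "card ?X = vcard Q - r" using e0Q fe0 by (simp add: card_Diff_subset)
  have vr: "r \<le> vcard Q" using e0Q fQ card_mono by metis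
  have "s ^ card ?X \<le> card {f \<in> PiE ?X B. inj_on f ?X}"
  proof (rule card_inj_PiE_ge)
    show "finite ?X" using fQ by simp
    show "finite (B x)" for x using V by (simp add: B_def)
    fix x assume "x \<in> ?X"
    then have "\<sigma> (\<kappa> x) < l" using \<kappa>l \<sigma> by (auto simp: bij_betw_def)
    then have "q \<le> card {y \<in> V. h y = \<sigma> (\<kappa> x)}" by (rule h(2))
    moreover have "card {y \<in> V. h y = \<sigma> (\<kappa> x)} - card a \<le> card (B x)"
      unfolding B_def using fa by (rule diff_card_le_card_Diff)
    ultimately show "s + card ?X \<le> card (B x)" using a(2) cX vq vr by (simp add: s_def)
  qed
  also have "\<dots> \<le> card {f \<in> verts Q \<rightarrow>\<^sub>E V. inj_on f (verts Q) \<and> f ` e0 = a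
    \<and> (\<forall>e\<in>edges Q. inj_on (h \<circ> f) e)}"
    (is "_ \<le> card ?R")
  proof (rule card_inj_on_le[where f = "\<lambda>f x. if x \<in> e0 then b x else f x"])
    show "finite ?R"
      by (rule finite_filter_PiE) (use fQ V in auto)
    show "inj_on (\<lambda>f x. if x \<in> e0 then b x else f x) {f \<in> PiE ?X B. inj_on f ?X}"
    proof (rule inj_onI, clarify)
      fix f g assume f: "f \<in> PiE ?X B" and g: "g \<in> PiE ?X B"
        and eq: "(\<lambda>x. if x \<in> e0 then b x else f x) = (\<lambda>x. if x \<in> e0 then b x else g x)"
      show "f = g"
      proof
        fix x show "f x = g x"
          using fun_cong[OF eq, of x] PiE_arb[OF f, of x] PiE_arb[OF g, of x]
            by (cases "x \<in> e0") auto
      qed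
    qed
    show "(\<lambda>f x. if x \<in> e0 then b x else f x) ` {f \<in> PiE ?X B. inj_on f ?X} \<subseteq> ?R"
    proof (rule image_subsetI)
      fix f assume "f \<in> {f \<in> PiE ?X B. inj_on f ?X}"
      then have f: "f \<in> PiE ?X B" "inj_on f ?X" by auto
      define F where "F x = (if x \<in> e0 then b x else f x)" for x
      have Fb: "F x = b x" if "x \<in> e0" for x using that by (simp add: F_def)
      have Ff: "F x = f x" "f x \<in> B x" if "x \<in> ?X" for x using that PiE_mem[OF f(1)]
        by (auto simp: F_def)
      have ba: "b ` e0 = a" "inj_on b e0" using b by (auto simp: bij_betw_def)
      have col: "h (F x) = \<sigma> (\<kappa> x)" if "x \<in> verts Q" for x
      proof (cases "x \<in> e0")
        case True
        then show ?thesis using \<sigma>\<tau>[of "\<kappa> x"] \<tau>[of x] Fb[of x] by simp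
      next
        case False
        then show ?thesis using Ff[of x] that by (simp add: B_def)
      qed
      have "F x \<in> V" if "x \<in> verts Q" for x
        using that Fb[of x] Ff[of x] ba a(1) by (cases "x \<in> e0") (auto simp: B_def)
      moreover have "F x = undefined" if "x \<notin> verts Q" for x
        using that e0Q PiE_arb[OF f(1), of x] by (auto simp: F_def)
      ultimately have "F \<in> verts Q \<rightarrow>\<^sub>E V" by (auto simp: PiE_iff extensional_def)
      moreover have "inj_on F (verts Q)"
      proof (rule inj_onI)
        fix x y assume xy: "x \<in> verts Q" "y \<in> verts Q" "F x = F y"
        have mem: "F z \<in> a \<longleftrightarrow> z \<in> e0" if "z \<in> verts Q" for z
          using that Fb[of z] Ff[of z] ba by (cases "z \<in> e0") (auto simp: B_def)
        show "x = y"
        proof (cases "x \<in> e0")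
          case True
          then have "y \<in> e0" using mem xy by metis
          then show ?thesis using True xy Fb ba(2) by (auto dest: inj_onD)
        next
          case False
          then have "y \<notin> e0" using mem xy by metis
          then show ?thesis using False xy Ff f(2) by (auto dest: inj_onD)
        qed
      qed
      moreover have "F ` e0 = a" using Fb ba(1) by (metis image_cong)
      moreover have "inj_on (h \<circ> F) e" if e: "e \<in> edges Q" for e
      proof (rule inj_onI)
        have eQ: "e \<subseteq> verts Q" using Q e by (auto simp: r_graph_def)
        fix x y assume xy: "x \<in> e" "y \<in> e" "(h \<circ> F) x = (h \<circ> F) y"
        then have xyQ: "x \<in> verts Q" "y \<in> verts Q" using eQ by auto
        have "\<sigma> (\<kappa> x) = \<sigma> (\<kappa> y)" using col[OF xyQ(1)] col[OF xyQ(2)] xy(3) by simp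
        moreover have "inj_on \<sigma> {1..l}" using \<sigma> by (simp add: bij_betw_def)
        ultimately have "\<kappa> x = \<kappa> y" using \<kappa>l[OF xyQ(1)] \<kappa>l[OF xyQ(2)] by (auto dest: inj_onD)
        moreover have "inj_on \<kappa> e" using \<kappa> e by (simp add: proper_coloring_def)
        ultimately show "x = y" using xy by (auto dest: inj_onD)
      qed
      ultimately have "F \<in> ?R" by blast
      then show "(\<lambda>x. if x \<in> e0 then b x else f x) \<in> ?R" unfolding F_def .
    qed
  qed
  finally show ?thesis unfolding cX s_def .
qed

text \<open>For each edge \<open>a\<close> missing from \<open>E\<close>, consider the copies of
  \<open>Q\<close> in \<open>T\<close> that send \<open>e0\<close> to \<open>a\<close>. These
  families are disjoint for different \<open>a\<close>, and disjoint from the copies inside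
  \<open>E\<close>.\<close>

lemma card_missing_edges:
  assumes V: "finite V" and h: "\<And>x. x \<in> V \<Longrightarrow> h x < l" "\<And>j. j < l \<Longrightarrow> q \<le> card {x \<in> V. h x = j}"
    and Q: "r_graph r Q" and \<kappa>: "proper_coloring l Q \<kappa>" and e0: "e0 \<in> edges Q" and vq: "vcard Q \<le> q"
  defines "T \<equiv> {e. e \<subseteq> V \<and> card e = r \<and> inj_on h e}"
  assumes E: "E \<subseteq> T"
  shows "card (T - E) * (q - vcard Q) ^ (vcard Q - r) + inj_count Q (V, E) \<le> inj_count Q (V, T)"
proof -
  let ?S = "\<lambda>a. {f \<in> verts Q \<rightarrow>\<^sub>E V. inj_on f (verts Q) \<and> f ` e0 = a
    \<and> (\<forall>e\<in>edges Q. inj_on (h \<circ> f) e)}"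
  let ?I = "\<lambda>E. {f \<in> verts Q \<rightarrow>\<^sub>E V. inj_on f (verts Q) \<and> homomorphism f Q (V, E)}"
  note fQ = finite_verts[OF Q]
  have fT: "finite T" unfolding T_def using V by simp
  have fPi: "finite (verts Q \<rightarrow>\<^sub>E V)" using fQ V by (intro finite_PiE) auto
  have "(\<Sum>a\<in>T - E. (q - vcard Q) ^ (vcard Q - r)) \<le> (\<Sum>a\<in>T - E. card (?S a))"
    by (intro sum_mono card_copies_through_edge[OF V h Q \<kappa> e0 _ _ _ vq]) (auto simp: T_def)
  also have "\<dots> = card (\<Union>a\<in>T - E. ?S a)"
    by (rule card_UN_disjoint[symmetric]) (use fT fPi in auto)
  finally have "card (T - E) * (q - vcard Q) ^ (vcard Q - r) + card (?I E) \<le>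
      card (\<Union>a\<in>T - E. ?S a) + card (?I E)" by simp
  also have "\<dots> = card ((\<Union>a\<in>T - E. ?S a) \<union> ?I E)"
  proof (rule card_Un_disjoint[symmetric])
    show "finite (\<Union>a\<in>T - E. ?S a)" using fT fPi by auto
    show "finite (?I E)" using fPi by auto
    show "(\<Union>a\<in>T - E. ?S a) \<inter> ?I E = {}" using e0 by (auto simp: homomorphism_def)
  qed
  also have "\<dots> \<le> card (?I T)"
  proof (rule card_mono)
    show "finite (?I T)" using fPi by auto
    have "?I E \<subseteq> ?I T" using E by (auto simp: homomorphism_def)
    moreover have "?S a \<subseteq> ?I T" for a
    proof clarify
      fix f assume f: "f \<in> verts Q \<rightarrow>\<^sub>E V" "inj_on f (verts Q)" "\<forall>e\<in>edges Q. inj_on (h \<circ> f) e"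
      have "f ` e \<in> T" if e: "e \<in> edges Q" for e
      proof -
        have eQ: "e \<subseteq> verts Q" "card e = r" using Q e by (auto simp: r_graph_def)
        have "inj_on f e" using f(2) eQ by (auto intro: inj_on_subset)
        moreover have "inj_on h (f ` e)" using f(3) e by (auto intro: inj_on_imageI)
        ultimately show ?thesis using eQ f(1) by (auto simp: T_def card_image)
      qed
      then show "homomorphism f Q (V, T)" using f(1) by (auto simp: homomorphism_def)
    qed
    ultimately show "(\<Union>a\<in>T - E. ?S a) \<union> ?I E \<subseteq> ?I T" by blast
  qed
  finally show ?thesis by (simp add: inj_count_def)
qed

section \<open>Turan stability of the expansion\<close>

lemma card_bij_residue_class_ge:
  assumes g: "bij_betw g V {1..n}" and j: "j < l"
  shows "n div l \<le> card {x \<in> V. g x mod l = j}"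
proof -
  have "bij_betw g {x \<in> V. g x mod l = j} {y \<in> {1..n}. y mod l = j}"
    using g by (auto simp: bij_betw_def inj_on_def)
  then show ?thesis using card_residue_class_ge[OF j, of n] by (simp add: bij_betw_same_card)
qed

lemma isomorphic_turan:
  assumes g: "bij_betw g V {1..n}"
  shows "isomorphic (V, {e. e \<subseteq> V \<and> card e = r \<and> inj_on (\<lambda>x. g x mod l) e}) (turan_r_graph r n l)"
proof -
  let ?T = "{e. e \<subseteq> V \<and> card e = r \<and> inj_on (\<lambda>x. g x mod l) e}"
  have gi: "inj_on g e" if "e \<subseteq> V" for e using g that by (auto simp: bij_betw_def intro:
    inj_on_subset)
  have mod: "inj_on (\<lambda>x. g x mod l) e \<longleftrightarrow> inj_on (\<lambda>y. y mod l) (g ` e)" if "e \<subseteq> V" for e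
    using comp_inj_on_iff[OF gi[OF that], of "\<lambda>y. y mod l"] by (simp add: comp_def)
  have "(\<lambda>e. g ` e) ` ?T = edges (turan_r_graph r n l)"
  proof
    show "(\<lambda>e. g ` e) ` ?T \<subseteq> edges (turan_r_graph r n l)"
    proof (rule image_subsetI)
      fix e assume e: "e \<in> ?T"
      then have "g ` e \<subseteq> {1..n}" using g by (auto simp: bij_betw_def)
      then show "g ` e \<in> edges (turan_r_graph r n l)"
        using e gi[of e] mod[of e] by (simp add: turan_r_graph_def card_image)
    qed
    show "edges (turan_r_graph r n l) \<subseteq> (\<lambda>e. g ` e) ` ?T"
    proof
      fix d assume d: "d \<in> edges (turan_r_graph r n l)"
      then have "d \<subseteq> g ` V" using g by (simp add: turan_r_graph_def bij_betw_def)
      then obtain e where e: "e \<subseteq> V" "d = g ` e" by (rule subset_imageE)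
      then have "e \<in> ?T" using d gi[OF e(1)] mod[OF e(1)] by (simp add: turan_r_graph_def
        card_image)
      then show "d \<in> (\<lambda>e. g ` e) ` ?T" using e(2) by blast
    qed
  qed
  then show ?thesis using g by (auto simp: isomorphic_def turan_r_graph_def)
qed

lemma expansion_turan_stable:
  fixes F :: "'b hypergraph"
  assumes r: "2 \<le> r" and l: "2 \<le> l" and Q: "r_graph r Q"
    and F: "r_graph 2 F" "chromatic_number F = l + 1"
    and turan: "turan_stable 2 l (pair_shadow Q) (clique (l + 1))"
  shows "turan_stable r l Q (expansion r F)"
  unfolding turan_stable_iff
proof (intro allI impI)
  fix \<epsilon> :: real assume \<epsilon>: "0 < \<epsilon>"
  let ?P = "pair_shadow Q" and ?K = "clique (l + 1)"
  let ?X = "expansion r F"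
  let ?C = "real (card (edges Q) * r ^ r)"
  have P: "r_graph 2 ?P" using Q by (rule r_graph_pair_shadow)
  note fQ = finite_verts[OF Q]
  define v where "v = vcard Q"
  have l1: "1 \<le> l" using l by simp
  have stable: "edge_stable 2 ?P {?K} (colorable_family 2 l)"
    by (rule turan_stable_imp_edge_stable[OF turan l1])
  have rstable: "edge_stable r Q {?X} (colorable_family r l)"
    by (rule expansion_edge_stable[OF r l1 Q F stable])
  obtain m where m: "0 < m" "0 < inj_max 2 m ?P {?K}" and Pne: "edges ?P \<noteq> {}"
    using turan_stable_nontrivial[OF turan l P] by blast
  obtain c where c: "0 < c" "\<And>n. m \<le> n \<Longrightarrow> c * real n ^ v \<le> real (inj_max 2 n ?P {?K})"
    using inj_max_order_of_magnitude[OF P _ m] l unfolding v_def verts_pair_shadow by auto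
  obtain \<kappa> where \<kappa>P: "proper_coloring l ?P \<kappa>"
    using stable_imp_colorable[OF P l1 stable c(1), of m] c(2) unfolding v_def verts_pair_shadow
      by blast
  have \<kappa>: "proper_coloring l Q \<kappa>"
  proof -
    have "inj_on \<kappa> e" if e: "e \<in> edges Q" for e
    proof (rule inj_on_if_pairs)
      fix p assume "p \<subseteq> e" "card p = 2"
      then have "p \<in> edges ?P" using e by (auto simp: pair_shadow_def)
      then show "inj_on \<kappa> p" using \<kappa>P by (simp add: proper_coloring_def)
    qed
    then show ?thesis using \<kappa>P by (simp add: proper_coloring_def)
  qed
  obtain e0 where e0: "e0 \<in> edges Q" using Pne by (auto simp: pair_shadow_def)
  have rv: "r \<le> v" using Q e0 unfolding v_def r_graph_def by (metis card_mono)
  \<comment> \<open>By \<open>card_copies_through_edge\<close>, each edge of the Turan hypergraph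
    lies in at least c1 n ^ (v - r) copies, once its parts have been seen to retain n / (2 l) usable
    vertices.\<close>
  define c1 where "c1 = (1 / (2 * real l)) ^ (v - r)"
  have c1: "0 < c1" using l by (simp add: c1_def)
  \<comment> \<open>The deletions may use half of \<epsilon>. The copies they destroy and the slack
    \<delta> n ^ v together stay below (\<epsilon> / 2) c1 n ^ v, which leaves room for at most
    (\<epsilon> / 2) n ^ r missing edges.\<close>
  obtain \<epsilon>3 where \<epsilon>3: "0 < \<epsilon>3" "\<epsilon>3 \<le> \<epsilon> / 2" "?C * \<epsilon>3 < \<epsilon> * c1 / 4"
    using small_real_exists[of "\<epsilon> / 2" "\<epsilon> * c1 / 4" ?C] \<epsilon> c1 by auto
  obtain \<delta>2 N2 where \<delta>2: "0 < \<delta>2" and N2: "near_max_imp 2 ?P {?K} \<delta>2 N2 (turan_close 2 l (\<epsilon>3 / 2))"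
    using turan[unfolded turan_stable_iff, rule_format, OF half_gt_zero[OF \<epsilon>3(1)]]
      by (elim exE conjE)
  note N2 = N2[rule_format]
  \<comment> \<open>Three losses of \<theta> n ^ v amount to \<delta>2 c n ^ v, at most a fraction
    \<delta>2 of the extremal number. This conversion to a relative error relies on the lower bound
    by \<open>c\<close>.\<close>
  define \<theta> where "\<theta> = \<delta>2 * c / 3"
  have \<theta>: "0 < \<theta>" using \<delta>2 c by (simp add: \<theta>_def)
  obtain \<epsilon>4 where \<epsilon>4: "0 < \<epsilon>4" "\<epsilon>4 \<le> \<epsilon>3 / 2" "?C * \<epsilon>4 < \<theta>"
    using small_real_exists[of "\<epsilon>3 / 2" \<theta> ?C] \<epsilon>3 \<theta> by auto
  obtain \<delta>4 N4 where \<delta>4: "0 < \<delta>4" and N4: "near_max_imp r Q {?X} \<delta>4 N4 (deletion_close r \<epsilon>4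
    (colorable_family r l))"
    using rstable[unfolded edge_stable_iff, rule_format, OF \<epsilon>4(1)] by (elim exE conjE)
  note N4 = N4[rule_format]
  obtain N5 where N5: "\<And>n. N5 \<le> n \<Longrightarrow> real (inj_max 2 n ?P {?K}) - \<theta> * real n ^ v
    \<le> real (inj_max r n Q {?X})"
    using inj_max_expansion_ge[OF r l1 Q F stable \<theta>] unfolding v_def by blast
  define \<delta> where "\<delta> = min \<delta>4 (min \<theta> (\<epsilon> * c1 / 4))"
  have \<delta>: "0 < \<delta>" using \<delta>4 \<theta> \<epsilon> c1 by (simp add: \<delta>_def)
  have \<delta>': "\<delta> \<le> \<delta>4" "\<delta> \<le> \<theta>" "\<delta> \<le> \<epsilon> * c1 / 4" by (simp_all add: \<delta>_def)
  define N0 where "N0 = m + N2 + N4 + N5 + 2 * l * (v + 1)"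
  have N0: "m \<le> N0" "N2 \<le> N0" "N4 \<le> N0" "N5 \<le> N0" "2 * l * (v + 1) \<le> N0" unfolding N0_def
    by linarith+
  have main: "\<exists>D A. D \<subseteq> edges H \<and> A \<subseteq> {e. e \<subseteq> verts H \<and> card e = r} - edges H \<and>
             real (card D + card A) \<le> \<epsilon> * real n ^ r \<and>
             isomorphic (verts H, (edges H - D) \<union> A) (turan_r_graph r n l)"
    if n0: "N0 \<le> n" and H: "r_graph r H" "vcard H = n" "free_of {?X} H"
      and near: "(1 - \<delta>) * real (inj_max r n Q {?X}) \<le> real (inj_count Q H)" for n
        and H :: "nat hypergraph"
  proof -
    have n: "m \<le> n" "N2 \<le> n" "N4 \<le> n" "N5 \<le> n" "2 * l * (v + 1) \<le> n" using n0 N0 by linarith+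
    note fV = finite_verts[OF H(1)]
    have near': "real (inj_max r n Q {?X}) - \<delta> * real n ^ v \<le> real (inj_count Q H)"
      unfolding v_def using edges_nonempty_if_chromatic[of F] F(2) l
      by (intro inj_max_additive_slack[OF fQ _ \<delta> near]) (auto intro!: edges_expansion_nonempty)
    have "(1 - \<delta>4) * real (inj_max r n Q {?X}) \<le> (1 - \<delta>) * real (inj_max r n Q {?X})"
      using \<delta>' by (intro mult_right_mono) auto
    then have "(1 - \<delta>4) * real (inj_max r n Q {?X}) \<le> real (inj_count Q H)" using near by linarith
    then obtain D1 where D1: "D1 \<subseteq> edges H" "real (card D1) \<le> \<epsilon>4 * real (vcard H) ^ r"
      "(verts H, edges H - D1) \<in> colorable_family r l"
      using N4[OF H(1) _ H(3)] H(2) n by auto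
    let ?H1 = "(verts H, edges H - D1)"
    let ?G = "pair_shadow ?H1"
    have rH1: "r_graph r ?H1" by (rule r_graph_subset[OF H(1)]) auto
    have rG: "r_graph 2 ?G" using rH1 by (rule r_graph_pair_shadow)
    obtain d where d: "proper_coloring l ?H1 d" using D1(3) by (auto simp: colorable_family_iff)
    have "proper_coloring l ?G d"
      using d by (auto simp: proper_coloring_def pair_shadow_def intro: inj_on_subset)
    then have freeG: "free_of {?K} ?G" using rG by (rule complete_free_if_colorable)
    have "(1 - \<delta>2) * real (inj_max 2 n ?P {?K}) \<le> real (inj_count ?P ?G)"
    proof -
      have "real (inj_count Q H) \<le> real (inj_count Q ?H1) + ?C * \<epsilon>4 * real (vcard H) ^ vcard Q"
        by (rule inj_count_delete_real[OF Q H(1) D1(1,2)])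
      moreover have "?C * \<epsilon>4 * real (vcard H) ^ vcard Q \<le> \<theta> * real n ^ v"
        unfolding H(2) v_def using \<epsilon>4 by (intro mult_right_mono) auto
      moreover have "inj_count Q ?H1 \<le> inj_count ?P ?G"
        by (rule inj_count_pair_shadow_ge[OF fQ]) (use fV Q in \<open>auto simp: pair_shadow_def
          r_graph_def\<close>)
      then have "real (inj_count Q ?H1) \<le> real (inj_count ?P ?G)" by simp
      moreover have "\<delta> * real n ^ v \<le> \<theta> * real n ^ v" using \<delta>' by (intro mult_right_mono) auto
      moreover have "3 * (\<theta> * real n ^ v) \<le> \<delta>2 * real (inj_max 2 n ?P {?K})"
      proof -
        have "3 * (\<theta> * real n ^ v) = \<delta>2 * (c * real n ^ v)" by (simp add: \<theta>_def)
        also have "\<dots> \<le> \<delta>2 * real (inj_max 2 n ?P {?K})" using c(2)[OF n(1)] \<delta>2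
          by (intro mult_left_mono) auto
        finally show ?thesis .
      qed
      moreover have "(1 - \<delta>2) * real (inj_max 2 n ?P {?K}) = real (inj_max 2 n ?P {?K}) - \<delta>2 *
        real (inj_max 2 n ?P {?K})"
        by (simp add: algebra_simps)
      ultimately show ?thesis using near' N5[OF n(4)] by linarith
    qed
    then obtain D2 A2 where D2: "D2 \<subseteq> edges ?G" "real (card D2 + card A2)
      \<le> \<epsilon>3 / 2 * real (vcard ?G) ^ 2"
      "isomorphic (verts ?G, (edges ?G - D2) \<union> A2) (turan_r_graph 2 (vcard ?G) l)"
      using N2[OF rG _ freeG] H(2) n by auto
    obtain g where g: "bij_betw g (verts ?G) {1..vcard ?G}"
      and "(\<lambda>e. g ` e) ` ((edges ?G - D2) \<union> A2) = edges (turan_r_graph 2 (vcard ?G) l)"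
      and gp: "\<And>p. p \<in> (edges ?G - D2) \<union> A2 \<Longrightarrow> p \<subseteq> verts ?G \<Longrightarrow> inj_on (\<lambda>x. g x mod l) p"
      by (rule turan_isomorphismE[OF D2(3)]) (rule that, assumption, assumption, blast)
    have gV: "bij_betw g (verts H) {1..n}" using g by (simp add: H(2))
    let ?h = "\<lambda>x. g x mod l"
    \<comment> \<open>The Turan hypergraph on the parts found for the shadow. It is the target:
      \<open>D\<close> and \<open>A\<close> are its differences from \<open>H\<close>.\<close>
    define T where "T = {e. e \<subseteq> verts H \<and> card e = r \<and> inj_on ?h e}"
    define D where "D = edges H - T"
    define A where "A = T - edges H"
    let ?L2 = "{e \<in> edges H. \<exists>p\<in>D2. p \<subseteq> e}"
    have "D \<subseteq> D1 \<union> ?L2"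
    proof
      fix e assume e: "e \<in> D"
      show "e \<in> D1 \<union> ?L2"
      proof (rule ccontr)
        assume no: "e \<notin> D1 \<union> ?L2"
        have eH: "e \<in> edges H" "e \<notin> T" using e by (auto simp: D_def)
        then have eV: "e \<subseteq> verts H" "card e = r" using H(1) by (auto simp: r_graph_def)
        have "inj_on ?h e"
        proof (rule inj_on_if_pairs)
          \<comment> \<open>An edge that survives \<open>D1\<close> and covers no pair of
            \<open>D2\<close> has all its pairs in the modified shadow, so it meets each part at
            most once.\<close>
          fix p assume p: "p \<subseteq> e" "card p = 2"
          then have "p \<in> edges ?G - D2" using eH no by (auto simp: pair_shadow_def)
          then show "inj_on ?h p" using gp[of p] p eV by auto
        qed
        then show False using eH eV by (simp add: T_def)
      qed
    qed
    moreover have fL2: "finite (D1 \<union> ?L2)"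
      using finite_edges[OF H(1)] D1(1) finite_subset by auto
    ultimately have "card D \<le> card D1 + card ?L2"
      using card_mono[of "D1 \<union> ?L2" D] card_Un_le[of D1 ?L2] by linarith
    moreover have "real (card ?L2) \<le> \<epsilon>3 / 2 * real (vcard H) ^ r"
    proof (rule card_edges_over_pairs_real[OF H(1) _ _ r])
      show "finite D2" using D2(1) finite_edges[OF rG] finite_subset by blast
      show "\<And>p. p \<in> D2 \<Longrightarrow> p \<subseteq> verts H \<and> card p = 2" using D2(1) rG by (auto simp: r_graph_def)
    qed (use D2(2) in simp)
    moreover have "\<epsilon>4 * real n ^ r \<le> \<epsilon>3 / 2 * real n ^ r" using \<epsilon>4 by (intro mult_right_mono) auto
    ultimately have cD: "real (card D) \<le> \<epsilon>3 * real (vcard H) ^ r"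
      using D1(2) unfolding H(2) by (simp add: field_simps)
    have AT: "A = T - (edges H - D)" by (auto simp: A_def D_def)
    have DT: "edges H - D \<subseteq> T" by (auto simp: D_def)
    have ETD: "(edges H - D) \<union> A = T" by (auto simp: A_def D_def)
    let ?q = "n div l"
    have lq: "real n / (2 * real l) \<le> real (?q - v)" and vq: "v \<le> ?q"
    proof -
      have "2 * (v + 1) * l \<le> n" using n(5) by (simp add: mult_ac)
      then have q2: "2 * (v + 1) \<le> ?q" using l by (simp add: less_eq_div_iff_mult_less_eq)
      then show "v \<le> ?q" by simp
      \<comment> \<open>The additional 1 absorbs the remainder of \<open>n\<close> modulo
        \<open>l\<close>.\<close>
      have half: "q + 1 \<le> 2 * (q - v)" if "2 * (v + 1) \<le> q" for q using that by arith
      have "n = l * ?q + n mod l" "n mod l < l" using l by simp_all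
      then have "n \<le> l * ?q + l" by linarith
      also have "\<dots> = l * (?q + 1)" by simp
      also have "\<dots> \<le> l * (2 * (?q - v))" by (rule mult_le_mono2[OF half[OF q2]])
      finally have "real n \<le> real (l * (2 * (?q - v)))" by (rule of_nat_mono)
      then have "real n \<le> real (?q - v) * (2 * real l)" by (simp add: mult_ac)
      then show "real n / (2 * real l) \<le> real (?q - v)" using l by (simp add: field_simps)
    qed
    \<comment> \<open>The Turan hypergraph is itself admissible, so it has at most the extremal
      number of copies; this caps the copies gained by filling in missing edges.\<close>
    have "inj_count Q (verts H, T) \<le> inj_max r n Q {?X}"
    proof (rule inj_max_ge[OF fQ])
      show "r_graph r (verts H, T)" using fV by (auto simp: r_graph_def T_def)
      have "proper_coloring l (verts H, T) (\<lambda>x. ?h x + 1)"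
        using l by (auto simp: proper_coloring_def T_def inj_on_def Suc_le_eq)
      then show "free_of {?X} (verts H, T)" using F by (intro expansion_free_if_colorable) auto
    qed (simp add: H(2))
    moreover have "card A * (?q - v) ^ (v - r) + inj_count Q (verts H, edges H - D)
      \<le> inj_count Q (verts H, T)"
      unfolding AT T_def v_def
      by (rule card_missing_edges[OF fV _ _ Q \<kappa> e0])
        (use l vq DT card_bij_residue_class_ge[OF gV] in \<open>simp_all add: v_def T_def\<close>)
    ultimately have "real (card A * (?q - v) ^ (v - r) + inj_count Q (verts H, edges H - D))
      \<le> real (inj_max r n Q {?X})"
      by (intro of_nat_mono) linarith
    then have up: "real (card A) * real (?q - v) ^ (v - r) + real (inj_count Q (verts H, edges H -
      D)) \<le> real (inj_max r n Q {?X})"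
      by simp
    have "real (inj_count Q H) \<le> real (inj_count Q (verts H, edges H - D)) + ?C * \<epsilon>3 * real (vcard
      H) ^ vcard Q"
      by (rule inj_count_delete_real[OF Q H(1) _ cD]) (auto simp: D_def)
    moreover have "?C * \<epsilon>3 * real (vcard H) ^ vcard Q \<le> \<epsilon> * c1 / 4 * real n ^ v"
      unfolding H(2) v_def using \<epsilon>3 by (intro mult_right_mono) auto
    moreover have "\<delta> * real n ^ v \<le> \<epsilon> * c1 / 4 * real n ^ v" using \<delta>'
      by (intro mult_right_mono) auto
    ultimately have "real (card A) * real (?q - v) ^ (v - r) \<le> \<epsilon> * c1 / 4 * real n ^ v + \<epsilon> * c1 /
      4 * real n ^ v"
      using up near' by linarith
    also have "\<dots> = (\<epsilon> / 2 * real n ^ r) * (c1 * real n ^ (v - r))"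
      using rv by (simp add: field_simps flip: power_add)
    finally have a1: "real (card A) * real (?q - v) ^ (v - r)
      \<le> (\<epsilon> / 2 * real n ^ r) * (c1 * real n ^ (v - r))" .
    have "c1 * real n ^ (v - r) = (real n / (2 * real l)) ^ (v - r)"
      by (simp add: c1_def power_divide power_mult_distrib)
    also have "\<dots> \<le> real (?q - v) ^ (v - r)" using lq by (intro power_mono) auto
    finally have "real (card A) * (c1 * real n ^ (v - r)) \<le> (\<epsilon> / 2 * real n ^ r) * (c1 * real n ^
      (v - r))"
      using a1 by (meson mult_left_mono of_nat_0_le_iff order_trans)
    moreover have "0 < n" using n(1) m(1) by simp
    then have "0 < c1 * real n ^ (v - r)" using c1 by simp
    ultimately have cA: "real (card A) \<le> \<epsilon> / 2 * real n ^ r" by (simp only: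
      mult_le_cancel_right_pos)
    have "\<epsilon>3 * real n ^ r \<le> \<epsilon> / 2 * real n ^ r" using \<epsilon>3 by (intro mult_right_mono) auto
    then have "real (card D + card A) \<le> \<epsilon> * real n ^ r" using cD cA unfolding H(2) by simp
    moreover have "isomorphic (verts H, (edges H - D) \<union> A) (turan_r_graph r n l)"
      unfolding ETD T_def by (rule isomorphic_turan[OF gV])
    moreover have "D \<subseteq> edges H" "A \<subseteq> {e. e \<subseteq> verts H \<and> card e = r} - edges H"
      by (auto simp: D_def A_def T_def)
    ultimately show ?thesis by blast
  qed
  show "\<exists>\<delta>>0. \<exists>N. near_max_imp r Q {?X} \<delta> N (turan_close r l \<epsilon>)"
    by (rule exI[of _ \<delta>], rule conjI[OF \<delta>], rule exI[of _ N0], intro allI impI, rule main) simp_all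
qed

theorem theorem8p1:
  fixes l r :: nat and Q :: "'a hypergraph" and F :: "'b hypergraph"
  assumes "2 \<le> r" and "r \<le> l"
    and "r_graph r Q"
    and "r_graph 2 F" and "chromatic_number F = l + 1"
  shows "(edge_stable 2 (pair_shadow Q) {complete_r_graph 2 (l + 1)} (colorable_family 2 l) \<longrightarrow>
            edge_stable r Q {expansion r F} (colorable_family r l)) \<and>
         (turan_stable 2 l (pair_shadow Q) (complete_r_graph 2 (l + 1)) \<longrightarrow>
            turan_stable r l Q (expansion r F))"
proof -
  have "1 \<le> l" "2 \<le> l" using assms(1,2) by auto
  then show ?thesis
    using expansion_edge_stable[OF assms(1) _ assms(3-5)] expansion_turan_stable[OF assms(1) _
      assms(3-5)]
    by blast
qed

end
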